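(* Let $A$ be any formula of $\mathsf{PA}^{\unlhd}$ built from atomic formulas using $\neg$, $\vee$, bounded universal quantifiers $\forall z \unlhd t$, and unbounded universal quantifiers $\forall z$ (and, optionally, $\wedge$ treated as a primitive symbol). Write its Shoenfield-like bounded functional interpretation as $A^U \equiv \tilde\forall \underline{x}\, \tilde\exists \underline{y}\, A_U(\underline{x},\underline{y})$. Then the bounded functional interpretation of its Krivine negative translation has the form $(A^K)^B \equiv \tilde\exists \underline{Y}\, \tilde\forall \underline{x}\, (A^K)_B(\underline{Y},\underline{x})$, where $\underline{x}$ is a tuple of variables of the same types as the tuple $\underline{x}$ in $A^U$ and $\underline{Y}$ is a tuple of variables with $\underline{Y}\underline{x}$ of the same types as $\underline{y}$, and: 1. $\mathsf{HA}^{\unlhd} + \mathsf{BLEM} \vdash \tilde\forall \underline{Y},\underline{x}\, [A_U(\underline{x},\underline{Y}\underline{x}) \leftrightarrow (A^K)_B(\underline{Y},\underline{x})]$; 2. $\mathsf{HA}^{\unlhd} + \mathsf{BLEM} + \mathsf{bMAC} \vdash A^U \leftrightarrow (A^K)^B$.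
   Context: $\mathsf{HA}$ is Heyting arithmetic in all finite types (with a minimal treatment of equality and no extensionality, as in Troelstra). $\mathsf{HA}^{\unlhd}$ (Heyting arithmetic with majorizability) is obtained from $\mathsf{HA}$ by: adding atomic formulas $t \unlhd_\rho q$ for every finite type $\rho$ ($t,q$ terms of type $\rho$); adding bounded quantifiers $\forall x \unlhd t\, A$ and $\exists x \unlhd t\, A$ ($x$ not occurring in $t$) with axioms $\forall x \unlhd t\, A \leftrightarrow \forall x (x \unlhd t \to A)$ and $\exists x \unlhd t\, A \leftrightarrow \exists x (x \unlhd t \wedge A)$; adding the axioms $x \unlhd_0 y \leftrightarrow x \le_0 y$ and $x \unlhd y \to \forall u \unlhd v (xu \unlhd yv \wedge yu \unlhd yv)$ and the rule: from $A_b \wedge u \unlhd v \to tu \unlhd qv \wedge qu \unlhd qv$ infer $A_b \to t \unlhd q$ (for bounded $A_b$, with $u,v$ not free in $A_b,t,q$); and extending induction to the new formulas. $\mathsf{PA}^{\unlhd}$ is the classical counterpart. A formula is bounded if all its quantifiers are bounded. Notation: underlined letters denote (possibly empty) tuples; $\underline{t}\unlhd\underline{t}$ means $t_1\unlhd t_1\wedge\dots\wedge t_n \unlhd t_n$; $\tilde\forall \underline{x} A :\equiv \forall \underline{x}(\underline{x}\unlhd\underline{x} \to A)$, $\tilde\exists \underline{x} A :\equiv \exists \underline{x}(\underline{x}\unlhd\underline{x}\wedge A)$, $\tilde\forall \underline{x}\unlhd\underline{t}\, A :\equiv \forall \underline{x}\unlhd \underline{t}(\underline{x}\unlhd\underline{x}\to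 A)$, $\tilde\exists \underline{x}\unlhd\underline{t}\, A :\equiv \exists \underline{x}\unlhd \underline{t}(\underline{x}\unlhd\underline{x}\wedge A)$. $\mathsf{BLEM}$: $A_b \vee \neg A_b$ for all bounded $A_b$. $\mathsf{bMAC}$: $\tilde\forall \underline{x}\,\tilde\exists \underline{y}\, A_b(\underline{x},\underline{y}) \to \tilde\exists \underline{Y}\,\tilde\forall \underline{x}\,\tilde\exists \underline{y}\unlhd \underline{Y}\underline{x}\, A_b(\underline{x},\underline{y})$ for bounded $A_b$. Krivine negative translation: $A^K :\equiv \neg A_K$, where $A_K :\equiv \neg A$ for atomic $A$; $(\neg A)_K :\equiv \neg A_K$; $(A\vee B)_K :\equiv A_K \wedge B_K$; $(\forall x\unlhd t A)_K :\equiv \exists x \unlhd t A_K$; $(\forall x A)_K :\equiv \exists x A_K$; if $\wedge$ is primitive, $(A\wedge B)_K :\equiv A_K \vee B_K$. Bounded functional interpretation $B$ (for formulas of $\mathsf{HA}^{\unlhd}$ built from atomic formulas, $\bot,\wedge,\vee,\to,\forall\unlhd,\exists\unlhd,\forall,\exists$): $A^B \equiv \tilde\exists\underline{x}\,\tilde\forall\underline{y}\, A_B(\underline{x},\underline{y})$, defined inductively. For atomic $A$: $A^B :\equiv A_B :\equiv A$ with empty tuples. If $A^B \equiv \tilde\exists\underline{x}\tilde\forall\underline{y} A_B(\underline{x},\underline{y})$ and $B^B\equiv \tilde\exists\underline{x'}\tilde\forall\underline{y'} B_B(\underline{x'},\underline{y'})$, then: $(A\wedge B)^B :\equiv \tilde\exists\underline{x},\underline{x'}\tilde\forall\underline{y},\underline{y'}[A_B(\underline{x},\underline{y})\wedge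 B_B(\underline{x'},\underline{y'})]$; $(A\vee B)^B :\equiv \tilde\exists\underline{x},\underline{x'}\tilde\forall\underline{y},\underline{y'}[\tilde\forall\underline{\tilde y}\unlhd\underline{y} A_B(\underline{x},\underline{\tilde y})\vee \tilde\forall\underline{\tilde y'}\unlhd\underline{y'} B_B(\underline{x'},\underline{\tilde y'})]$; $(A\to B)^B :\equiv \tilde\exists\underline{X'},\underline{Y}\tilde\forall\underline{x},\underline{y'}[\tilde\forall\underline{y}\unlhd\underline{Y}\underline{x}\underline{y'} A_B(\underline{x},\underline{y}) \to B_B(\underline{X'}\underline{x},\underline{y'})]$; $(\forall z\unlhd t A)^B :\equiv \tilde\exists\underline{x}\tilde\forall\underline{y}\forall z\unlhd t A_B(\underline{x},\underline{y})$; $(\exists z\unlhd t A)^B :\equiv \tilde\exists\underline{x}\tilde\forall\underline{y}\exists z\unlhd t\tilde\forall\underline{\tilde y}\unlhd\underline{y} A_B(\underline{x},\underline{\tilde y})$; $(\forall z A)^B :\equiv \tilde\exists\underline{X}\tilde\forall w,\underline{y}\forall z\unlhd w A_B(\underline{X}w,\underline{y})$; $(\exists z A)^B :\equiv \tilde\exists w,\underline{x}\tilde\forall\underline{y}\exists z\unlhd w\tilde\forall\underline{\tilde y}\unlhd\underline{y} A_B(\underline{x},\underline{\tilde y})$; in each case the matrix after the displayed $\tilde\exists\,\tilde\forall$ prefix is by definition the corresponding $(\cdot)_B$. In particular $(\neg A)^B \equiv \tilde\exists\underline{Y}\tilde\forall\underline{x}\,\neg\tilde\forall\underline{y}\unlhd\underline{Y}\underline{x}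 A_B(\underline{x},\underline{y})$ with $(\neg A)_B(\underline{Y},\underline{x}) \equiv \neg\tilde\forall\underline{y}\unlhd\underline{Y}\underline{x} A_B(\underline{x},\underline{y})$ (taking $\neg C :\equiv C\to\bot$). Shoenfield-like bounded functional interpretation $U$ (for formulas of $\mathsf{PA}^{\unlhd}$ built from $\neg,\vee,\forall\unlhd,\forall$, optionally $\wedge$): $A^U\equiv\tilde\forall\underline{x}\tilde\exists\underline{y} A_U(\underline{x},\underline{y})$, defined inductively. For atomic $A$: $A^U :\equiv A_U :\equiv A$ with empty tuples. If $A^U\equiv\tilde\forall\underline{x}\tilde\exists\underline{y}A_U(\underline{x},\underline{y})$ and $B^U\equiv\tilde\forall\underline{x'}\tilde\exists\underline{y'}B_U(\underline{x'},\underline{y'})$, then: $(\neg A)^U :\equiv \tilde\forall\underline{Y}\tilde\exists\underline{x}\,\tilde\exists\underline{\tilde x}\unlhd\underline{x}\neg A_U(\underline{\tilde x},\underline{Y}\underline{\tilde x})$; $(A\vee B)^U :\equiv \tilde\forall\underline{x},\underline{x'}\tilde\exists\underline{y},\underline{y'}[A_U(\underline{x},\underline{y})\vee B_U(\underline{x'},\underline{y'})]$; $(\forall z\unlhd t A)^U :\equiv \tilde\forall\underline{x}\tilde\exists\underline{y}\forall z\unlhd t A_U(\underline{x},\underline{y})$; $(\forall z A)^U :\equiv \tilde\forall w,\underline{x}\tilde\exists\underline{y}\forall z\unlhd w A_U(\underline{x},\underline{y})$; if $\wedge$ is primitive, $(A\wedge B)^U :\equiv \tilde\forall\underline{x},\underline{x'}\tilde\exists\underline{y},\underline{y'}[A_U(\underline{x},\underline{y})\wedge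 B_U(\underline{x'},\underline{y'})]$; again the matrix after the displayed prefix is by definition the corresponding $(\cdot)_U$. *)

theory Defs
  imports Main
begin

section \<open>Finite types, terms and formulas\<close>

text \<open>Variables are de Bruijn indices.  A context is the list of the types of the variables
  \<open>0, 1, 2, \<dots>\<close>, so a binder of type \<open>\<rho>\<close> extends a context \<open>\<Gamma>\<close> to \<open>\<rho> # \<Gamma>\<close>.  Terms contain no
  binders (the typed combinators take the place of abstraction), hence a term substituted
  below a quantifier only has to be lifted.\<close>

datatype ty = N | Fun ty ty

definition funs :: "ty list \<Rightarrow> ty \<Rightarrow> ty" where
  "funs \<rho>s \<tau> = foldr Fun \<rho>s \<tau>"

datatype tm =
    Var nat
  | Zero
  | Succ
  | Pi ty ty
  | Sigma ty ty ty
  | Rec ty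
  | App tm tm  (infixl "\<bullet>" 90)

inductive has_ty :: "ty list \<Rightarrow> tm \<Rightarrow> ty \<Rightarrow> bool" where
  "i < length \<Gamma> \<Longrightarrow> has_ty \<Gamma> (Var i) (\<Gamma> ! i)"
| "has_ty \<Gamma> Zero N"
| "has_ty \<Gamma> Succ (Fun N N)"
| "has_ty \<Gamma> (Pi \<rho> \<tau>) (funs [\<rho>, \<tau>] \<rho>)"
| "has_ty \<Gamma> (Sigma \<rho> \<sigma> \<tau>) (funs [funs [\<rho>, \<sigma>] \<tau>, Fun \<rho> \<sigma>, \<rho>] \<tau>)"
| "has_ty \<Gamma> (Rec \<rho>) (funs [\<rho>, funs [\<rho>, N] \<rho>, N] \<rho>)"
| "has_ty \<Gamma> t (Fun \<rho> \<tau>) \<Longrightarrow> has_ty \<Gamma> s \<rho> \<Longrightarrow> has_ty \<Gamma> (t \<bullet> s) \<tau>"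

text \<open>\<open>apps t [s\<^sub>1, \<dots>, s\<^sub>n] = t s\<^sub>1 \<dots> s\<^sub>n\<close>, and \<open>tapps\<close> is the application of a tuple
  to a tuple: \<open>Y x = Y\<^sub>1 x, \<dots>, Y\<^sub>m x\<close>.\<close>

definition apps :: "tm \<Rightarrow> tm list \<Rightarrow> tm" where
  "apps t ss = foldl App t ss"

definition tapps :: "tm list \<Rightarrow> tm list \<Rightarrow> tm list" where
  "tapps ts ss = map (\<lambda>t. apps t ss) ts"

text \<open>Equality is primitive at type \<open>N\<close> only.\<close>

datatype atm = Eq tm tm | Maj ty tm tm

datatype fm =
    Atom atm
  | Bot
  | And fm fm
  | Or fm fm
  | Imp fm fm
  | BAll ty tm fm
  | BEx ty tm fm
  | UAll ty fm
  | UEx ty fm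

abbreviation Neg :: "fm \<Rightarrow> fm" where
  "Neg A \<equiv> Imp A Bot"

abbreviation Iff :: "fm \<Rightarrow> fm \<Rightarrow> fm" where
  "Iff A B \<equiv> And (Imp A B) (Imp B A)"

text \<open>The formulas to which the Krivine translation and the interpretation \<open>U\<close> apply;
  negation and universal quantifiers are primitive there.\<close>

datatype pfm =
    PAtom atm
  | PNeg pfm
  | POr pfm pfm
  | PAnd pfm pfm
  | PBAll ty tm pfm
  | PUAll ty pfm

fun wf_atm :: "ty list \<Rightarrow> atm \<Rightarrow> bool" where
  "wf_atm \<Gamma> (Eq s t) \<longleftrightarrow> has_ty \<Gamma> s N \<and> has_ty \<Gamma> t N"
| "wf_atm \<Gamma> (Maj \<rho> s t) \<longleftrightarrow> has_ty \<Gamma> s \<rho> \<and> has_ty \<Gamma> t \<rho>"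

fun wf_fm :: "ty list \<Rightarrow> fm \<Rightarrow> bool" where
  "wf_fm \<Gamma> (Atom a) \<longleftrightarrow> wf_atm \<Gamma> a"
| "wf_fm \<Gamma> Bot \<longleftrightarrow> True"
| "wf_fm \<Gamma> (And A B) \<longleftrightarrow> wf_fm \<Gamma> A \<and> wf_fm \<Gamma> B"
| "wf_fm \<Gamma> (Or A B) \<longleftrightarrow> wf_fm \<Gamma> A \<and> wf_fm \<Gamma> B"
| "wf_fm \<Gamma> (Imp A B) \<longleftrightarrow> wf_fm \<Gamma> A \<and> wf_fm \<Gamma> B"
| "wf_fm \<Gamma> (BAll \<rho> t A) \<longleftrightarrow> has_ty \<Gamma> t \<rho> \<and> wf_fm (\<rho> # \<Gamma>) A"
| "wf_fm \<Gamma> (BEx \<rho> t A) \<longleftrightarrow> has_ty \<Gamma> t \<rho> \<and> wf_fm (\<rho> # \<Gamma>) A"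
| "wf_fm \<Gamma> (UAll \<rho> A) \<longleftrightarrow> wf_fm (\<rho> # \<Gamma>) A"
| "wf_fm \<Gamma> (UEx \<rho> A) \<longleftrightarrow> wf_fm (\<rho> # \<Gamma>) A"

fun wf_pfm :: "ty list \<Rightarrow> pfm \<Rightarrow> bool" where
  "wf_pfm \<Gamma> (PAtom a) \<longleftrightarrow> wf_atm \<Gamma> a"
| "wf_pfm \<Gamma> (PNeg A) \<longleftrightarrow> wf_pfm \<Gamma> A"
| "wf_pfm \<Gamma> (POr A B) \<longleftrightarrow> wf_pfm \<Gamma> A \<and> wf_pfm \<Gamma> B"
| "wf_pfm \<Gamma> (PAnd A B) \<longleftrightarrow> wf_pfm \<Gamma> A \<and> wf_pfm \<Gamma> B"
| "wf_pfm \<Gamma> (PBAll \<rho> t A) \<longleftrightarrow> has_ty \<Gamma> t \<rho> \<and> wf_pfm (\<rho> # \<Gamma>) A"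
| "wf_pfm \<Gamma> (PUAll \<rho> A) \<longleftrightarrow> wf_pfm (\<rho> # \<Gamma>) A"

fun bounded :: "fm \<Rightarrow> bool" where
  "bounded (Atom a) \<longleftrightarrow> True"
| "bounded Bot \<longleftrightarrow> True"
| "bounded (And A B) \<longleftrightarrow> bounded A \<and> bounded B"
| "bounded (Or A B) \<longleftrightarrow> bounded A \<and> bounded B"
| "bounded (Imp A B) \<longleftrightarrow> bounded A \<and> bounded B"
| "bounded (BAll \<rho> t A) \<longleftrightarrow> bounded A"
| "bounded (BEx \<rho> t A) \<longleftrightarrow> bounded A"
| "bounded (UAll \<rho> A) \<longleftrightarrow> False"
| "bounded (UEx \<rho> A) \<longleftrightarrow> False"


section \<open>Substitution\<close>

text \<open>Simultaneous substitution: \<open>\<sigma> i\<close> replaces the variable with index \<open>i\<close>.\<close>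

primrec tsubst :: "(nat \<Rightarrow> tm) \<Rightarrow> tm \<Rightarrow> tm" where
  "tsubst \<sigma> (Var i) = \<sigma> i"
| "tsubst \<sigma> Zero = Zero"
| "tsubst \<sigma> Succ = Succ"
| "tsubst \<sigma> (Pi \<rho> \<tau>) = Pi \<rho> \<tau>"
| "tsubst \<sigma> (Sigma \<rho> \<rho>' \<tau>) = Sigma \<rho> \<rho>' \<tau>"
| "tsubst \<sigma> (Rec \<rho>) = Rec \<rho>"
| "tsubst \<sigma> (t \<bullet> s) = tsubst \<sigma> t \<bullet> tsubst \<sigma> s"

definition lift_env :: "nat \<Rightarrow> nat \<Rightarrow> tm" where
  "lift_env n = (\<lambda>i. Var (i + n))"

abbreviation tlift :: "nat \<Rightarrow> tm \<Rightarrow> tm" where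
  "tlift n \<equiv> tsubst (lift_env n)"

definition up :: "(nat \<Rightarrow> tm) \<Rightarrow> nat \<Rightarrow> tm" where
  "up \<sigma> = (\<lambda>i. case i of 0 \<Rightarrow> Var 0 | Suc j \<Rightarrow> tlift 1 (\<sigma> j))"

primrec asubst :: "(nat \<Rightarrow> tm) \<Rightarrow> atm \<Rightarrow> atm" where
  "asubst \<sigma> (Eq s t) = Eq (tsubst \<sigma> s) (tsubst \<sigma> t)"
| "asubst \<sigma> (Maj \<rho> s t) = Maj \<rho> (tsubst \<sigma> s) (tsubst \<sigma> t)"

primrec fsubst :: "(nat \<Rightarrow> tm) \<Rightarrow> fm \<Rightarrow> fm" where
  "fsubst \<sigma> (Atom a) = Atom (asubst \<sigma> a)"
| "fsubst \<sigma> Bot = Bot"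
| "fsubst \<sigma> (And A B) = And (fsubst \<sigma> A) (fsubst \<sigma> B)"
| "fsubst \<sigma> (Or A B) = Or (fsubst \<sigma> A) (fsubst \<sigma> B)"
| "fsubst \<sigma> (Imp A B) = Imp (fsubst \<sigma> A) (fsubst \<sigma> B)"
| "fsubst \<sigma> (BAll \<rho> t A) = BAll \<rho> (tsubst \<sigma> t) (fsubst (up \<sigma>) A)"
| "fsubst \<sigma> (BEx \<rho> t A) = BEx \<rho> (tsubst \<sigma> t) (fsubst (up \<sigma>) A)"
| "fsubst \<sigma> (UAll \<rho> A) = UAll \<rho> (fsubst (up \<sigma>) A)"
| "fsubst \<sigma> (UEx \<rho> A) = UEx \<rho> (fsubst (up \<sigma>) A)"

primrec psubst :: "(nat \<Rightarrow> tm) \<Rightarrow> pfm \<Rightarrow> pfm" where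
  "psubst \<sigma> (PAtom a) = PAtom (asubst \<sigma> a)"
| "psubst \<sigma> (PNeg A) = PNeg (psubst \<sigma> A)"
| "psubst \<sigma> (POr A B) = POr (psubst \<sigma> A) (psubst \<sigma> B)"
| "psubst \<sigma> (PAnd A B) = PAnd (psubst \<sigma> A) (psubst \<sigma> B)"
| "psubst \<sigma> (PBAll \<rho> t A) = PBAll \<rho> (tsubst \<sigma> t) (psubst (up \<sigma>) A)"
| "psubst \<sigma> (PUAll \<rho> A) = PUAll \<rho> (psubst (up \<sigma>) A)"

abbreviation flift :: "nat \<Rightarrow> fm \<Rightarrow> fm" where
  "flift n \<equiv> fsubst (lift_env n)"

abbreviation plift :: "nat \<Rightarrow> pfm \<Rightarrow> pfm" where
  "plift n \<equiv> psubst (lift_env n)"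

text \<open>Replaces variable \<open>0\<close> by \<open>t\<close> and discharges its binder.\<close>

definition inst_env :: "tm \<Rightarrow> nat \<Rightarrow> tm" where
  "inst_env t = (\<lambda>i. case i of 0 \<Rightarrow> t | Suc j \<Rightarrow> Var j)"

abbreviation ainst :: "tm \<Rightarrow> atm \<Rightarrow> atm" where
  "ainst t \<equiv> asubst (inst_env t)"

abbreviation finst :: "tm \<Rightarrow> fm \<Rightarrow> fm" where
  "finst t \<equiv> fsubst (inst_env t)"

text \<open>Replaces variable \<open>0\<close> by its successor and stays in the same context.\<close>

definition succ_env :: "nat \<Rightarrow> tm" where
  "succ_env = (\<lambda>i. case i of 0 \<Rightarrow> Succ \<bullet> Var 0 | Suc j \<Rightarrow> Var (Suc j))"


section \<open>Tuples of quantifiers\<close>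

text \<open>Below a block of \<open>n\<close> quantifiers \<open>x\<^sub>1, \<dots>, x\<^sub>n\<close> (with \<open>x\<^sub>1\<close> outermost) the tuple
  \<open>x\<^sub>1, \<dots>, x\<^sub>n\<close> is \<open>vars n\<close>, and a context \<open>\<Gamma>\<close> has become \<open>rev \<rho>s @ \<Gamma>\<close>.\<close>

definition vars :: "nat \<Rightarrow> tm list" where
  "vars n = map Var (rev [0..<n])"

fun UAlls :: "ty list \<Rightarrow> fm \<Rightarrow> fm" where
  "UAlls [] A = A"
| "UAlls (\<rho> # \<rho>s) A = UAll \<rho> (UAlls \<rho>s A)"

fun UExs :: "ty list \<Rightarrow> fm \<Rightarrow> fm" where
  "UExs [] A = A"
| "UExs (\<rho> # \<rho>s) A = UEx \<rho> (UExs \<rho>s A)"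

fun BAlls :: "ty list \<Rightarrow> tm list \<Rightarrow> fm \<Rightarrow> fm" where
  "BAlls [] ts A = A"
| "BAlls (\<rho> # \<rho>s) ts A = BAll \<rho> (hd ts) (BAlls \<rho>s (map (tlift 1) (tl ts)) A)"

fun BExs :: "ty list \<Rightarrow> tm list \<Rightarrow> fm \<Rightarrow> fm" where
  "BExs [] ts A = A"
| "BExs (\<rho> # \<rho>s) ts A = BEx \<rho> (hd ts) (BExs \<rho>s (map (tlift 1) (tl ts)) A)"

text \<open>Conjunction of a nonempty list; the guards below vanish for the empty list, so that
  quantification over the empty tuple leaves a formula unchanged.\<close>

fun Conj :: "fm list \<Rightarrow> fm" where
  "Conj [] = Neg Bot"
| "Conj [A] = A"
| "Conj (A # As) = And A (Conj As)"

definition ImpGuard :: "fm list \<Rightarrow> fm \<Rightarrow> fm" where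
  "ImpGuard As A = (if As = [] then A else Imp (Conj As) A)"

definition AndGuard :: "fm list \<Rightarrow> fm \<Rightarrow> fm" where
  "AndGuard As A = (if As = [] then A else And (Conj As) A)"

definition self_maj :: "ty list \<Rightarrow> fm list" where
  "self_maj \<rho>s = map2 (\<lambda>\<rho> x. Atom (Maj \<rho> x x)) \<rho>s (vars (length \<rho>s))"

text \<open>The quantifiers with a tilde; the prefix \<open>M\<close> stands for \<open>monotone\<close>.\<close>

definition MAlls :: "ty list \<Rightarrow> fm \<Rightarrow> fm" where
  "MAlls \<rho>s A = UAlls \<rho>s (ImpGuard (self_maj \<rho>s) A)"

definition MExs :: "ty list \<Rightarrow> fm \<Rightarrow> fm" where
  "MExs \<rho>s A = UExs \<rho>s (AndGuard (self_maj \<rho>s) A)"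

definition MBAlls :: "ty list \<Rightarrow> tm list \<Rightarrow> fm \<Rightarrow> fm" where
  "MBAlls \<rho>s ts A = BAlls \<rho>s ts (ImpGuard (self_maj \<rho>s) A)"

definition MBExs :: "ty list \<Rightarrow> tm list \<Rightarrow> fm \<Rightarrow> fm" where
  "MBExs \<rho>s ts A = BExs \<rho>s ts (AndGuard (self_maj \<rho>s) A)"


section \<open>Heyting arithmetic in all finite types with majorizability\<close>

text \<open>\<open>x \<le> y\<close> is \<open>x \<ominus> y = 0\<close>, where \<open>\<ominus>\<close> is cut-off subtraction:
  \<open>x \<ominus> 0 = x\<close> and \<open>x \<ominus> S y = pred (x \<ominus> y)\<close>.\<close>

definition id_tm :: tm where
  "id_tm = Sigma N (Fun N N) N \<bullet> Pi N (Fun N N) \<bullet> Pi N N"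

definition pred_tm :: tm where
  "pred_tm = Rec N \<bullet> Zero \<bullet> (Pi (Fun N N) N \<bullet> id_tm)"

text \<open>The step term \<open>\<Sigma> (\<Pi> \<Pi>) pred\<close> sends \<open>r\<close> and \<open>i\<close> to \<open>pred r\<close>.\<close>

definition monus :: "tm \<Rightarrow> tm \<Rightarrow> tm" where
  "monus s t =
     Rec N \<bullet> s \<bullet> (Sigma N N (Fun N N) \<bullet> (Pi (funs [N, N] N) N \<bullet> Pi N N) \<bullet> pred_tm) \<bullet> t"

definition Le :: "tm \<Rightarrow> tm \<Rightarrow> fm" where
  "Le s t = Atom (Eq (monus s t) Zero)"

text \<open>Minimal treatment of equality: the equations for the combinators and recursors are
  given by replacement in an atomic formula \<open>a\<close> with distinguished variable \<open>0\<close>.\<close>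

inductive HA_axiom :: "ty list \<Rightarrow> fm \<Rightarrow> bool" for \<Gamma> where
  eq_refl: "has_ty \<Gamma> t N \<Longrightarrow> HA_axiom \<Gamma> (Atom (Eq t t))"
| eq_subst: "wf_atm (N # \<Gamma>) a \<Longrightarrow> has_ty \<Gamma> s N \<Longrightarrow> has_ty \<Gamma> t N \<Longrightarrow>
    HA_axiom \<Gamma> (Imp (And (Atom (Eq s t)) (Atom (ainst s a))) (Atom (ainst t a)))"
| Pi_conv: "wf_atm (\<rho> # \<Gamma>) a \<Longrightarrow> has_ty \<Gamma> s \<rho> \<Longrightarrow> has_ty \<Gamma> t \<tau> \<Longrightarrow>
    HA_axiom \<Gamma> (Iff (Atom (ainst (Pi \<rho> \<tau> \<bullet> s \<bullet> t) a)) (Atom (ainst s a)))"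
| Sigma_conv: "wf_atm (\<tau> # \<Gamma>) a \<Longrightarrow> has_ty \<Gamma> r (funs [\<rho>, \<sigma>] \<tau>) \<Longrightarrow> has_ty \<Gamma> s (Fun \<rho> \<sigma>) \<Longrightarrow>
    has_ty \<Gamma> t \<rho> \<Longrightarrow>
    HA_axiom \<Gamma> (Iff (Atom (ainst (Sigma \<rho> \<sigma> \<tau> \<bullet> r \<bullet> s \<bullet> t) a)) (Atom (ainst (r \<bullet> t \<bullet> (s \<bullet> t)) a)))"
| Rec_Zero: "wf_atm (\<rho> # \<Gamma>) a \<Longrightarrow> has_ty \<Gamma> r \<rho> \<Longrightarrow> has_ty \<Gamma> s (funs [\<rho>, N] \<rho>) \<Longrightarrow>
    HA_axiom \<Gamma> (Iff (Atom (ainst (Rec \<rho> \<bullet> r \<bullet> s \<bullet> Zero) a)) (Atom (ainst r a)))"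
| Rec_Succ: "wf_atm (\<rho> # \<Gamma>) a \<Longrightarrow> has_ty \<Gamma> r \<rho> \<Longrightarrow> has_ty \<Gamma> s (funs [\<rho>, N] \<rho>) \<Longrightarrow> has_ty \<Gamma> t N \<Longrightarrow>
    HA_axiom \<Gamma> (Iff (Atom (ainst (Rec \<rho> \<bullet> r \<bullet> s \<bullet> (Succ \<bullet> t)) a))
                   (Atom (ainst (s \<bullet> (Rec \<rho> \<bullet> r \<bullet> s \<bullet> t) \<bullet> t) a)))"
| Succ_Zero: "has_ty \<Gamma> t N \<Longrightarrow> HA_axiom \<Gamma> (Neg (Atom (Eq (Succ \<bullet> t) Zero)))"
| Succ_inj: "has_ty \<Gamma> s N \<Longrightarrow> has_ty \<Gamma> t N \<Longrightarrow>
    HA_axiom \<Gamma> (Imp (Atom (Eq (Succ \<bullet> s) (Succ \<bullet> t))) (Atom (Eq s t)))"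
| induction: "wf_fm (N # \<Gamma>) A \<Longrightarrow>
    HA_axiom \<Gamma> (Imp (And (finst Zero A) (UAll N (Imp A (fsubst succ_env A)))) (UAll N A))"
| BAll_iff: "wf_fm (\<rho> # \<Gamma>) A \<Longrightarrow> has_ty \<Gamma> t \<rho> \<Longrightarrow>
    HA_axiom \<Gamma> (Iff (BAll \<rho> t A) (UAll \<rho> (Imp (Atom (Maj \<rho> (Var 0) (tlift 1 t))) A)))"
| BEx_iff: "wf_fm (\<rho> # \<Gamma>) A \<Longrightarrow> has_ty \<Gamma> t \<rho> \<Longrightarrow>
    HA_axiom \<Gamma> (Iff (BEx \<rho> t A) (UEx \<rho> (And (Atom (Maj \<rho> (Var 0) (tlift 1 t))) A)))"
| Maj_N: "has_ty \<Gamma> s N \<Longrightarrow> has_ty \<Gamma> t N \<Longrightarrow> HA_axiom \<Gamma> (Iff (Atom (Maj N s t)) (Le s t))"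
| Maj_Fun: "has_ty \<Gamma> s (Fun \<rho> \<tau>) \<Longrightarrow> has_ty \<Gamma> t (Fun \<rho> \<tau>) \<Longrightarrow> has_ty \<Gamma> r \<rho> \<Longrightarrow>
    HA_axiom \<Gamma> (Imp (Atom (Maj (Fun \<rho> \<tau>) s t))
      (BAll \<rho> r
        (And (Atom (Maj \<tau> (tlift 1 s \<bullet> Var 0) (tlift 1 t \<bullet> tlift 1 r)))
             (Atom (Maj \<tau> (tlift 1 t \<bullet> Var 0) (tlift 1 t \<bullet> tlift 1 r))))))"

text \<open>Intuitionistic natural deduction over the axioms above and the additional axioms
  \<open>T \<Gamma>\<close>, from hypotheses \<open>\<Phi>\<close>.  In the rule \<open>Maj_rule\<close>, \<open>u\<close> is variable \<open>1\<close> and \<open>v\<close> is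
  variable \<open>0\<close>; its premise has to be a theorem, so it may not use hypotheses.\<close>

inductive prv :: "(ty list \<Rightarrow> fm set) \<Rightarrow> ty list \<Rightarrow> fm set \<Rightarrow> fm \<Rightarrow> bool" for T where
  hyp: "A \<in> \<Phi> \<Longrightarrow> wf_fm \<Gamma> A \<Longrightarrow> prv T \<Gamma> \<Phi> A"
| HA_ax: "HA_axiom \<Gamma> A \<Longrightarrow> prv T \<Gamma> \<Phi> A"
| extra_ax: "A \<in> T \<Gamma> \<Longrightarrow> prv T \<Gamma> \<Phi> A"
| BotE: "prv T \<Gamma> \<Phi> Bot \<Longrightarrow> wf_fm \<Gamma> A \<Longrightarrow> prv T \<Gamma> \<Phi> A"
| AndI: "prv T \<Gamma> \<Phi> A \<Longrightarrow> prv T \<Gamma> \<Phi> B \<Longrightarrow> prv T \<Gamma> \<Phi> (And A B)"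
| AndE1: "prv T \<Gamma> \<Phi> (And A B) \<Longrightarrow> prv T \<Gamma> \<Phi> A"
| AndE2: "prv T \<Gamma> \<Phi> (And A B) \<Longrightarrow> prv T \<Gamma> \<Phi> B"
| OrI1: "prv T \<Gamma> \<Phi> A \<Longrightarrow> wf_fm \<Gamma> B \<Longrightarrow> prv T \<Gamma> \<Phi> (Or A B)"
| OrI2: "prv T \<Gamma> \<Phi> B \<Longrightarrow> wf_fm \<Gamma> A \<Longrightarrow> prv T \<Gamma> \<Phi> (Or A B)"
| OrE: "prv T \<Gamma> \<Phi> (Or A B) \<Longrightarrow> prv T \<Gamma> (insert A \<Phi>) C \<Longrightarrow> prv T \<Gamma> (insert B \<Phi>) C \<Longrightarrow>
    prv T \<Gamma> \<Phi> C"
| ImpI: "prv T \<Gamma> (insert A \<Phi>) B \<Longrightarrow> wf_fm \<Gamma> A \<Longrightarrow> prv T \<Gamma> \<Phi> (Imp A B)"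
| ImpE: "prv T \<Gamma> \<Phi> (Imp A B) \<Longrightarrow> prv T \<Gamma> \<Phi> A \<Longrightarrow> prv T \<Gamma> \<Phi> B"
| UAllI: "prv T (\<rho> # \<Gamma>) (flift 1 ` \<Phi>) A \<Longrightarrow> prv T \<Gamma> \<Phi> (UAll \<rho> A)"
| UAllE: "prv T \<Gamma> \<Phi> (UAll \<rho> A) \<Longrightarrow> has_ty \<Gamma> t \<rho> \<Longrightarrow> prv T \<Gamma> \<Phi> (finst t A)"
| UExI: "prv T \<Gamma> \<Phi> (finst t A) \<Longrightarrow> has_ty \<Gamma> t \<rho> \<Longrightarrow> wf_fm (\<rho> # \<Gamma>) A \<Longrightarrow> prv T \<Gamma> \<Phi> (UEx \<rho> A)"
| UExE: "prv T \<Gamma> \<Phi> (UEx \<rho> A) \<Longrightarrow> prv T (\<rho> # \<Gamma>) (insert A (flift 1 ` \<Phi>)) (flift 1 C) \<Longrightarrow>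
    prv T \<Gamma> \<Phi> C"
| Maj_rule: "bounded A \<Longrightarrow> wf_fm \<Gamma> A \<Longrightarrow> has_ty \<Gamma> t (Fun \<rho> \<tau>) \<Longrightarrow> has_ty \<Gamma> q (Fun \<rho> \<tau>) \<Longrightarrow>
    prv T (\<rho> # \<rho> # \<Gamma>) {}
      (Imp (And (flift 2 A) (Atom (Maj \<rho> (Var 1) (Var 0))))
           (And (Atom (Maj \<tau> (tlift 2 t \<bullet> Var 1) (tlift 2 q \<bullet> Var 0)))
                (Atom (Maj \<tau> (tlift 2 q \<bullet> Var 1) (tlift 2 q \<bullet> Var 0))))) \<Longrightarrow>
    prv T \<Gamma> \<Phi> (Imp A (Atom (Maj (Fun \<rho> \<tau>) t q)))"

definition BLEM :: "ty list \<Rightarrow> fm set" where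
  "BLEM \<Gamma> = {Or A (Neg A) | A. wf_fm \<Gamma> A \<and> bounded A}"

text \<open>In the conclusion of \<open>bMAC\<close> the tuple \<open>Y\<close> is bound outside \<open>x\<close> and \<open>y\<close>, so the
  parameters of \<open>A\<close> are lifted past it, while \<open>x\<close> and \<open>y\<close> keep their indices.\<close>

definition bMAC :: "ty list \<Rightarrow> fm set" where
  "bMAC \<Gamma> =
    {Imp (MAlls \<rho>s (MExs \<tau>s A))
         (MExs (map (funs \<rho>s) \<tau>s) (MAlls \<rho>s
            (MBExs \<tau>s (tapps (map (tlift (length \<rho>s)) (vars (length \<tau>s))) (vars (length \<rho>s)))
              (fsubst (\<lambda>i. if i < length \<rho>s + length \<tau>s then Var i else Var (i + length \<tau>s)) A))))
     | \<rho>s \<tau>s A. wf_fm (rev \<tau>s @ rev \<rho>s @ \<Gamma>) A \<and> bounded A}"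


section \<open>The Krivine negative translation\<close>

fun krivine_sub :: "pfm \<Rightarrow> fm" where
  "krivine_sub (PAtom a) = Neg (Atom a)"
| "krivine_sub (PNeg A) = Neg (krivine_sub A)"
| "krivine_sub (POr A B) = And (krivine_sub A) (krivine_sub B)"
| "krivine_sub (PAnd A B) = Or (krivine_sub A) (krivine_sub B)"
| "krivine_sub (PBAll \<rho> t A) = BEx \<rho> t (krivine_sub A)"
| "krivine_sub (PUAll \<rho> A) = UEx \<rho> (krivine_sub A)"

definition krivine :: "pfm \<Rightarrow> fm" where
  "krivine A = Neg (krivine_sub A)"


section \<open>The bounded functional interpretation\<close>

text \<open>\<open>B_ex A\<close> and \<open>B_all A\<close> are the types of the tuples in the existential and universal
  prefix of the interpretation of \<open>A\<close>.  The matrix \<open>B_mat A xs ys\<close> takes these tuples as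
  lists of terms (of lengths \<open>length (B_ex A)\<close> and \<open>length (B_all A)\<close>) in the context of \<open>A\<close>;
  everything that passes below a new quantifier is lifted.\<close>

fun B_ex :: "fm \<Rightarrow> ty list" and B_all :: "fm \<Rightarrow> ty list" where
  "B_ex (Atom a) = []"
| "B_ex Bot = []"
| "B_ex (And A B) = B_ex A @ B_ex B"
| "B_ex (Or A B) = B_ex A @ B_ex B"
| "B_ex (Imp A B) = map (funs (B_ex A)) (B_ex B) @ map (funs (B_ex A @ B_all B)) (B_all A)"
| "B_ex (BAll \<rho> t A) = B_ex A"
| "B_ex (BEx \<rho> t A) = B_ex A"
| "B_ex (UAll \<rho> A) = map (Fun \<rho>) (B_ex A)"
| "B_ex (UEx \<rho> A) = \<rho> # B_ex A"
| "B_all (Atom a) = []"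
| "B_all Bot = []"
| "B_all (And A B) = B_all A @ B_all B"
| "B_all (Or A B) = B_all A @ B_all B"
| "B_all (Imp A B) = B_ex A @ B_all B"
| "B_all (BAll \<rho> t A) = B_all A"
| "B_all (BEx \<rho> t A) = B_all A"
| "B_all (UAll \<rho> A) = \<rho> # B_all A"
| "B_all (UEx \<rho> A) = B_all A"

text \<open>Lifting does not change the height, which is why \<open>B_mat\<close> and \<open>U_mat\<close> terminate.\<close>

primrec fheight :: "fm \<Rightarrow> nat" where
  "fheight (Atom a) = 0"
| "fheight Bot = 0"
| "fheight (And A B) = Suc (fheight A + fheight B)"
| "fheight (Or A B) = Suc (fheight A + fheight B)"
| "fheight (Imp A B) = Suc (fheight A + fheight B)"
| "fheight (BAll \<rho> t A) = Suc (fheight A)"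
| "fheight (BEx \<rho> t A) = Suc (fheight A)"
| "fheight (UAll \<rho> A) = Suc (fheight A)"
| "fheight (UEx \<rho> A) = Suc (fheight A)"

lemma fheight_fsubst [simp]: "fheight (fsubst \<sigma> A) = fheight A"
  by (induction A arbitrary: \<sigma>) simp_all

function B_mat :: "fm \<Rightarrow> tm list \<Rightarrow> tm list \<Rightarrow> fm" where
  "B_mat (Atom a) xs ys = Atom a"
| "B_mat Bot xs ys = Bot"
| "B_mat (And A B) xs ys =
    And (B_mat A (take (length (B_ex A)) xs) (take (length (B_all A)) ys))
        (B_mat B (drop (length (B_ex A)) xs) (drop (length (B_all A)) ys))"
| "B_mat (Or A B) xs ys =
    (let x = take (length (B_ex A)) xs; x' = drop (length (B_ex A)) xs;
         y = take (length (B_all A)) ys; y' = drop (length (B_all A)) ys;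
         n = length (B_all A); n' = length (B_all B)
     in Or (MBAlls (B_all A) y (B_mat (flift n A) (map (tlift n) x) (vars n)))
           (MBAlls (B_all B) y' (B_mat (flift n' B) (map (tlift n') x') (vars n'))))"
| "B_mat (Imp A B) XYs xys =
    (let X' = take (length (B_ex B)) XYs; Y = drop (length (B_ex B)) XYs;
         x = take (length (B_ex A)) xys; y' = drop (length (B_ex A)) xys;
         n = length (B_all A)
     in Imp (MBAlls (B_all A) (tapps Y (x @ y')) (B_mat (flift n A) (map (tlift n) x) (vars n)))
            (B_mat B (tapps X' x) y'))"
| "B_mat (BAll \<rho> t A) xs ys = BAll \<rho> t (B_mat A (map (tlift 1) xs) (map (tlift 1) ys))"
| "B_mat (BEx \<rho> t A) xs ys =
    (let n = length (B_all A)
     in BEx \<rho> t (MBAlls (B_all A) (map (tlift 1) ys)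
          (B_mat (flift n A) (map (tlift (n + 1)) xs) (vars n))))"
| "B_mat (UAll \<rho> A) Xs wys =
    (let w = hd wys; y = tl wys
     in BAll \<rho> w (B_mat A (map (tlift 1) (tapps Xs [w])) (map (tlift 1) y)))"
| "B_mat (UEx \<rho> A) wxs ys =
    (let w = hd wxs; x = tl wxs; n = length (B_all A)
     in BEx \<rho> w (MBAlls (B_all A) (map (tlift 1) ys)
          (B_mat (flift n A) (map (tlift (n + 1)) x) (vars n))))"
  by pat_completeness auto
termination
  by (relation "measure (\<lambda>(A, _, _). fheight A)") simp_all

definition B_int :: "fm \<Rightarrow> fm" where
  "B_int A =
    (let m = length (B_ex A); n = length (B_all A)
     in MExs (B_ex A) (MAlls (B_all A)
          (B_mat (flift (m + n) A) (map (tlift n) (vars m)) (vars n))))"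


section \<open>The Shoenfield-like bounded functional interpretation\<close>

fun U_all :: "pfm \<Rightarrow> ty list" and U_ex :: "pfm \<Rightarrow> ty list" where
  "U_all (PAtom a) = []"
| "U_all (PNeg A) = map (funs (U_all A)) (U_ex A)"
| "U_all (POr A B) = U_all A @ U_all B"
| "U_all (PAnd A B) = U_all A @ U_all B"
| "U_all (PBAll \<rho> t A) = U_all A"
| "U_all (PUAll \<rho> A) = \<rho> # U_all A"
| "U_ex (PAtom a) = []"
| "U_ex (PNeg A) = U_all A"
| "U_ex (POr A B) = U_ex A @ U_ex B"
| "U_ex (PAnd A B) = U_ex A @ U_ex B"
| "U_ex (PBAll \<rho> t A) = U_ex A"
| "U_ex (PUAll \<rho> A) = U_ex A"

primrec pheight :: "pfm \<Rightarrow> nat" where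
  "pheight (PAtom a) = 0"
| "pheight (PNeg A) = Suc (pheight A)"
| "pheight (POr A B) = Suc (pheight A + pheight B)"
| "pheight (PAnd A B) = Suc (pheight A + pheight B)"
| "pheight (PBAll \<rho> t A) = Suc (pheight A)"
| "pheight (PUAll \<rho> A) = Suc (pheight A)"

lemma pheight_psubst [simp]: "pheight (psubst \<sigma> A) = pheight A"
  by (induction A arbitrary: \<sigma>) simp_all

function U_mat :: "pfm \<Rightarrow> tm list \<Rightarrow> tm list \<Rightarrow> fm" where
  "U_mat (PAtom a) xs ys = Atom a"
| "U_mat (PNeg A) Ys xs =
    (let n = length (U_all A)
     in MBExs (U_all A) xs
          (Neg (U_mat (plift n A) (vars n) (tapps (map (tlift n) Ys) (vars n)))))"
| "U_mat (POr A B) xs ys =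
    Or (U_mat A (take (length (U_all A)) xs) (take (length (U_ex A)) ys))
       (U_mat B (drop (length (U_all A)) xs) (drop (length (U_ex A)) ys))"
| "U_mat (PAnd A B) xs ys =
    And (U_mat A (take (length (U_all A)) xs) (take (length (U_ex A)) ys))
        (U_mat B (drop (length (U_all A)) xs) (drop (length (U_ex A)) ys))"
| "U_mat (PBAll \<rho> t A) xs ys = BAll \<rho> t (U_mat A (map (tlift 1) xs) (map (tlift 1) ys))"
| "U_mat (PUAll \<rho> A) wxs ys =
    BAll \<rho> (hd wxs) (U_mat A (map (tlift 1) (tl wxs)) (map (tlift 1) ys))"
  by pat_completeness auto
termination
  by (relation "measure (\<lambda>(A, _, _). pheight A)") simp_all

definition U_int :: "pfm \<Rightarrow> fm" where
  "U_int A =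
    (let m = length (U_all A); n = length (U_ex A)
     in MAlls (U_all A) (MExs (U_ex A)
          (U_mat (plift (m + n) A) (map (tlift n) (vars m)) (vars n))))"

end

(* For monotone x and y, the bounded formula (forall~ y' <| y) (A_K)_B(x, y') is equivalent to
   not A_U(x, y).  This follows by induction on A.  For a negation both sides turn into
   (forall~ x' <| x) not not A_U(x', Y x'), without any use of monotonicity of A_U; for a
   conjunction and for the quantifiers one moves the outer (forall~ y' <| y) inwards, which works
   because the inner statement is antimonotone in y by transitivity of majorizability, and then
   uses de Morgan's laws for bounded formulas, i.e. BLEM.  Since the matrix of the interpretation
   of A^K is the negation of the formula above with Y x for y, the first claim follows by
   stability of bounded formulas.  For the second claim bMAC turns A^U into
   exists~ Y forall~ x (exists~ y <| Y x) A_U(x, y), and by the equivalence and antimonotonicity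
   again the witness y may be replaced by Y x. *)
theory Submission
  imports Defs
begin

section \<open>Substitution and typing\<close>

text \<open>The closure under smaller tuples is what carries the induction: for a negation, (A_K)_B
  speaks of a single tuple, whereas the U-matrix ranges over all smaller monotone tuples, so the two
  match only after closing. Choosing the bound itself as an instance of the closure requires the
  bound to be monotone; hence the restriction to monotone arguments.

  Transitivity of majorizability is not an axiom. At type \<open>N\<close> it is transitivity of an
  order defined through cut-off subtraction, which has to be derived from the recursor equations by
  induction. At function types it comes from \<open>Maj_rule\<close>, whose premise admits no
  hypotheses; the given majorizations therefore travel in the bounded antecedent of that rule.

  Most equivalences are stated as equal derivability from the same hypotheses, for all contexts and
  all sets of hypotheses, and not as derivable formulas. Connectives and quantifiers can then be
  treated as in Kripke semantics, and derivable equivalences are recovered at the end by letting the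
  hypotheses grow.\<close>

lemma tsubst_tsubst [simp]: "tsubst \<sigma> (tsubst \<tau> t) = tsubst (\<lambda>i. tsubst \<sigma> (\<tau> i)) t"
  by (induction t) simp_all

lemma tsubst_Var [simp]: "tsubst Var t = t"
  by (induction t) simp_all

lemma up_0 [simp]: "up \<sigma> 0 = Var 0"
  and up_Suc [simp]: "up \<sigma> (Suc i) = tlift 1 (\<sigma> i)"
  by (simp_all add: up_def)

lemma lift_env_apply [simp]: "lift_env n i = Var (i + n)"
  by (simp add: lift_env_def)

lemma inst_env_0 [simp]: "inst_env t 0 = t"
  and inst_env_Suc [simp]: "inst_env t (Suc i) = Var i"
  by (simp_all add: inst_env_def)

lemma up_Var [simp]: "up Var = Var"
  by (rule ext) (simp add: up_def split: nat.split)

lemma tsubst_up_up: "tsubst (up \<sigma>) (up \<tau> i) = up (\<lambda>i. tsubst \<sigma> (\<tau> i)) i"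
  by (cases i) simp_all

lemma asubst_asubst [simp]: "asubst \<sigma> (asubst \<tau> a) = asubst (\<lambda>i. tsubst \<sigma> (\<tau> i)) a"
  by (cases a) simp_all

lemma asubst_Var [simp]: "asubst Var a = a"
  by (cases a) simp_all

lemma fsubst_fsubst [simp]: "fsubst \<sigma> (fsubst \<tau> A) = fsubst (\<lambda>i. tsubst \<sigma> (\<tau> i)) A"
  by (induction A arbitrary: \<sigma> \<tau>) (simp_all add: tsubst_up_up)

lemma psubst_psubst [simp]: "psubst \<sigma> (psubst \<tau> A) = psubst (\<lambda>i. tsubst \<sigma> (\<tau> i)) A"
  by (induction A arbitrary: \<sigma> \<tau>) (simp_all add: tsubst_up_up)

lemma fsubst_Var [simp]: "fsubst Var A = A"
  by (induction A) simp_all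

lemma psubst_Var [simp]: "psubst Var A = A"
  by (induction A) simp_all

lemma lift_env_0 [simp]: "lift_env 0 = Var"
  by (rule ext) simp

section \<open>Substitution below a block of binders and instantiation of a block\<close>

definition upn :: "nat \<Rightarrow> (nat \<Rightarrow> tm) \<Rightarrow> nat \<Rightarrow> tm" where
  "upn n \<sigma> i = (if i < n then Var i else tlift n (\<sigma> (i - n)))"

text \<open>Instantiates a whole block at once and acts as \<sigma> on the outer context. Index 0 is
  the innermost binder while tuples are listed from the outermost one, hence the reversal.\<close>

definition extend :: "(nat \<Rightarrow> tm) \<Rightarrow> tm list \<Rightarrow> nat \<Rightarrow> tm" where
  "extend \<sigma> ss i = (if i < length ss then rev ss ! i else \<sigma> (i - length ss))"

lemma upn_0 [simp]: "upn 0 \<sigma> = \<sigma>"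
  by (rule ext) (simp add: upn_def)

text \<open>Identifies the closed form with the n-fold iterate of \<open>up\<close>. The recursion
  peels off the outermost binder, as the recursive definitions of the quantifier blocks do.\<close>

lemma upn_Suc: "upn (Suc n) \<sigma> = upn n (up \<sigma>)"
proof
  fix i
  show "upn (Suc n) \<sigma> i = upn n (up \<sigma>) i"
  proof (cases "i < n")
    case False
    then obtain j where "i = n + j" by (metis le_Suc_ex not_less)
    then show ?thesis by (cases j) (simp_all add: upn_def lift_env_def)
  qed (simp add: upn_def)
qed

lemma upn_1 [simp]: "upn (Suc 0) \<sigma> = up \<sigma>"
  by (simp add: upn_Suc)

lemma upn_lift [simp]: "upn n \<sigma> (i + n) = tlift n (\<sigma> i)"
  by (simp add: upn_def)

lemma extend_Nil [simp]: "extend \<sigma> [] = \<sigma>"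
  by (rule ext) (simp add: extend_def)

lemma extend_Cons: "extend \<sigma> (s # ss) = extend (extend \<sigma> [s]) ss"
proof
  fix i
  show "extend \<sigma> (s # ss) i = extend (extend \<sigma> [s]) ss i"
  proof (cases "i < length ss")
    case False
    then obtain j where "i = length ss + j" by (metis le_Suc_ex not_less)
    then show ?thesis by (cases j) (simp_all add: extend_def nth_append)
  qed (simp add: extend_def nth_append)
qed

lemma extend_single_0 [simp]: "extend \<sigma> [s] 0 = s"
  and extend_single_Suc [simp]: "extend \<sigma> [s] (Suc i) = \<sigma> i"
  by (simp_all add: extend_def)

lemma inst_env_extend: "inst_env t = extend Var [t]"
  by (rule ext) (simp add: inst_env_def extend_def split: nat.split)

lemma extend_lift [simp]: "length ss = n \<Longrightarrow> extend \<sigma> ss (i + n) = \<sigma> i"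
  by (simp add: extend_def)

text \<open>Fuses moving a matrix under a block with instantiating that block afterwards; almost
  every computation with the matrices ends in this form.\<close>

lemma tsubst_extend_upn:
  assumes "length ss = n"
  shows "tsubst (extend \<sigma> ss) (upn n \<tau> i) = extend (\<lambda>i. tsubst \<sigma> (\<tau> i)) ss i"
  using assms by (simp add: upn_def extend_def)

lemma length_vars [simp]: "length (vars n) = n"
  by (simp add: vars_def)

lemma vars_0 [simp]: "vars 0 = []"
  by (simp add: vars_def)

lemma vars_Suc: "vars (Suc n) = Var n # vars n"
  by (simp add: vars_def)

lemma rev_vars: "rev (vars n) = map Var [0..<n]"
  by (simp add: vars_def rev_map)

lemma vars_nth: "i < n \<Longrightarrow> vars n ! i = Var (n - Suc i)"
  by (simp add: vars_def rev_nth)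

lemma map_upn_vars [simp]: "map (tsubst (upn n \<sigma>)) (vars n) = vars n"
  by (simp add: vars_def upn_def)

lemma map_extend_vars [simp]: "length ss = n \<Longrightarrow> map (tsubst (extend \<sigma> ss)) (vars n) = ss"
  by (rule nth_equalityI) (auto simp: vars_nth extend_def rev_nth)

lemma extend_lift_vars [simp]: "extend (lift_env n) (vars n) = Var"
  by (rule ext) (simp add: extend_def rev_vars)

section \<open>Typing and its preservation under substitution\<close>

inductive_cases has_ty_AppE: "has_ty \<Gamma> (t \<bullet> s) \<tau>"
inductive_cases has_ty_VarE: "has_ty \<Gamma> (Var i) \<tau>"

lemma has_ty_Var [simp]: "has_ty \<Gamma> (Var i) \<tau> \<longleftrightarrow> i < length \<Gamma> \<and> \<tau> = \<Gamma> ! i"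
  by (auto elim: has_ty_VarE intro: has_ty.intros)

definition wt_env :: "(nat \<Rightarrow> tm) \<Rightarrow> ty list \<Rightarrow> ty list \<Rightarrow> bool" where
  "wt_env \<sigma> \<Gamma> \<Delta> \<longleftrightarrow> (\<forall>i < length \<Gamma>. has_ty \<Delta> (\<sigma> i) (\<Gamma> ! i))"

lemma has_ty_tsubst: "has_ty \<Gamma> t \<tau> \<Longrightarrow> wt_env \<sigma> \<Gamma> \<Delta> \<Longrightarrow> has_ty \<Delta> (tsubst \<sigma> t) \<tau>"
  by (induction rule: has_ty.induct) (auto simp: wt_env_def intro: has_ty.intros)

lemma wt_lift [simp]: "length \<rho>s = n \<Longrightarrow> wt_env (lift_env n) \<Gamma> (\<rho>s @ \<Gamma>)"
  by (simp add: wt_env_def nth_append)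

lemma wt_lift_1 [simp]: "wt_env (lift_env (Suc 0)) \<Gamma> (\<rho> # \<Gamma>)"
  by (simp add: wt_env_def)

lemma wt_lift_2 [simp]: "wt_env (lift_env 2) \<Gamma> (\<rho> # \<tau> # \<Gamma>)"
  by (simp add: wt_env_def)

lemma wt_Var [simp]: "wt_env Var \<Gamma> \<Gamma>"
  by (simp add: wt_env_def)

lemma wt_comp: "wt_env \<sigma> \<Gamma> \<Delta> \<Longrightarrow> wt_env \<tau> \<Delta> \<Theta> \<Longrightarrow> wt_env (\<lambda>i. tsubst \<tau> (\<sigma> i)) \<Gamma> \<Theta>"
  unfolding wt_env_def by (metis has_ty_tsubst wt_env_def)

lemma wt_up: "wt_env \<sigma> \<Gamma> \<Delta> \<Longrightarrow> wt_env (up \<sigma>) (\<rho> # \<Gamma>) (\<rho> # \<Delta>)"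
  unfolding wt_env_def
  by (auto simp: less_Suc_eq_0_disj intro!: has_ty_tsubst [where \<Gamma> = \<Delta>])

lemma wt_extend:
  assumes "wt_env \<sigma> \<Gamma> \<Delta>" and "list_all2 (has_ty \<Delta>) ss \<rho>s"
  shows "wt_env (extend \<sigma> ss) (rev \<rho>s @ \<Gamma>) \<Delta>"
proof -
  have "list_all2 (has_ty \<Delta>) (rev ss) (rev \<rho>s)"
    using assms(2) by simp
  then show ?thesis
    using assms(1) by (auto simp: wt_env_def extend_def nth_append list_all2_conv_all_nth)
qed

lemma wt_extend_single:
  "wt_env \<sigma> \<Gamma> \<Delta> \<Longrightarrow> has_ty \<Delta> s \<rho> \<Longrightarrow> wt_env (extend \<sigma> [s]) (\<rho> # \<Gamma>) \<Delta>"
  using wt_extend [of \<sigma> \<Gamma> \<Delta> "[s]" "[\<rho>]"] by simp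

lemma wt_inst: "has_ty \<Gamma> s \<rho> \<Longrightarrow> wt_env (inst_env s) (\<rho> # \<Gamma>) \<Gamma>"
  by (simp add: inst_env_extend wt_extend_single)

lemma has_ty_tlift [simp]: "has_ty \<Gamma> t \<tau> \<Longrightarrow> length \<rho>s = n \<Longrightarrow> has_ty (\<rho>s @ \<Gamma>) (tlift n t) \<tau>"
  by (erule has_ty_tsubst) simp

lemma has_ty_tlift_1 [simp]: "has_ty \<Gamma> t \<tau> \<Longrightarrow> has_ty (\<rho> # \<Gamma>) (tlift (Suc 0) t) \<tau>"
  by (erule has_ty_tsubst) simp

lemma has_ty_tlift_2 [simp]: "has_ty \<Gamma> t \<tau> \<Longrightarrow> has_ty (\<rho> # \<rho>' # \<Gamma>) (tlift 2 t) \<tau>"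
  by (erule has_ty_tsubst) simp

lemma wf_asubst: "wf_atm \<Gamma> a \<Longrightarrow> wt_env \<sigma> \<Gamma> \<Delta> \<Longrightarrow> wf_atm \<Delta> (asubst \<sigma> a)"
  by (cases a) (auto intro: has_ty_tsubst)

lemma wf_fsubst: "wf_fm \<Gamma> A \<Longrightarrow> wt_env \<sigma> \<Gamma> \<Delta> \<Longrightarrow> wf_fm \<Delta> (fsubst \<sigma> A)"
  by (induction A arbitrary: \<Gamma> \<Delta> \<sigma>) (auto intro: wf_asubst has_ty_tsubst wt_up)

lemma wf_psubst: "wf_pfm \<Gamma> A \<Longrightarrow> wt_env \<sigma> \<Gamma> \<Delta> \<Longrightarrow> wf_pfm \<Delta> (psubst \<sigma> A)"
  by (induction A arbitrary: \<Gamma> \<Delta> \<sigma>) (auto intro: wf_asubst has_ty_tsubst wt_up)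

lemma bounded_fsubst [simp]: "bounded (fsubst \<sigma> A) \<longleftrightarrow> bounded A"
  by (induction A arbitrary: \<sigma>) simp_all

lemma has_ty_apps:
  "has_ty \<Gamma> t (funs \<rho>s \<tau>) \<Longrightarrow> list_all2 (has_ty \<Gamma>) ss \<rho>s \<Longrightarrow> has_ty \<Gamma> (apps t ss) \<tau>"
proof (induction \<rho>s arbitrary: t ss)
  case (Cons \<rho> \<rho>s)
  then obtain s ss' where "ss = s # ss'" "has_ty \<Gamma> s \<rho>" "list_all2 (has_ty \<Gamma>) ss' \<rho>s"
    by (auto simp: list_all2_Cons2)
  with Cons.IH [of "t \<bullet> s" ss'] Cons.prems(1) show ?case
    by (auto simp: funs_def apps_def intro: has_ty.intros)
qed (simp add: funs_def apps_def)

lemma list_all2_tapps: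
  "list_all2 (has_ty \<Gamma>) ts (map (funs \<rho>s) \<tau>s) \<Longrightarrow> list_all2 (has_ty \<Gamma>) ss \<rho>s \<Longrightarrow>
    list_all2 (has_ty \<Gamma>) (tapps ts ss) \<tau>s"
  unfolding tapps_def list.rel_map by (erule list_all2_mono) (rule has_ty_apps)

lemma list_all2_tsubst:
  "list_all2 (has_ty \<Gamma>) ts \<tau>s \<Longrightarrow> wt_env \<sigma> \<Gamma> \<Delta> \<Longrightarrow> list_all2 (has_ty \<Delta>) (map (tsubst \<sigma>) ts) \<tau>s"
  by (auto simp: list_all2_conv_all_nth intro: has_ty_tsubst)

lemma list_all2_vars: "list_all2 (has_ty (rev \<rho>s @ \<Gamma>)) (vars (length \<rho>s)) \<rho>s"
  by (auto simp: list_all2_conv_all_nth vars_nth nth_append rev_nth)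

lemma tsubst_apps: "tsubst \<sigma> (apps t ss) = apps (tsubst \<sigma> t) (map (tsubst \<sigma>) ss)"
  by (induction ss arbitrary: t) (simp_all add: apps_def)

lemma map_tsubst_tapps [simp]:
  "map (tsubst \<sigma>) (tapps ts ss) = tapps (map (tsubst \<sigma>) ts) (map (tsubst \<sigma>) ss)"
  by (simp add: tapps_def tsubst_apps)

lemma length_tapps [simp]: "length (tapps ts ss) = length ts"
  by (simp add: tapps_def)

section \<open>Weakening and substitution for derivations\<close>

lemma prv_mono: "prv T \<Gamma> \<Phi> A \<Longrightarrow> \<Phi> \<subseteq> \<Psi> \<Longrightarrow> prv T \<Gamma> \<Psi> A"
proof (induction arbitrary: \<Psi> rule: prv.induct)
  case (OrE \<Gamma> \<Phi> A B C)
  then show ?case by (meson insert_mono prv.OrE)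
next
  case (UExE \<Gamma> \<Phi> \<rho> A C)
  then show ?case by (meson image_mono insert_mono prv.UExE)
next
  case (UAllI \<rho> \<Gamma> \<Phi> A)
  then show ?case by (meson image_mono prv.UAllI)
next
  case (ImpI \<Gamma> A \<Phi> B)
  then show ?case by (meson insert_mono prv.ImpI)
qed (blast intro: prv.intros)+

text \<open>Carries results obtained with BLEM alone over to the theory with bMAC, so that closure
  under substitution has to be known for BLEM only.\<close>

lemma prv_theory_mono: "prv T \<Gamma> \<Phi> A \<Longrightarrow> (\<And>\<Gamma>. T \<Gamma> \<subseteq> T' \<Gamma>) \<Longrightarrow> prv T' \<Gamma> \<Phi> A"
  by (induction rule: prv.induct) (blast intro: prv.intros)+

text \<open>The condition on the additional axioms under which every derivation can be moved along a
  typed substitution.\<close>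

definition subst_closed :: "(ty list \<Rightarrow> fm set) \<Rightarrow> bool" where
  "subst_closed T \<longleftrightarrow> (\<forall>\<Gamma> \<Delta> \<sigma> A. A \<in> T \<Gamma> \<longrightarrow> wt_env \<sigma> \<Gamma> \<Delta> \<longrightarrow> fsubst \<sigma> A \<in> T \<Delta>)"

lemma subst_closed_BLEM: "subst_closed BLEM"
  by (auto simp: subst_closed_def BLEM_def intro: wf_fsubst)

lemma asubst_ainst:
  "asubst \<sigma> (ainst t a) = ainst (tsubst \<sigma> t) (asubst (up \<sigma>) a)"
proof -
  have "tsubst \<sigma> (inst_env t i) = tsubst (inst_env (tsubst \<sigma> t)) (up \<sigma> i)" for i
    by (cases i) simp_all
  then show ?thesis by simp
qed

lemma fsubst_finst:
  "fsubst \<sigma> (finst t A) = finst (tsubst \<sigma> t) (fsubst (up \<sigma>) A)"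
proof -
  have "tsubst \<sigma> (inst_env t i) = tsubst (inst_env (tsubst \<sigma> t)) (up \<sigma> i)" for i
    by (cases i) simp_all
  then show ?thesis by simp
qed

lemma tsubst_up_up_lift: "tsubst (up (up \<sigma>)) (tlift 2 t) = tlift 2 (tsubst \<sigma> t)"
  by (simp add: numeral_2_eq_2 lift_env_def)

lemma fsubst_up_up_lift: "fsubst (up (up \<sigma>)) (flift 2 A) = flift 2 (fsubst \<sigma> A)"
  by (simp add: numeral_2_eq_2 lift_env_def)

lemma fsubst_succ: "fsubst (up \<sigma>) (fsubst succ_env A) = fsubst succ_env (fsubst (up \<sigma>) A)"
proof -
  have "tsubst (up \<sigma>) (succ_env i) = tsubst succ_env (up \<sigma> i)" for i
    by (cases i) (simp_all add: succ_env_def lift_env_def)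
  then show ?thesis by simp
qed

lemma tsubst_monus: "tsubst \<sigma> (monus s t) = monus (tsubst \<sigma> s) (tsubst \<sigma> t)"
  by (simp add: monus_def pred_tm_def id_tm_def)

lemma HA_axiom_fsubst:
  assumes "HA_axiom \<Gamma> A" and wt: "wt_env \<sigma> \<Gamma> \<Delta>"
  shows "HA_axiom \<Delta> (fsubst \<sigma> A)"
  using assms(1)
proof cases
  case (induction A')
  then show ?thesis using HA_axiom.induction [of \<Delta> "fsubst (up \<sigma>) A'"] wt
    by (simp add: fsubst_finst fsubst_succ wf_fsubst wt_up del: fsubst_fsubst)
next
  case (BAll_iff \<rho> A t)
  then show ?thesis using HA_axiom.BAll_iff [of \<rho> \<Delta> "fsubst (up \<sigma>) A" "tsubst \<sigma> t"] wt
    by (simp add: wf_fsubst wt_up has_ty_tsubst)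
next
  case (BEx_iff \<rho> A t)
  then show ?thesis using HA_axiom.BEx_iff [of \<rho> \<Delta> "fsubst (up \<sigma>) A" "tsubst \<sigma> t"] wt
    by (simp add: wf_fsubst wt_up has_ty_tsubst)
next
  case (Maj_N s t)
  then show ?thesis using HA_axiom.Maj_N [of \<Delta> "tsubst \<sigma> s" "tsubst \<sigma> t"] wt
    by (simp add: has_ty_tsubst Le_def tsubst_monus)
next
  case (Maj_Fun s \<rho> \<tau> t r)
  then show ?thesis
    using HA_axiom.Maj_Fun [of \<Delta> "tsubst \<sigma> s" \<rho> \<tau> "tsubst \<sigma> t" "tsubst \<sigma> r"] wt
    by (simp add: has_ty_tsubst)
qed (use wt in \<open>simp_all add: asubst_ainst del: asubst_asubst\<close>,
  (rule HA_axiom.intros[simplified]; auto intro: has_ty_tsubst wf_asubst wt_up)+)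

text \<open>Induction on the derivation. The substitution and the target context vary because the
  quantifier rules continue with \<open>up \<sigma>\<close> in an extended context.\<close>

lemma prv_fsubst_image:
  assumes T: "subst_closed T"
  shows "prv T \<Gamma> \<Phi> A \<Longrightarrow> wt_env \<sigma> \<Gamma> \<Delta> \<Longrightarrow> prv T \<Delta> (fsubst \<sigma> ` \<Phi>) (fsubst \<sigma> A)"
proof (induction arbitrary: \<sigma> \<Delta> rule: prv.induct)
  case (extra_ax A \<Gamma> \<Phi>)
  then show ?case using T by (auto simp: subst_closed_def intro: prv.extra_ax)
next
  case (OrE \<Gamma> \<Phi> A B C)
  show ?case using OrE.IH [OF OrE.prems] by (auto intro: prv.OrE)
next
  case (ImpI \<Gamma> A \<Phi> B)
  show ?case using ImpI.IH [OF ImpI.prems] ImpI.hyps ImpI.prems by (auto intro: prv.ImpI wf_fsubst)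
next
  case (ImpE \<Gamma> \<Phi> A B)
  show ?case using ImpE.IH [OF ImpE.prems] by (auto intro: prv.ImpE)
next
  case (UAllI \<rho> \<Gamma> \<Phi> A)
  show ?case using UAllI.IH [OF wt_up [OF UAllI.prems]]
    by (auto intro!: prv.UAllI simp: image_image)
next
  case (UAllE \<Gamma> \<Phi> \<rho> A t)
  have "prv T \<Delta> (fsubst \<sigma> ` \<Phi>) (finst (tsubst \<sigma> t) (fsubst (up \<sigma>) A))"
    using UAllE.IH [OF UAllE.prems] has_ty_tsubst [OF UAllE.hyps(2) UAllE.prems]
    by (intro prv.UAllE) simp_all
  then show ?case by (simp only: fsubst_finst)
next
  case (UExI \<Gamma> \<Phi> t A \<rho>)
  have "prv T \<Delta> (fsubst \<sigma> ` \<Phi>) (finst (tsubst \<sigma> t) (fsubst (up \<sigma>) A))"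
    using UExI.IH [OF UExI.prems] by (simp only: fsubst_finst)
  then show ?case
    using has_ty_tsubst [OF UExI.hyps(2) UExI.prems] wf_fsubst [OF UExI.hyps(3) wt_up [OF UExI.prems]]
    by (auto intro: prv.UExI)
next
  case (UExE \<Gamma> \<Phi> \<rho> A C)
  have "prv T (\<rho> # \<Delta>) (insert (fsubst (up \<sigma>) A) (flift 1 ` fsubst \<sigma> ` \<Phi>)) (flift 1 (fsubst \<sigma> C))"
    using UExE.IH(2) [OF wt_up [OF UExE.prems]] by (simp add: image_image)
  then show ?case using UExE.IH(1) [OF UExE.prems] by (auto intro: prv.UExE)
next
  case (Maj_rule A \<Gamma> t \<rho> \<tau> q \<Phi>)
  \<comment> \<open>The premise of the rule has no hypotheses, and the image of the empty set is
    empty, so the rule applies again after the substitution.\<close>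
  have "prv T \<Delta> (fsubst \<sigma> ` \<Phi>) (Imp (fsubst \<sigma> A) (Atom (Maj (Fun \<rho> \<tau>) (tsubst \<sigma> t) (tsubst \<sigma> q))))"
  proof (rule prv.Maj_rule)
    show "prv T (\<rho> # \<rho> # \<Delta>) {}
      (Imp (And (flift 2 (fsubst \<sigma> A)) (Atom (Maj \<rho> (Var 1) (Var 0))))
           (And (Atom (Maj \<tau> (tlift 2 (tsubst \<sigma> t) \<bullet> Var 1) (tlift 2 (tsubst \<sigma> q) \<bullet> Var 0)))
                (Atom (Maj \<tau> (tlift 2 (tsubst \<sigma> q) \<bullet> Var 1) (tlift 2 (tsubst \<sigma> q) \<bullet> Var 0)))))"
      using Maj_rule.IH [OF wt_up [OF wt_up [OF Maj_rule.prems]]]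
      by (simp add: fsubst_up_up_lift tsubst_up_up_lift del: fsubst_fsubst tsubst_tsubst)
  qed (use Maj_rule in \<open>auto intro: wf_fsubst has_ty_tsubst\<close>)
  then show ?case by simp
qed (auto intro: prv.intros wf_fsubst HA_axiom_fsubst)

lemma prv_fsubst:
  assumes "subst_closed T" and "prv T \<Gamma> \<Phi> A" and "wt_env \<sigma> \<Gamma> \<Delta>" and "fsubst \<sigma> ` \<Phi> \<subseteq> \<Psi>"
  shows "prv T \<Delta> \<Psi> (fsubst \<sigma> A)"
  using prv_mono [OF prv_fsubst_image [OF assms(1-3)] assms(4)] .

section \<open>Derived rules, in particular for bounded quantifiers\<close>

lemma prv_insert: "wf_fm \<Gamma> A \<Longrightarrow> prv T \<Gamma> (insert A \<Phi>) A"
  by (simp add: hyp)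

lemma prv_weaken: "prv T \<Gamma> \<Phi> A \<Longrightarrow> prv T \<Gamma> (insert B \<Phi>) A"
  by (erule prv_mono) blast

lemma prv_cut: "prv T \<Gamma> \<Phi> A \<Longrightarrow> prv T \<Gamma> (insert A \<Phi>) B \<Longrightarrow> wf_fm \<Gamma> A \<Longrightarrow> prv T \<Gamma> \<Phi> B"
  using ImpE [OF ImpI] .

lemma prv_Iff_iff: "prv T \<Gamma> \<Phi> (Iff A B) \<Longrightarrow> prv T \<Gamma> \<Phi> A \<longleftrightarrow> prv T \<Gamma> \<Phi> B"
  using ImpE [OF AndE1] ImpE [OF AndE2] by metis

text \<open>The calculus has no rules for bounded quantifiers. This rule and the following three
  come from the rules for unbounded quantifiers through the axioms \<open>BAll_iff\<close> and
  \<open>BEx_iff\<close>.\<close>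

lemma BAllI:
  assumes "prv T (\<rho> # \<Gamma>) (insert (Atom (Maj \<rho> (Var 0) (tlift 1 t))) (flift 1 ` \<Phi>)) A"
    and "wf_fm (\<rho> # \<Gamma>) A" and "has_ty \<Gamma> t \<rho>"
  shows "prv T \<Gamma> \<Phi> (BAll \<rho> t A)"
proof -
  have "prv T \<Gamma> \<Phi> (UAll \<rho> (Imp (Atom (Maj \<rho> (Var 0) (tlift 1 t))) A))"
    using assms by (intro UAllI ImpI) simp_all
  then show ?thesis
    using prv_Iff_iff [OF HA_ax [OF BAll_iff [OF assms(2,3)]]] by blast
qed

lemma BAllE:
  assumes "prv T \<Gamma> \<Phi> (BAll \<rho> t A)" and "prv T \<Gamma> \<Phi> (Atom (Maj \<rho> s t))"
    and "wf_fm (\<rho> # \<Gamma>) A" and "has_ty \<Gamma> t \<rho>" and "has_ty \<Gamma> s \<rho>"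
  shows "prv T \<Gamma> \<Phi> (finst s A)"
proof -
  have "prv T \<Gamma> \<Phi> (UAll \<rho> (Imp (Atom (Maj \<rho> (Var 0) (tlift 1 t))) A))"
    using prv_Iff_iff [OF HA_ax [OF BAll_iff [OF assms(3,4)]]] assms(1) by blast
  from UAllE [OF this assms(5)] have "prv T \<Gamma> \<Phi> (Imp (Atom (Maj \<rho> s t)) (finst s A))"
    by simp
  then show ?thesis using assms(2) by (rule ImpE)
qed

lemma BExI:
  assumes "prv T \<Gamma> \<Phi> (finst s A)" and "prv T \<Gamma> \<Phi> (Atom (Maj \<rho> s t))"
    and "wf_fm (\<rho> # \<Gamma>) A" and "has_ty \<Gamma> t \<rho>" and "has_ty \<Gamma> s \<rho>"
  shows "prv T \<Gamma> \<Phi> (BEx \<rho> t A)"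
proof -
  have "prv T \<Gamma> \<Phi> (UEx \<rho> (And (Atom (Maj \<rho> (Var 0) (tlift 1 t))) A))"
    using assms by (intro UExI [where t = s]) (simp_all add: AndI)
  then show ?thesis
    using prv_Iff_iff [OF HA_ax [OF BEx_iff [OF assms(3,4)]]] by blast
qed

lemma BExE:
  assumes "prv T \<Gamma> \<Phi> (BEx \<rho> t A)"
    and "prv T (\<rho> # \<Gamma>) (insert A (insert (Atom (Maj \<rho> (Var 0) (tlift 1 t))) (flift 1 ` \<Phi>))) (flift 1 C)"
    and "wf_fm (\<rho> # \<Gamma>) A" and "has_ty \<Gamma> t \<rho>"
  shows "prv T \<Gamma> \<Phi> C"
proof (rule UExE)
  let ?M = "Atom (Maj \<rho> (Var 0) (tlift 1 t))"
  show "prv T \<Gamma> \<Phi> (UEx \<rho> (And ?M A))"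
    using prv_Iff_iff [OF HA_ax [OF BEx_iff [OF assms(3,4)]]] assms(1) by blast
  have wf: "wf_fm (\<rho> # \<Gamma>) (And ?M A)" using assms by simp
  have c: "prv T (\<rho> # \<Gamma>) (insert (And ?M A) (flift 1 ` \<Phi>)) (And ?M A)"
    using wf by (rule prv_insert)
  have "prv T (\<rho> # \<Gamma>) (insert A (insert ?M (insert (And ?M A) (flift 1 ` \<Phi>)))) (flift 1 C)"
    using assms(2) by (rule prv_mono) blast
  then show "prv T (\<rho> # \<Gamma>) (insert (And ?M A) (flift 1 ` \<Phi>)) (flift 1 C)"
    using prv_cut [OF AndE1 [OF c] prv_cut [OF prv_weaken [OF AndE2 [OF c]]]] wf by simp
qed

section \<open>Arithmetic and transitivity of majorizability\<close>

lemma has_ty_consts [simp]: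
  "has_ty \<Gamma> Zero \<upsilon> \<longleftrightarrow> \<upsilon> = N"
  "has_ty \<Gamma> Succ \<upsilon> \<longleftrightarrow> \<upsilon> = Fun N N"
  "has_ty \<Gamma> (Pi \<rho> \<tau>) \<upsilon> \<longleftrightarrow> \<upsilon> = funs [\<rho>, \<tau>] \<rho>"
  "has_ty \<Gamma> (Sigma \<rho> \<sigma> \<tau>) \<upsilon> \<longleftrightarrow> \<upsilon> = funs [funs [\<rho>, \<sigma>] \<tau>, Fun \<rho> \<sigma>, \<rho>] \<tau>"
  "has_ty \<Gamma> (Rec \<rho>) \<upsilon> \<longleftrightarrow> \<upsilon> = funs [\<rho>, funs [\<rho>, N] \<rho>, N] \<rho>"
  by (subst has_ty.simps; simp)+

lemma has_ty_App: "has_ty \<Gamma> (t \<bullet> s) \<tau> \<longleftrightarrow> (\<exists>\<rho>. has_ty \<Gamma> t (Fun \<rho> \<tau>) \<and> has_ty \<Gamma> s \<rho>)"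
  by (auto elim: has_ty_AppE intro: has_ty.intros)

lemma funs_Nil [simp]: "funs [] \<tau> = \<tau>"
  and funs_Cons [simp]: "funs (\<rho> # \<rho>s) \<tau> = Fun \<rho> (funs \<rho>s \<tau>)"
  by (simp_all add: funs_def)

lemma has_ty_id_tm [simp]: "has_ty \<Gamma> id_tm \<tau> \<longleftrightarrow> \<tau> = Fun N N"
  by (auto simp: id_tm_def has_ty_App)

lemma has_ty_pred_tm [simp]: "has_ty \<Gamma> pred_tm \<tau> \<longleftrightarrow> \<tau> = Fun N N"
  by (auto simp: pred_tm_def has_ty_App)

lemma has_ty_pred_App [simp]: "has_ty \<Gamma> (pred_tm \<bullet> t) \<tau> \<longleftrightarrow> \<tau> = N \<and> has_ty \<Gamma> t N"
  by (auto simp: has_ty_App)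

lemma has_ty_Succ_App [simp]: "has_ty \<Gamma> (Succ \<bullet> t) \<tau> \<longleftrightarrow> \<tau> = N \<and> has_ty \<Gamma> t N"
  by (auto simp: has_ty_App)

lemma has_ty_monus [simp]:
  "has_ty \<Gamma> (monus s t) \<tau> \<longleftrightarrow> \<tau> = N \<and> has_ty \<Gamma> s N \<and> has_ty \<Gamma> t N"
  by (auto simp: monus_def has_ty_App)

lemma tsubst_pred_tm [simp]: "tsubst \<sigma> pred_tm = pred_tm"
  by (simp add: pred_tm_def id_tm_def)

lemma tsubst_id_tm [simp]: "tsubst \<sigma> id_tm = id_tm"
  by (simp add: id_tm_def)

text \<open>Equality exists at type \<open>N\<close> only, so convertibility at an arbitrary type is
  interchangeability in all atomic formulas. This is the form in which the axioms give the equations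
  for combinators and recursors.\<close>

definition conv :: "(ty list \<Rightarrow> fm set) \<Rightarrow> ty list \<Rightarrow> fm set \<Rightarrow> ty \<Rightarrow> tm \<Rightarrow> tm \<Rightarrow> bool" where
  "conv T \<Gamma> \<Phi> \<rho> s t \<longleftrightarrow>
    (\<forall>a. wf_atm (\<rho> # \<Gamma>) a \<longrightarrow> prv T \<Gamma> \<Phi> (Iff (Atom (ainst s a)) (Atom (ainst t a))))"

text \<open>An atom with a distinguished place for \<open>s \<bullet> r\<close> becomes an atom with
  a distinguished place for \<open>s\<close> once variable 0 is replaced by
  \<open>Var 0 \<bullet> tlift 1 r\<close>.\<close>

lemma conv_App:
  assumes "conv T \<Gamma> \<Phi> (Fun \<rho> \<tau>) s t" and r: "has_ty \<Gamma> r \<rho>"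
  shows "conv T \<Gamma> \<Phi> \<tau> (s \<bullet> r) (t \<bullet> r)"
  unfolding conv_def
proof (intro allI impI)
  fix a assume a: "wf_atm (\<tau> # \<Gamma>) a"
  let ?\<sigma> = "extend (lift_env 1) [Var 0 \<bullet> tlift 1 r]"
  have "wf_atm (Fun \<rho> \<tau> # \<Gamma>) (asubst ?\<sigma> a)"
    using a r by (auto intro!: wf_asubst wt_extend_single simp: has_ty_App)
  with assms(1) have "prv T \<Gamma> \<Phi> (Iff (Atom (ainst s (asubst ?\<sigma> a))) (Atom (ainst t (asubst ?\<sigma> a))))"
    unfolding conv_def by blast
  moreover have "ainst s' (asubst ?\<sigma> a) = ainst (s' \<bullet> r) a" for s'
  proof -
    have "tsubst (inst_env s') (?\<sigma> i) = inst_env (s' \<bullet> r) i" for i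
      by (cases i) simp_all
    then show ?thesis by simp
  qed
  ultimately show "prv T \<Gamma> \<Phi> (Iff (Atom (ainst (s \<bullet> r) a)) (Atom (ainst (t \<bullet> r) a)))"
    by simp
qed

lemma conv_trans:
  assumes "conv T \<Gamma> \<Phi> \<rho> r s" and "conv T \<Gamma> \<Phi> \<rho> s t" and ty: "has_ty \<Gamma> r \<rho>" "has_ty \<Gamma> t \<rho>"
  shows "conv T \<Gamma> \<Phi> \<rho> r t"
  unfolding conv_def
proof (intro allI impI)
  fix a assume a: "wf_atm (\<rho> # \<Gamma>) a"
  have wf: "wf_atm \<Gamma> (ainst r a)" "wf_atm \<Gamma> (ainst t a)"
    using a ty by (auto intro!: wf_asubst wt_inst)
  have 1: "prv T \<Gamma> \<Phi> (Iff (Atom (ainst r a)) (Atom (ainst s a)))"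
    and 2: "prv T \<Gamma> \<Phi> (Iff (Atom (ainst s a)) (Atom (ainst t a)))"
    using assms a by (auto simp: conv_def)
  have "prv T \<Gamma> (insert A \<Phi>) (Iff (Atom (ainst r a)) (Atom (ainst s a)))"
    "prv T \<Gamma> (insert A \<Phi>) (Iff (Atom (ainst s a)) (Atom (ainst t a)))" for A
    using 1 2 by (auto intro: prv_weaken)
  then have "prv T \<Gamma> (insert A \<Phi>) (Atom (ainst r a)) \<longleftrightarrow> prv T \<Gamma> (insert A \<Phi>) (Atom (ainst t a))" for A
    using prv_Iff_iff by metis
  then show "prv T \<Gamma> \<Phi> (Iff (Atom (ainst r a)) (Atom (ainst t a)))"
    using wf prv_insert by (intro AndI ImpI) (metis wf_fm.simps(1))+
qed

text \<open>Leibniz's argument with the atom x = t, whose instance at t is reflexivity.\<close>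

lemma conv_eq:
  assumes "conv T \<Gamma> \<Phi> N s t" and "has_ty \<Gamma> s N" and "has_ty \<Gamma> t N"
  shows "prv T \<Gamma> \<Phi> (Atom (Eq s t))"
proof -
  have "wf_atm (N # \<Gamma>) (Eq (Var 0) (tlift 1 t))" using assms by simp
  with assms(1) have "prv T \<Gamma> \<Phi> (Iff (Atom (Eq s t)) (Atom (Eq t t)))"
    unfolding conv_def by fastforce
  from prv_Iff_iff [OF this] show ?thesis using assms HA_ax [OF eq_refl] by blast
qed

lemma conv_Pi: "has_ty \<Gamma> s \<rho> \<Longrightarrow> has_ty \<Gamma> t \<tau> \<Longrightarrow> conv T \<Gamma> \<Phi> \<rho> (Pi \<rho> \<tau> \<bullet> s \<bullet> t) s"
  unfolding conv_def by (blast intro: HA_ax Pi_conv)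

lemma conv_Sigma:
  "has_ty \<Gamma> r (funs [\<rho>, \<sigma>] \<tau>) \<Longrightarrow> has_ty \<Gamma> s (Fun \<rho> \<sigma>) \<Longrightarrow> has_ty \<Gamma> t \<rho> \<Longrightarrow>
    conv T \<Gamma> \<Phi> \<tau> (Sigma \<rho> \<sigma> \<tau> \<bullet> r \<bullet> s \<bullet> t) (r \<bullet> t \<bullet> (s \<bullet> t))"
  unfolding conv_def by (blast intro: HA_ax Sigma_conv)

lemma conv_Rec_Zero:
  "has_ty \<Gamma> r \<rho> \<Longrightarrow> has_ty \<Gamma> s (funs [\<rho>, N] \<rho>) \<Longrightarrow>
    conv T \<Gamma> \<Phi> \<rho> (Rec \<rho> \<bullet> r \<bullet> s \<bullet> Zero) r"
  unfolding conv_def by (blast intro: HA_ax Rec_Zero)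

lemma conv_Rec_Succ:
  "has_ty \<Gamma> r \<rho> \<Longrightarrow> has_ty \<Gamma> s (funs [\<rho>, N] \<rho>) \<Longrightarrow> has_ty \<Gamma> t N \<Longrightarrow>
    conv T \<Gamma> \<Phi> \<rho> (Rec \<rho> \<bullet> r \<bullet> s \<bullet> (Succ \<bullet> t)) (s \<bullet> (Rec \<rho> \<bullet> r \<bullet> s \<bullet> t) \<bullet> t)"
  unfolding conv_def by (blast intro: HA_ax Rec_Succ)

lemma eq_reflI: "has_ty \<Gamma> t N \<Longrightarrow> prv T \<Gamma> \<Phi> (Atom (Eq t t))"
  by (blast intro: HA_ax eq_refl)

lemma eq_atom:
  assumes "prv T \<Gamma> \<Phi> (Atom (Eq s t))" and "prv T \<Gamma> \<Phi> (Atom (ainst s a))"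
    and "wf_atm (N # \<Gamma>) a" and "has_ty \<Gamma> s N" and "has_ty \<Gamma> t N"
  shows "prv T \<Gamma> \<Phi> (Atom (ainst t a))"
  using ImpE [OF HA_ax [OF eq_subst [OF assms(3-5)]] AndI [OF assms(1,2)]] .

lemma eq_sym:
  assumes "prv T \<Gamma> \<Phi> (Atom (Eq s t))" and "has_ty \<Gamma> s N" and "has_ty \<Gamma> t N"
  shows "prv T \<Gamma> \<Phi> (Atom (Eq t s))"
  using eq_atom [OF assms(1), of "Eq (Var 0) (tlift 1 s)"] assms by (simp add: eq_reflI)

lemma eq_trans:
  assumes "prv T \<Gamma> \<Phi> (Atom (Eq r s))" and "prv T \<Gamma> \<Phi> (Atom (Eq s t))"
    and "has_ty \<Gamma> r N" and "has_ty \<Gamma> s N" and "has_ty \<Gamma> t N"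
  shows "prv T \<Gamma> \<Phi> (Atom (Eq r t))"
  using eq_atom [OF assms(2), of "Eq (tlift 1 r) (Var 0)"] assms by simp

text \<open>Replacement is available in atoms only; the atom used is c[s] = c, with s fixed on the
  left, and its instance at s is reflexivity.\<close>

lemma eq_cong:
  assumes "prv T \<Gamma> \<Phi> (Atom (Eq s t))" and "has_ty (N # \<Gamma>) c N"
    and "has_ty \<Gamma> s N" and "has_ty \<Gamma> t N"
  shows "prv T \<Gamma> \<Phi> (Atom (Eq (tsubst (inst_env s) c) (tsubst (inst_env t) c)))"
proof -
  have "has_ty \<Gamma> (tsubst (inst_env s) c) N"
    using assms by (blast intro: has_ty_tsubst wt_inst)
  then show ?thesis
    using eq_atom [OF assms(1), of "Eq (tlift 1 (tsubst (inst_env s) c)) c"] assms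
    by (simp del: tsubst_tsubst add: eq_reflI) (simp add: eq_reflI)
qed

lemma eq_pred:
  "prv T \<Gamma> \<Phi> (Atom (Eq s t)) \<Longrightarrow> has_ty \<Gamma> s N \<Longrightarrow> has_ty \<Gamma> t N \<Longrightarrow>
    prv T \<Gamma> \<Phi> (Atom (Eq (pred_tm \<bullet> s) (pred_tm \<bullet> t)))"
  using eq_cong [of T \<Gamma> \<Phi> s t "pred_tm \<bullet> Var 0"] by simp

lemma eq_monus:
  assumes "prv T \<Gamma> \<Phi> (Atom (Eq s s'))" and "prv T \<Gamma> \<Phi> (Atom (Eq t t'))"
    and ty: "has_ty \<Gamma> s N" "has_ty \<Gamma> t N" "has_ty \<Gamma> s' N" "has_ty \<Gamma> t' N"
  shows "prv T \<Gamma> \<Phi> (Atom (Eq (monus s t) (monus s' t')))"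
  using eq_cong [OF assms(1), of "monus (Var 0) (tlift 1 t)"]
    eq_cong [OF assms(2), of "monus (tlift 1 s') (Var 0)"] ty
  by (auto simp: tsubst_monus intro: eq_trans)

section \<open>Recursion equations of predecessor and cut-off subtraction\<close>

lemma pred_Zero: "prv T \<Gamma> \<Phi> (Atom (Eq (pred_tm \<bullet> Zero) Zero))"
  unfolding pred_tm_def by (intro conv_eq conv_Rec_Zero) (simp_all add: has_ty_App)

text \<open>\<open>id_tm\<close> is the combinator S K K, and K t (K t) reduces to t.\<close>

lemma conv_id: "has_ty \<Gamma> t N \<Longrightarrow> conv T \<Gamma> \<Phi> N (id_tm \<bullet> t) t"
  unfolding id_tm_def
  by (rule conv_trans [OF conv_Sigma conv_Pi]) (simp_all add: has_ty_App)

text \<open>The step term \<open>Pi (Fun N N) N \<bullet> id_tm\<close> discards the recursive value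
  and returns the index, which here is t.\<close>

lemma pred_Succ:
  assumes "has_ty \<Gamma> t N"
  shows "prv T \<Gamma> \<Phi> (Atom (Eq (pred_tm \<bullet> (Succ \<bullet> t)) t))"
proof (rule conv_eq)
  have "conv T \<Gamma> \<Phi> N (pred_tm \<bullet> (Succ \<bullet> t)) (Pi (Fun N N) N \<bullet> id_tm \<bullet> (pred_tm \<bullet> t) \<bullet> t)"
    unfolding pred_tm_def by (rule conv_Rec_Succ) (use assms in \<open>simp_all add: has_ty_App\<close>)
  moreover have "conv T \<Gamma> \<Phi> N (Pi (Fun N N) N \<bullet> id_tm \<bullet> (pred_tm \<bullet> t) \<bullet> t) (id_tm \<bullet> t)"
    by (rule conv_App [OF conv_Pi]) (use assms in simp_all)
  ultimately show "conv T \<Gamma> \<Phi> N (pred_tm \<bullet> (Succ \<bullet> t)) t"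
    using assms conv_id [OF assms, of T \<Phi>]
    by - (erule conv_trans, erule conv_trans, assumption, simp_all add: has_ty_App)
qed (use assms in simp_all)

lemma monus_Zero: "has_ty \<Gamma> s N \<Longrightarrow> prv T \<Gamma> \<Phi> (Atom (Eq (monus s Zero) s))"
  unfolding monus_def by (intro conv_eq conv_Rec_Zero) (simp_all add: has_ty_App)

text \<open>The recursor applies the step term to the value at t and to t. Its S combinator
  duplicates that value, and the two K combinators discard one copy and the index, leaving the
  predecessor of the value.\<close>

lemma monus_Succ:
  assumes "has_ty \<Gamma> s N" and "has_ty \<Gamma> t N"
  shows "prv T \<Gamma> \<Phi> (Atom (Eq (monus s (Succ \<bullet> t)) (pred_tm \<bullet> monus s t)))"
proof (rule conv_eq)
  let ?k = "Pi (funs [N, N] N) N \<bullet> Pi N N"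
  let ?f = "Sigma N N (Fun N N) \<bullet> ?k \<bullet> pred_tm"
  let ?m = "monus s t"
  have "conv T \<Gamma> \<Phi> N (monus s (Succ \<bullet> t)) (?f \<bullet> ?m \<bullet> t)"
    unfolding monus_def by (rule conv_Rec_Succ) (use assms in \<open>simp_all add: has_ty_App\<close>)
  moreover have "conv T \<Gamma> \<Phi> N (?f \<bullet> ?m \<bullet> t) (?k \<bullet> ?m \<bullet> (pred_tm \<bullet> ?m) \<bullet> t)"
    by (rule conv_App [OF conv_Sigma]) (use assms in \<open>simp_all add: has_ty_App\<close>)
  moreover have "conv T \<Gamma> \<Phi> N (?k \<bullet> ?m \<bullet> (pred_tm \<bullet> ?m) \<bullet> t) (Pi N N \<bullet> (pred_tm \<bullet> ?m) \<bullet> t)"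
    using conv_Pi [of \<Gamma> "Pi N N" "funs [N, N] N" ?m N T \<Phi>] assms
    by (intro conv_App [where \<rho> = N]) simp_all
  moreover have "conv T \<Gamma> \<Phi> N (Pi N N \<bullet> (pred_tm \<bullet> ?m) \<bullet> t) (pred_tm \<bullet> ?m)"
    by (rule conv_Pi) (use assms in simp_all)
  ultimately show "conv T \<Gamma> \<Phi> N (monus s (Succ \<bullet> t)) (pred_tm \<bullet> ?m)"
    using assms by - (erule conv_trans, erule conv_trans, erule conv_trans, assumption,
      simp_all add: has_ty_App)
qed (use assms in simp_all)

lemma prv_induct:
  assumes "prv T \<Gamma> \<Phi> (finst Zero A)"
    and "prv T (N # \<Gamma>) (insert A (flift 1 ` \<Phi>)) (fsubst succ_env A)"
    and "wf_fm (N # \<Gamma>) A" and "has_ty \<Gamma> t N"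
  shows "prv T \<Gamma> \<Phi> (finst t A)"
  by (rule UAllE [OF ImpE [OF HA_ax [OF induction [OF assms(3)]]] assms(4)])
    (intro AndI UAllI ImpI assms)

lemma succ_env_0 [simp]: "succ_env 0 = Succ \<bullet> Var 0"
  and succ_env_Suc [simp]: "succ_env (Suc i) = Var (Suc i)"
  by (simp_all add: succ_env_def)

lemma tsubst_succ_lift [simp]: "tsubst succ_env (tlift (Suc 0) t) = tlift (Suc 0) t"
  by (simp add: lift_env_def)

text \<open>Both sides iterate the predecessor on s, so induction on t suffices. The equation
  permits a successor on the right of an inequality to be traded for a predecessor on the
  left.\<close>

lemma monus_pred:
  assumes "has_ty \<Gamma> s N" and "has_ty \<Gamma> t N"
  shows "prv T \<Gamma> \<Phi> (Atom (Eq (monus (pred_tm \<bullet> s) t) (pred_tm \<bullet> monus s t)))"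
proof -
  let ?s = "tlift 1 s"
  let ?A = "Atom (Eq (monus (pred_tm \<bullet> ?s) (Var 0)) (pred_tm \<bullet> monus ?s (Var 0)))"
  have "prv T \<Gamma> \<Phi> (finst t ?A)"
  proof (rule prv_induct)
    have "prv T \<Gamma> \<Phi> (Atom (Eq (pred_tm \<bullet> s) (pred_tm \<bullet> monus s Zero)))"
      using assms by (intro eq_pred eq_sym [OF monus_Zero]) simp_all
    then show "prv T \<Gamma> \<Phi> (finst Zero ?A)"
      using assms by (auto simp: tsubst_monus intro: eq_trans [OF monus_Zero])
    let ?\<Phi> = "insert ?A (flift 1 ` \<Phi>)"
    have s: "has_ty (N # \<Gamma>) ?s N" using assms by simp
    have "prv T (N # \<Gamma>) ?\<Phi> ?A" by (rule prv_insert) (use s in simp)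
    then have 1: "prv T (N # \<Gamma>) ?\<Phi> (Atom (Eq (pred_tm \<bullet> monus (pred_tm \<bullet> ?s) (Var 0))
        (pred_tm \<bullet> (pred_tm \<bullet> monus ?s (Var 0)))))"
      using s by (intro eq_pred) simp_all
    have 2: "prv T (N # \<Gamma>) ?\<Phi> (Atom (Eq (pred_tm \<bullet> (pred_tm \<bullet> monus ?s (Var 0)))
        (pred_tm \<bullet> monus ?s (Succ \<bullet> Var 0))))"
      using s by (intro eq_pred eq_sym [OF monus_Succ]) simp_all
    have "prv T (N # \<Gamma>) ?\<Phi> (Atom (Eq (monus (pred_tm \<bullet> ?s) (Succ \<bullet> Var 0))
        (pred_tm \<bullet> monus ?s (Succ \<bullet> Var 0))))"
      using s by (intro eq_trans [OF monus_Succ eq_trans [OF 1 2]]) simp_all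
    then show "prv T (N # \<Gamma>) ?\<Phi> (fsubst succ_env ?A)"
      by (simp add: tsubst_monus lift_env_def)
  qed (use assms in simp_all)
  then show ?thesis by (simp add: tsubst_monus)
qed

section \<open>The order on the natural numbers\<close>

lemma Le_refl:
  assumes "has_ty \<Gamma> t N"
  shows "prv T \<Gamma> \<Phi> (Le t t)"
proof -
  let ?A = "Le (Var 0) (Var 0)"
  have "prv T \<Gamma> \<Phi> (finst t ?A)"
  proof (rule prv_induct)
    show "prv T \<Gamma> \<Phi> (finst Zero ?A)"
      by (simp add: Le_def tsubst_monus monus_Zero)
    let ?\<Phi> = "insert ?A (flift 1 ` \<Phi>)"
    let ?s = "Succ \<bullet> Var 0"
    have h: "prv T (N # \<Gamma>) ?\<Phi> (Atom (Eq (monus (Var 0) (Var 0)) Zero))"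
      unfolding Le_def by (rule prv_insert) simp
    \<comment> \<open>With \<open>monus\<close> written as a minus sign, the chain is S x - S x =
      pred (S x - x) = pred (S x) - x = x - x, and x - x = 0 is the induction hypothesis.\<close>
    have 1: "prv T (N # \<Gamma>) ?\<Phi> (Atom (Eq (monus ?s ?s) (pred_tm \<bullet> monus ?s (Var 0))))"
      by (rule monus_Succ) simp_all
    have 2: "prv T (N # \<Gamma>) ?\<Phi> (Atom (Eq (pred_tm \<bullet> monus ?s (Var 0)) (monus (pred_tm \<bullet> ?s) (Var 0))))"
      by (intro eq_sym [OF monus_pred]) simp_all
    have 3: "prv T (N # \<Gamma>) ?\<Phi> (Atom (Eq (monus (pred_tm \<bullet> ?s) (Var 0)) (monus (Var 0) (Var 0))))"
      by (intro eq_monus pred_Succ eq_reflI) simp_all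
    show "prv T (N # \<Gamma>) ?\<Phi> (fsubst succ_env ?A)"
      using eq_trans [OF eq_trans [OF eq_trans [OF 1 2] 3] h] by (simp add: Le_def tsubst_monus)
  qed (use assms in \<open>simp_all add: Le_def\<close>)
  then show ?thesis by (simp add: Le_def tsubst_monus)
qed

text \<open>The inductions avoid a case distinction between zero and successor by means of
  \<open>s \<le> S t \<longleftrightarrow> pred s \<le> t\<close>.\<close>

lemma Le_pred:
  assumes le: "prv T \<Gamma> \<Phi> (Le s t)" and s: "has_ty \<Gamma> s N" and t: "has_ty \<Gamma> t N"
  shows "prv T \<Gamma> \<Phi> (Le (pred_tm \<bullet> s) (pred_tm \<bullet> t))"
proof -
  let ?s = "tlift 1 s"
  let ?A = "Imp (Le ?s (Var 0)) (Le (pred_tm \<bullet> ?s) (pred_tm \<bullet> Var 0))"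
  have "prv T \<Gamma> \<Phi> (finst t ?A)"
  proof (rule prv_induct)
    let ?\<Phi> = "insert (Le s Zero) \<Phi>"
    have h: "prv T \<Gamma> ?\<Phi> (Atom (Eq (monus s Zero) Zero))"
      unfolding Le_def using s by (intro prv_insert) simp
    have 1: "prv T \<Gamma> ?\<Phi> (Atom (Eq s Zero))"
      using s by (intro eq_trans [OF eq_sym [OF monus_Zero] h]) simp_all
    have 2: "prv T \<Gamma> ?\<Phi> (Atom (Eq (pred_tm \<bullet> s) Zero))"
      using s by (intro eq_trans [OF eq_pred [OF 1] pred_Zero]) simp_all
    have "prv T \<Gamma> ?\<Phi> (Atom (Eq (monus (pred_tm \<bullet> s) (pred_tm \<bullet> Zero)) (monus Zero Zero)))"
      using s by (intro eq_monus 2 pred_Zero) simp_all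
    from eq_trans [OF this monus_Zero] s
    have "prv T \<Gamma> ?\<Phi> (Le (pred_tm \<bullet> s) (pred_tm \<bullet> Zero))"
      by (simp add: Le_def)
    then show "prv T \<Gamma> \<Phi> (finst Zero ?A)"
      using s by (simp add: Le_def tsubst_monus ImpI)
  next
    \<comment> \<open>For a bound S v the goal is pred s \<le> pred (S v). It follows from pred (S
      v) = v and from pred s - v = pred (s - v) = s - S v, which is 0 by assumption.\<close>
    let ?\<Psi> = "insert (Le ?s (Succ \<bullet> Var 0)) (insert ?A (flift 1 ` \<Phi>))"
    let ?v = "Succ \<bullet> Var 0"
    have s': "has_ty (N # \<Gamma>) ?s N" using s by simp
    have h: "prv T (N # \<Gamma>) ?\<Psi> (Atom (Eq (monus ?s ?v) Zero))"
      unfolding Le_def using s' by (intro prv_insert) simp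
    have 1: "prv T (N # \<Gamma>) ?\<Psi> (Atom (Eq (monus (pred_tm \<bullet> ?s) (pred_tm \<bullet> ?v)) (monus (pred_tm \<bullet> ?s) (Var 0))))"
      using s' by (intro eq_monus pred_Succ eq_reflI) simp_all
    have 2: "prv T (N # \<Gamma>) ?\<Psi> (Atom (Eq (monus (pred_tm \<bullet> ?s) (Var 0)) (pred_tm \<bullet> monus ?s (Var 0))))"
      using s' by (intro monus_pred) simp_all
    have 3: "prv T (N # \<Gamma>) ?\<Psi> (Atom (Eq (pred_tm \<bullet> monus ?s (Var 0)) (monus ?s ?v)))"
      using s' by (intro eq_sym [OF monus_Succ]) simp_all
    have "prv T (N # \<Gamma>) ?\<Psi> (Le (pred_tm \<bullet> ?s) (pred_tm \<bullet> ?v))"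
      using eq_trans [OF eq_trans [OF eq_trans [OF 1 2] 3] h] s' by (simp add: Le_def)
    then have "prv T (N # \<Gamma>) (insert ?A (flift 1 ` \<Phi>)) (Imp (Le ?s ?v) (Le (pred_tm \<bullet> ?s) (pred_tm \<bullet> ?v)))"
      using s' by (intro ImpI) (simp_all add: Le_def)
    then show "prv T (N # \<Gamma>) (insert ?A (flift 1 ` \<Phi>)) (fsubst succ_env ?A)"
      by (simp add: Le_def tsubst_monus lift_env_def)
  qed (use s t in \<open>simp_all add: Le_def\<close>)
  then have "prv T \<Gamma> \<Phi> (Imp (Le s t) (Le (pred_tm \<bullet> s) (pred_tm \<bullet> t)))"
    by (simp add: Le_def tsubst_monus)
  then show ?thesis using le by (rule ImpE)
qed

text \<open>Both subtractions are equal to pred (s - t).\<close>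

lemma Le_Succ_iff:
  assumes s: "has_ty \<Gamma> s N" and t: "has_ty \<Gamma> t N"
  shows "prv T \<Gamma> \<Phi> (Le s (Succ \<bullet> t)) \<longleftrightarrow> prv T \<Gamma> \<Phi> (Le (pred_tm \<bullet> s) t)"
proof -
  have 1: "prv T \<Gamma> \<Phi> (Atom (Eq (monus s (Succ \<bullet> t)) (pred_tm \<bullet> monus s t)))"
    using s t by (rule monus_Succ)
  have 2: "prv T \<Gamma> \<Phi> (Atom (Eq (pred_tm \<bullet> monus s t) (monus (pred_tm \<bullet> s) t)))"
    using s t by (intro eq_sym [OF monus_pred]) simp_all
  have 3: "prv T \<Gamma> \<Phi> (Atom (Eq (monus s (Succ \<bullet> t)) (monus (pred_tm \<bullet> s) t)))"
    using s t by (intro eq_trans [OF 1 2]) simp_all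
  show ?thesis
    using eq_trans [OF 3] eq_trans [OF eq_sym [OF 3]] s t by (auto simp: Le_def)
qed

text \<open>Induction on the upper bound with r and s universally quantified. In the step the
  hypothesis is used for pred r and pred s: \<open>Le_pred\<close> provides pred r \<le> pred s, and
  \<open>Le_Succ_iff\<close> converts the bound S t into t on the way in and back on the way
  out.\<close>

lemma Le_trans:
  assumes "prv T \<Gamma> \<Phi> (Le r s)" and "prv T \<Gamma> \<Phi> (Le s t)"
    and ty: "has_ty \<Gamma> r N" "has_ty \<Gamma> s N" "has_ty \<Gamma> t N"
  shows "prv T \<Gamma> \<Phi> (Le r t)"
proof -
  let ?A = "\<lambda>t. Imp (Le (Var 1) (Var 0)) (Imp (Le (Var 0) t) (Le (Var 1) t))"
  let ?P = "UAll N (UAll N (?A (Var 2)))"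
  have "prv T \<Gamma> \<Phi> (finst t ?P)"
  proof (rule prv_induct)
    let ?\<Gamma> = "N # N # \<Gamma>"
    let ?\<Psi> = "insert (Le (Var 0) Zero) (insert (Le (Var 1) (Var 0)) (flift 1 ` flift 1 ` \<Phi>))"
    \<comment> \<open>A bound of zero forces s = 0, and replacing 0 by s turns r - 0 into r - s,
      which is 0.\<close>
    have h1: "prv T ?\<Gamma> ?\<Psi> (Atom (Eq (monus (Var 0) Zero) Zero))"
      and h2: "prv T ?\<Gamma> ?\<Psi> (Atom (Eq (monus (Var 1) (Var 0)) Zero))"
      unfolding Le_def by (intro hyp; simp)+
    have 1: "prv T ?\<Gamma> ?\<Psi> (Atom (Eq (Var 0) Zero))"
      by (intro eq_trans [OF eq_sym [OF monus_Zero] h1]) simp_all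
    have 2: "prv T ?\<Gamma> ?\<Psi> (Atom (Eq (monus (Var 1) Zero) (monus (Var 1) (Var 0))))"
      by (intro eq_monus eq_reflI eq_sym [OF 1]) simp_all
    have "prv T ?\<Gamma> ?\<Psi> (Le (Var 1) Zero)"
      using eq_trans [OF 2 h2] by (simp add: Le_def)
    then have "prv T \<Gamma> \<Phi> (UAll N (UAll N (?A Zero)))"
      by (intro UAllI ImpI) (simp_all add: Le_def)
    then show "prv T \<Gamma> \<Phi> (finst Zero ?P)"
      by (simp add: Le_def tsubst_monus numeral_2_eq_2)
  next
    let ?\<Gamma> = "N # N # N # \<Gamma>"
    let ?t = "Succ \<bullet> Var 2"
    let ?\<Psi> = "insert (Le (Var 0) ?t) (insert (Le (Var 1) (Var 0))
      (flift 1 ` flift 1 ` insert ?P (flift 1 ` \<Phi>)))"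
    \<comment> \<open>In this context r, s and t are the variables 1, 0 and 2; the two quantifiers
      of the induction hypothesis shift t to variable 4.\<close>
    have Q: "prv T ?\<Gamma> ?\<Psi> (UAll N (UAll N (?A (Var 4))))"
    proof (rule hyp)
      have "UAll N (UAll N (?A (Var 4))) = flift 1 (flift 1 ?P)"
        by (simp add: Le_def tsubst_monus eval_nat_numeral)
      then show "UAll N (UAll N (?A (Var 4))) \<in> ?\<Psi>" by (metis imageI insertI1 insertI2)
    qed (simp add: Le_def)
    have "prv T ?\<Gamma> ?\<Psi> (UAll N (Imp (Le (pred_tm \<bullet> Var 2) (Var 0))
        (Imp (Le (Var 0) (Var 3)) (Le (pred_tm \<bullet> Var 2) (Var 3)))))"
      using UAllE [OF Q, of "pred_tm \<bullet> Var 1"] by (simp add: Le_def tsubst_monus eval_nat_numeral)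
    from UAllE [OF this, of "pred_tm \<bullet> Var 0"]
    have IH: "prv T ?\<Gamma> ?\<Psi> (Imp (Le (pred_tm \<bullet> Var 1) (pred_tm \<bullet> Var 0))
        (Imp (Le (pred_tm \<bullet> Var 0) (Var 2)) (Le (pred_tm \<bullet> Var 1) (Var 2))))"
      by (simp add: Le_def tsubst_monus eval_nat_numeral)
    have h1: "prv T ?\<Gamma> ?\<Psi> (Le (Var 1) (Var 0))" and h2: "prv T ?\<Gamma> ?\<Psi> (Le (Var 0) ?t)"
      by (intro hyp; simp add: Le_def)+
    have "prv T ?\<Gamma> ?\<Psi> (Le (Var 1) ?t)"
      using ImpE [OF ImpE [OF IH Le_pred [OF h1]]] h2 by (simp add: Le_Succ_iff)
    then have "prv T (N # \<Gamma>) (insert ?P (flift 1 ` \<Phi>)) (UAll N (UAll N (?A ?t)))"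
      by (intro UAllI ImpI) (simp_all add: Le_def)
    then show "prv T (N # \<Gamma>) (insert ?P (flift 1 ` \<Phi>)) (fsubst succ_env ?P)"
      by (simp add: Le_def tsubst_monus numeral_2_eq_2)
  qed (use ty in \<open>simp_all add: Le_def\<close>)
  then have "prv T \<Gamma> \<Phi> (UAll N (UAll N (?A (tlift 2 t))))"
    by (simp add: Le_def tsubst_monus numeral_2_eq_2 lift_env_def)
  from UAllE [OF this, of r]
  have "prv T \<Gamma> \<Phi> (UAll N (Imp (Le (tlift 1 r) (Var 0)) (Imp (Le (Var 0) (tlift 1 t)) (Le (tlift 1 r) (tlift 1 t)))))"
    using ty by (simp add: Le_def tsubst_monus lift_env_def numeral_2_eq_2)
  from UAllE [OF this, of s]
  have "prv T \<Gamma> \<Phi> (Imp (Le r s) (Imp (Le s t) (Le r t)))"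
    using ty by (simp add: Le_def tsubst_monus)
  then show ?thesis using assms(1,2) by (blast intro: ImpE)
qed

section \<open>Majorizability at function types\<close>

lemma Maj_Fun_App:
  assumes "prv T \<Gamma> \<Phi> (Atom (Maj (Fun \<rho> \<tau>) s t))" and "prv T \<Gamma> \<Phi> (Atom (Maj \<rho> u v))"
    and "has_ty \<Gamma> s (Fun \<rho> \<tau>)" and "has_ty \<Gamma> t (Fun \<rho> \<tau>)" and "has_ty \<Gamma> u \<rho>" and "has_ty \<Gamma> v \<rho>"
  shows "prv T \<Gamma> \<Phi> (Atom (Maj \<tau> (s \<bullet> u) (t \<bullet> v)))"
    and "prv T \<Gamma> \<Phi> (Atom (Maj \<tau> (t \<bullet> u) (t \<bullet> v)))"
proof -
  have "wf_fm (\<rho> # \<Gamma>) (And (Atom (Maj \<tau> (tlift 1 s \<bullet> Var 0) (tlift 1 t \<bullet> tlift 1 v)))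
      (Atom (Maj \<tau> (tlift 1 t \<bullet> Var 0) (tlift 1 t \<bullet> tlift 1 v))))"
    using assms(3-) by (auto simp: has_ty_App intro!: exI [of _ \<rho>])
  from BAllE [OF ImpE [OF HA_ax [OF Maj_Fun [OF assms(3,4,6)]] assms(1)] assms(2) this assms(6,5)]
  have "prv T \<Gamma> \<Phi> (And (Atom (Maj \<tau> (s \<bullet> u) (t \<bullet> v))) (Atom (Maj \<tau> (t \<bullet> u) (t \<bullet> v))))"
    by simp
  then show "prv T \<Gamma> \<Phi> (Atom (Maj \<tau> (s \<bullet> u) (t \<bullet> v)))"
    and "prv T \<Gamma> \<Phi> (Atom (Maj \<tau> (t \<bullet> u) (t \<bullet> v)))"
    by (blast intro: AndE1 AndE2)+
qed

lemma Maj_N_iff: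
  "has_ty \<Gamma> s N \<Longrightarrow> has_ty \<Gamma> t N \<Longrightarrow> prv T \<Gamma> \<Phi> (Atom (Maj N s t)) \<longleftrightarrow> prv T \<Gamma> \<Phi> (Le s t)"
  by (rule prv_Iff_iff [OF HA_ax [OF Maj_N]])

text \<open>At function types \<open>Maj_Fun\<close> gives, besides s u \<unlhd> t v, also t u
  \<unlhd> t v, which is the premise of \<open>Maj_rule\<close> for the pair t, t. As that premise
  admits no hypotheses, s \<unlhd> t is taken as the bounded antecedent of the rule. At type
  \<open>N\<close> reflexivity of the order suffices.\<close>

lemma Maj_right_refl:
  assumes "prv T \<Gamma> \<Phi> (Atom (Maj \<rho> s t))" and s: "has_ty \<Gamma> s \<rho>" and t: "has_ty \<Gamma> t \<rho>"
  shows "prv T \<Gamma> \<Phi> (Atom (Maj \<rho> t t))"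
proof (cases \<rho>)
  case N
  then show ?thesis using t by (simp add: Maj_N_iff Le_refl)
next
  case (Fun \<rho>' \<tau>)
  let ?A = "Atom (Maj \<rho> s t)"
  have "prv T \<Gamma> \<Phi> (Imp ?A (Atom (Maj (Fun \<rho>' \<tau>) t t)))"
  proof (rule Maj_rule)
    let ?h = "And (flift 2 ?A) (Atom (Maj \<rho>' (Var 1) (Var 0)))"
    have h: "prv T (\<rho>' # \<rho>' # \<Gamma>) {?h} ?h"
      by (rule prv_insert) (use s t Fun in simp)
    have "prv T (\<rho>' # \<rho>' # \<Gamma>) {?h} (Atom (Maj (Fun \<rho>' \<tau>) (tlift 2 s) (tlift 2 t)))"
      and "prv T (\<rho>' # \<rho>' # \<Gamma>) {?h} (Atom (Maj \<rho>' (Var 1) (Var 0)))"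
      using AndE1 [OF h] AndE2 [OF h] Fun by simp_all
    from Maj_Fun_App(2) [OF this]
    show "prv T (\<rho>' # \<rho>' # \<Gamma>) {} (Imp ?h (And
      (Atom (Maj \<tau> (tlift 2 t \<bullet> Var 1) (tlift 2 t \<bullet> Var 0)))
      (Atom (Maj \<tau> (tlift 2 t \<bullet> Var 1) (tlift 2 t \<bullet> Var 0)))))"
      using s t Fun by (intro ImpI AndI) simp_all
  qed (use s t Fun in simp_all)
  with assms(1) Fun show ?thesis by (auto intro: ImpE)
qed

text \<open>Induction on the type. For functions and u \<unlhd> v one has r u \<unlhd> s v and s v
  \<unlhd> t v, and the induction hypothesis at the result type composes them.\<close>

lemma Maj_trans:
  assumes "prv T \<Gamma> \<Phi> (Atom (Maj \<rho> r s))" and "prv T \<Gamma> \<Phi> (Atom (Maj \<rho> s t))"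
    and "has_ty \<Gamma> r \<rho>" and "has_ty \<Gamma> s \<rho>" and "has_ty \<Gamma> t \<rho>"
  shows "prv T \<Gamma> \<Phi> (Atom (Maj \<rho> r t))"
  using assms
proof (induction \<rho> arbitrary: \<Gamma> \<Phi> r s t)
  case N
  then show ?case by (auto simp: Maj_N_iff intro: Le_trans)
next
  case (Fun \<rho> \<tau>)
  \<comment> \<open>Both assumptions are packed into the bounded antecedent of
    \<open>Maj_rule\<close>, since its premise may not depend on \<Phi>.\<close>
  let ?A = "And (Atom (Maj (Fun \<rho> \<tau>) r s)) (Atom (Maj (Fun \<rho> \<tau>) s t))"
  have "prv T \<Gamma> \<Phi> (Imp ?A (Atom (Maj (Fun \<rho> \<tau>) r t)))"
  proof (rule Maj_rule)
    let ?h = "And (flift 2 ?A) (Atom (Maj \<rho> (Var 1) (Var 0)))"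
    let ?\<Gamma> = "\<rho> # \<rho> # \<Gamma>"
    have ty: "has_ty ?\<Gamma> (tlift 2 r) (Fun \<rho> \<tau>)" "has_ty ?\<Gamma> (tlift 2 s) (Fun \<rho> \<tau>)"
      "has_ty ?\<Gamma> (tlift 2 t) (Fun \<rho> \<tau>)" "has_ty ?\<Gamma> (Var 0) \<rho>" "has_ty ?\<Gamma> (Var 1) \<rho>"
      using Fun.prems by simp_all
    have h: "prv T ?\<Gamma> {?h} ?h"
      by (rule prv_insert) (use ty in simp)
    have rs: "prv T ?\<Gamma> {?h} (Atom (Maj (Fun \<rho> \<tau>) (tlift 2 r) (tlift 2 s)))"
      and st: "prv T ?\<Gamma> {?h} (Atom (Maj (Fun \<rho> \<tau>) (tlift 2 s) (tlift 2 t)))"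
      using AndE1 [OF AndE1 [OF h [unfolded fsubst.simps]]] AndE2 [OF AndE1 [OF h [unfolded fsubst.simps]]] by simp_all
    have uv: "prv T ?\<Gamma> {?h} (Atom (Maj \<rho> (Var 1) (Var 0)))"
      using h by (rule AndE2)
    \<comment> \<open>The second link s v \<unlhd> t v has the same argument on both sides, so it
      depends on v being monotone.\<close>
    have vv: "prv T ?\<Gamma> {?h} (Atom (Maj \<rho> (Var 0) (Var 0)))"
      using uv ty(5,4) by (rule Maj_right_refl)
    have "prv T ?\<Gamma> {?h} (Atom (Maj \<tau> (tlift 2 r \<bullet> Var 1) (tlift 2 t \<bullet> Var 0)))"
      by (rule Fun.IH(2) [OF Maj_Fun_App(1) [OF rs uv] Maj_Fun_App(1) [OF st vv]])
        (use ty in \<open>auto simp: has_ty_App\<close>)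
    moreover have "prv T ?\<Gamma> {?h} (Atom (Maj \<tau> (tlift 2 t \<bullet> Var 1) (tlift 2 t \<bullet> Var 0)))"
      by (rule Maj_Fun_App(2) [OF st uv]) (use ty in auto)
    ultimately show "prv T ?\<Gamma> {} (Imp ?h (And
      (Atom (Maj \<tau> (tlift 2 r \<bullet> Var 1) (tlift 2 t \<bullet> Var 0)))
      (Atom (Maj \<tau> (tlift 2 t \<bullet> Var 1) (tlift 2 t \<bullet> Var 0)))))"
      using ty by (intro ImpI AndI) simp_all
  qed (use Fun.prems in simp_all)
  then show ?case using AndI [OF Fun.prems(1,2)] by (rule ImpE)
qed

section \<open>Tuples and blocks of quantifiers\<close>

text \<open>A morphism leads from the world \<open>(\<Gamma>, \<Phi>)\<close> to a world \<open>(\<Delta>, \<Psi>)\<close>.  Derivability is preserved along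
  morphisms, so quantifier blocks can be treated as in Kripke semantics: the introduction rules
  below quantify over all later worlds and all terms there instead of handling fresh variables.\<close>

definition morph :: "(nat \<Rightarrow> tm) \<Rightarrow> ty list \<Rightarrow> fm set \<Rightarrow> ty list \<Rightarrow> fm set \<Rightarrow> bool" where
  "morph \<sigma> \<Gamma> \<Phi> \<Delta> \<Psi> \<longleftrightarrow> wt_env \<sigma> \<Gamma> \<Delta> \<and> fsubst \<sigma> ` \<Phi> \<subseteq> \<Psi>"

lemma tsubst_o [simp]: "tsubst \<sigma> \<circ> tsubst \<tau> = tsubst (\<lambda>i. tsubst \<sigma> (\<tau> i))"
  by (rule ext) simp

lemma tsubst_Var_id [simp]: "tsubst Var = (\<lambda>t. t)"
  by (rule ext) simp

lemma morph_Var [simp]: "morph Var \<Gamma> \<Phi> \<Gamma> \<Psi> \<longleftrightarrow> \<Phi> \<subseteq> \<Psi>"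
  by (simp add: morph_def)

lemma morph_comp:
  "morph \<sigma> \<Gamma> \<Phi> \<Delta> \<Psi> \<Longrightarrow> morph \<tau> \<Delta> \<Psi> \<Theta> \<Omega> \<Longrightarrow> morph (\<lambda>i. tsubst \<tau> (\<sigma> i)) \<Gamma> \<Phi> \<Theta> \<Omega>"
  by (fastforce simp: morph_def intro: wt_comp)

lemma morph_mono: "morph \<sigma> \<Gamma> \<Phi> \<Delta> \<Psi> \<Longrightarrow> \<Psi> \<subseteq> \<Psi>' \<Longrightarrow> morph \<sigma> \<Gamma> \<Phi> \<Delta> \<Psi>'"
  by (auto simp: morph_def)

lemma morph_wt: "morph \<sigma> \<Gamma> \<Phi> \<Delta> \<Psi> \<Longrightarrow> wt_env \<sigma> \<Gamma> \<Delta>"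
  by (simp add: morph_def)

lemma prv_morph:
  "subst_closed T \<Longrightarrow> prv T \<Gamma> \<Phi> A \<Longrightarrow> morph \<sigma> \<Gamma> \<Phi> \<Delta> \<Psi> \<Longrightarrow> prv T \<Delta> \<Psi> (fsubst \<sigma> A)"
  by (auto simp: morph_def intro: prv_fsubst)

text \<open>Typing of both tuples is built in, so one \<open>majs\<close> fact also provides
  well-typedness and lengths. With the same tuple twice it says that the tuple is monotone.\<close>

fun majs :: "(ty list \<Rightarrow> fm set) \<Rightarrow> ty list \<Rightarrow> fm set \<Rightarrow> ty list \<Rightarrow> tm list \<Rightarrow> tm list \<Rightarrow> bool" where
  "majs T \<Gamma> \<Phi> [] [] [] \<longleftrightarrow> True"
| "majs T \<Gamma> \<Phi> (\<rho> # \<rho>s) (s # ss) (t # ts) \<longleftrightarrow>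
    has_ty \<Gamma> s \<rho> \<and> has_ty \<Gamma> t \<rho> \<and> prv T \<Gamma> \<Phi> (Atom (Maj \<rho> s t)) \<and> majs T \<Gamma> \<Phi> \<rho>s ss ts"
| "majs T \<Gamma> \<Phi> _ _ _ \<longleftrightarrow> False"

lemma majs_Cons1:
  "majs T \<Gamma> \<Phi> (\<rho> # \<rho>s) ss ts \<longleftrightarrow> (\<exists>s ss' t ts'. ss = s # ss' \<and> ts = t # ts' \<and>
    has_ty \<Gamma> s \<rho> \<and> has_ty \<Gamma> t \<rho> \<and> prv T \<Gamma> \<Phi> (Atom (Maj \<rho> s t)) \<and> majs T \<Gamma> \<Phi> \<rho>s ss' ts')"
  by (cases ss; cases ts) auto

lemma majs_Nil1 [simp]: "majs T \<Gamma> \<Phi> [] ss ts \<longleftrightarrow> ss = [] \<and> ts = []"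
  by (cases ss; cases ts) auto

lemma majs_tys:
  "majs T \<Gamma> \<Phi> \<rho>s ss ts \<Longrightarrow> list_all2 (has_ty \<Gamma>) ss \<rho>s"
  "majs T \<Gamma> \<Phi> \<rho>s ss ts \<Longrightarrow> list_all2 (has_ty \<Gamma>) ts \<rho>s"
  by (induction T \<Gamma> \<Phi> \<rho>s ss ts rule: majs.induct) auto

lemma majs_length:
  "majs T \<Gamma> \<Phi> \<rho>s ss ts \<Longrightarrow> length ss = length \<rho>s"
  "majs T \<Gamma> \<Phi> \<rho>s ss ts \<Longrightarrow> length ts = length \<rho>s"
  by (auto dest: majs_tys list_all2_lengthD)

lemma majs_trans:
  "majs T \<Gamma> \<Phi> \<rho>s rs ss \<Longrightarrow> majs T \<Gamma> \<Phi> \<rho>s ss ts \<Longrightarrow> majs T \<Gamma> \<Phi> \<rho>s rs ts"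
  by (induction \<rho>s arbitrary: rs ss ts) (auto simp: majs_Cons1 intro: Maj_trans)

lemma majs_append:
  "majs T \<Gamma> \<Phi> (\<rho>s @ \<tau>s) ss ts \<longleftrightarrow>
    majs T \<Gamma> \<Phi> \<rho>s (take (length \<rho>s) ss) (take (length \<rho>s) ts) \<and>
    majs T \<Gamma> \<Phi> \<tau>s (drop (length \<rho>s) ss) (drop (length \<rho>s) ts)"
proof (induction \<rho>s arbitrary: ss ts)
  case (Cons \<rho> \<rho>s)
  then show ?case by (cases ss; cases ts) auto
qed simp

lemma majs_morph:
  "subst_closed T \<Longrightarrow> majs T \<Gamma> \<Phi> \<rho>s ss ts \<Longrightarrow> morph \<sigma> \<Gamma> \<Phi> \<Delta> \<Psi> \<Longrightarrow>
    majs T \<Delta> \<Psi> \<rho>s (map (tsubst \<sigma>) ss) (map (tsubst \<sigma>) ts)"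
proof (induction \<rho>s arbitrary: ss ts)
  case (Cons \<rho> \<rho>s)
  have "prv T \<Delta> \<Psi> (Atom (Maj \<rho> (tsubst \<sigma> s) (tsubst \<sigma> t)))"
    if "prv T \<Gamma> \<Phi> (Atom (Maj \<rho> s t))" for s t
    using prv_morph [OF Cons.prems(1) that Cons.prems(3)] by simp
  then show ?case
    using Cons.prems Cons.IH has_ty_tsubst [OF _ morph_wt [OF Cons.prems(3)]]
    by (auto simp: majs_Cons1)
qed simp

lemma majs_mono: "majs T \<Gamma> \<Phi> \<rho>s ss ts \<Longrightarrow> \<Phi> \<subseteq> \<Psi> \<Longrightarrow> majs T \<Gamma> \<Psi> \<rho>s ss ts"
  by (induction \<rho>s arbitrary: ss ts) (auto simp: majs_Cons1 intro: prv_mono)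

lemma Maj_apps:
  "prv T \<Gamma> \<Phi> (Atom (Maj (funs \<rho>s \<tau>) s t)) \<Longrightarrow> majs T \<Gamma> \<Phi> \<rho>s us vs \<Longrightarrow>
    has_ty \<Gamma> s (funs \<rho>s \<tau>) \<Longrightarrow> has_ty \<Gamma> t (funs \<rho>s \<tau>) \<Longrightarrow>
    prv T \<Gamma> \<Phi> (Atom (Maj \<tau> (apps s us) (apps t vs)))"
proof (induction \<rho>s arbitrary: s t us vs)
  case (Cons \<rho> \<rho>s)
  then obtain u us' v vs' where uv: "us = u # us'" "vs = v # vs'" "has_ty \<Gamma> u \<rho>" "has_ty \<Gamma> v \<rho>"
    "prv T \<Gamma> \<Phi> (Atom (Maj \<rho> u v))" "majs T \<Gamma> \<Phi> \<rho>s us' vs'"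
    by (auto simp: majs_Cons1)
  have "prv T \<Gamma> \<Phi> (Atom (Maj \<tau> (apps (s \<bullet> u) us') (apps (t \<bullet> v) vs')))"
  proof (rule Cons.IH)
    show "prv T \<Gamma> \<Phi> (Atom (Maj (funs \<rho>s \<tau>) (s \<bullet> u) (t \<bullet> v)))"
      using Cons.prems uv by (intro Maj_Fun_App(1)) simp_all
  qed (use Cons.prems uv in \<open>auto simp: has_ty_App\<close>)
  then show ?case using uv by (simp add: apps_def)
qed (simp add: apps_def)

text \<open>Componentwise iteration of \<open>Maj_Fun\<close>. Applied with equal tuples on both
  sides it shows that Y x is monotone when Y and x are, as the negation case and both claims
  require.\<close>

lemma majs_tapps:
  "majs T \<Gamma> \<Phi> (map (funs \<rho>s) \<tau>s) ss ts \<Longrightarrow> majs T \<Gamma> \<Phi> \<rho>s us vs \<Longrightarrow>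
    majs T \<Gamma> \<Phi> \<tau>s (tapps ss us) (tapps ts vs)"
proof (induction \<tau>s arbitrary: ss ts)
  case (Cons \<tau> \<tau>s)
  then show ?case
    using majs_tys [OF Cons.prems(2)] by (auto simp: majs_Cons1 tapps_def intro: Maj_apps has_ty_apps)
qed (simp add: tapps_def)

section \<open>Guards and quantifier blocks: substitution and well-formedness\<close>

lemma fsubst_Conj [simp]: "fsubst \<sigma> (Conj As) = Conj (map (fsubst \<sigma>) As)"
  by (induction As rule: Conj.induct) simp_all

lemma fsubst_ImpGuard [simp]: "fsubst \<sigma> (ImpGuard As A) = ImpGuard (map (fsubst \<sigma>) As) (fsubst \<sigma> A)"
  by (simp add: ImpGuard_def)

lemma fsubst_AndGuard [simp]: "fsubst \<sigma> (AndGuard As A) = AndGuard (map (fsubst \<sigma>) As) (fsubst \<sigma> A)"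
  by (simp add: AndGuard_def)

lemma wf_Conj [simp]: "wf_fm \<Gamma> (Conj As) \<longleftrightarrow> (\<forall>A \<in> set As. wf_fm \<Gamma> A)"
  by (induction As rule: Conj.induct) auto

lemma wf_ImpGuard [simp]: "wf_fm \<Gamma> (ImpGuard As A) \<longleftrightarrow> (\<forall>A \<in> set As. wf_fm \<Gamma> A) \<and> wf_fm \<Gamma> A"
  by (auto simp: ImpGuard_def)

lemma wf_AndGuard [simp]: "wf_fm \<Gamma> (AndGuard As A) \<longleftrightarrow> (\<forall>A \<in> set As. wf_fm \<Gamma> A) \<and> wf_fm \<Gamma> A"
  by (auto simp: AndGuard_def)

lemma prv_And [simp]: "prv T \<Gamma> \<Phi> (And A B) \<longleftrightarrow> prv T \<Gamma> \<Phi> A \<and> prv T \<Gamma> \<Phi> B"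
  using AndI AndE1 AndE2 by metis

lemma prv_Imp: "wf_fm \<Gamma> A \<Longrightarrow> prv T \<Gamma> \<Phi> (Imp A B) \<longleftrightarrow> prv T \<Gamma> (insert A \<Phi>) B"
  by (auto intro: ImpI ImpE [OF prv_weaken prv_insert])

lemma prv_Conj: "prv T \<Gamma> \<Phi> (Conj As) \<longleftrightarrow> (\<forall>A \<in> set As. prv T \<Gamma> \<Phi> A)"
  by (induction As rule: Conj.induct) (auto intro: prv_insert simp: prv_Imp)

lemma prv_cut_list:
  "\<forall>A \<in> set As. wf_fm \<Gamma> A \<and> prv T \<Gamma> \<Phi> A \<Longrightarrow> prv T \<Gamma> (\<Phi> \<union> set As) B \<Longrightarrow> prv T \<Gamma> \<Phi> B"
proof (induction As arbitrary: \<Phi>)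
  case (Cons A As)
  have "prv T \<Gamma> (insert A \<Phi>) B"
    by (rule Cons.IH) (use Cons.prems in \<open>auto intro: prv_weaken\<close>)
  then show ?case using Cons.prems(1) by (intro prv_cut [of T \<Gamma> \<Phi> A B]) simp_all
qed simp

text \<open>A nonempty guard enters as a single conjunction, from which the separate hypotheses are
  recovered by cuts; an empty guard leaves no implication at all.\<close>

lemma prv_ImpGuardI:
  assumes "prv T \<Gamma> (\<Phi> \<union> set As) A" and "\<forall>A \<in> set As. wf_fm \<Gamma> A"
  shows "prv T \<Gamma> \<Phi> (ImpGuard As A)"
proof (cases "As = []")
  case False
  have "prv T \<Gamma> (insert (Conj As) \<Phi>) A"
  proof (rule prv_cut_list)
    have "prv T \<Gamma> (insert (Conj As) \<Phi>) (Conj As)"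
      using assms(2) by (intro prv_insert) simp
    then show "\<forall>A \<in> set As. wf_fm \<Gamma> A \<and> prv T \<Gamma> (insert (Conj As) \<Phi>) A"
      using assms(2) by (simp add: prv_Conj)
    show "prv T \<Gamma> (insert (Conj As) \<Phi> \<union> set As) A"
      using assms(1) by (rule prv_mono) blast
  qed
  with False assms(2) show ?thesis by (simp add: ImpGuard_def ImpI)
qed (use assms in \<open>simp add: ImpGuard_def\<close>)

lemma prv_ImpGuardE:
  "prv T \<Gamma> \<Phi> (ImpGuard As A) \<Longrightarrow> \<forall>A \<in> set As. prv T \<Gamma> \<Phi> A \<Longrightarrow> prv T \<Gamma> \<Phi> A"
  unfolding ImpGuard_def using ImpE prv_Conj by (metis (full_types))

lemma prv_AndGuard: "prv T \<Gamma> \<Phi> (AndGuard As A) \<longleftrightarrow> (\<forall>A \<in> set As. prv T \<Gamma> \<Phi> A) \<and> prv T \<Gamma> \<Phi> A"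
  by (simp add: AndGuard_def prv_Conj)

lemma map_self_maj:
  "map (fsubst \<sigma>) (self_maj \<rho>s) =
    map2 (\<lambda>\<rho> x. Atom (Maj \<rho> x x)) \<rho>s (map (tsubst \<sigma>) (vars (length \<rho>s)))"
  by (auto simp: self_maj_def zip_map2)

lemma map_self_maj_upn [simp]:
  "length \<rho>s = n \<Longrightarrow> map (fsubst (upn n \<sigma>)) (self_maj \<rho>s) = self_maj \<rho>s"
  unfolding map_self_maj by (simp add: self_maj_def)

lemma map_self_maj_extend:
  "length ss = length \<rho>s \<Longrightarrow>
    map (fsubst (extend \<sigma> ss)) (self_maj \<rho>s) = map2 (\<lambda>\<rho> x. Atom (Maj \<rho> x x)) \<rho>s ss"
  unfolding map_self_maj by simp

lemma majs_self_iff: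
  "list_all2 (has_ty \<Gamma>) ss \<rho>s \<Longrightarrow>
    majs T \<Gamma> \<Phi> \<rho>s ss ss \<longleftrightarrow> (\<forall>A \<in> set (map2 (\<lambda>\<rho> x. Atom (Maj \<rho> x x)) \<rho>s ss). prv T \<Gamma> \<Phi> A)"
  by (induction rule: list_all2_induct) auto

lemma wf_map2_self:
  "list_all2 (has_ty \<Gamma>) ss \<rho>s \<Longrightarrow> A \<in> set (map2 (\<lambda>\<rho> x. Atom (Maj \<rho> x x)) \<rho>s ss) \<Longrightarrow> wf_fm \<Gamma> A"
  by (auto simp: list_all2_conv_all_nth set_zip)

lemma wf_self_maj: "A \<in> set (self_maj \<rho>s) \<Longrightarrow> wf_fm (rev \<rho>s @ \<Gamma>) A"
  unfolding self_maj_def by (rule wf_map2_self [OF list_all2_vars])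

lemma fsubst_BAlls:
  "length ts = length \<rho>s \<Longrightarrow>
    fsubst \<sigma> (BAlls \<rho>s ts A) = BAlls \<rho>s (map (tsubst \<sigma>) ts) (fsubst (upn (length \<rho>s) \<sigma>) A)"
proof (induction \<rho>s arbitrary: ts \<sigma>)
  case (Cons \<rho> \<rho>s)
  then show ?case by (cases ts) (simp_all add: upn_Suc)
qed simp

lemma fsubst_BExs:
  "length ts = length \<rho>s \<Longrightarrow>
    fsubst \<sigma> (BExs \<rho>s ts A) = BExs \<rho>s (map (tsubst \<sigma>) ts) (fsubst (upn (length \<rho>s) \<sigma>) A)"
proof (induction \<rho>s arbitrary: ts \<sigma>)
  case (Cons \<rho> \<rho>s)
  then show ?case by (cases ts) (simp_all add: upn_Suc)
qed simp

lemma fsubst_UAlls: "fsubst \<sigma> (UAlls \<rho>s A) = UAlls \<rho>s (fsubst (upn (length \<rho>s) \<sigma>) A)"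
  by (induction \<rho>s arbitrary: \<sigma>) (simp_all add: upn_Suc)

lemma fsubst_UExs: "fsubst \<sigma> (UExs \<rho>s A) = UExs \<rho>s (fsubst (upn (length \<rho>s) \<sigma>) A)"
  by (induction \<rho>s arbitrary: \<sigma>) (simp_all add: upn_Suc)

lemma wf_BAlls:
  "list_all2 (has_ty \<Gamma>) ts \<rho>s \<Longrightarrow> wf_fm \<Gamma> (BAlls \<rho>s ts A) \<longleftrightarrow> wf_fm (rev \<rho>s @ \<Gamma>) A"
  by (induction \<rho>s arbitrary: \<Gamma> ts) (auto simp: list_all2_Cons2 list_all2_tsubst)

lemma wf_BExs:
  "list_all2 (has_ty \<Gamma>) ts \<rho>s \<Longrightarrow> wf_fm \<Gamma> (BExs \<rho>s ts A) \<longleftrightarrow> wf_fm (rev \<rho>s @ \<Gamma>) A"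
  by (induction \<rho>s arbitrary: \<Gamma> ts) (auto simp: list_all2_Cons2 list_all2_tsubst)

lemma wf_UAlls: "wf_fm \<Gamma> (UAlls \<rho>s A) \<longleftrightarrow> wf_fm (rev \<rho>s @ \<Gamma>) A"
  by (induction \<rho>s arbitrary: \<Gamma>) simp_all

lemma wf_UExs: "wf_fm \<Gamma> (UExs \<rho>s A) \<longleftrightarrow> wf_fm (rev \<rho>s @ \<Gamma>) A"
  by (induction \<rho>s arbitrary: \<Gamma>) simp_all

section \<open>Rules for whole blocks of quantifiers\<close>

lemma finst_up: "finst s (fsubst (up \<sigma>) A) = fsubst (extend \<sigma> [s]) A"
proof -
  have "tsubst (inst_env s) (up \<sigma> i) = extend \<sigma> [s] i" for i
    by (cases i) simp_all
  then show ?thesis by simp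
qed

text \<open>A substitution out of an extended context is its restriction to the old variables
  together with the term given to the fresh variable 0. This converts a fresh variable into an
  arbitrary term in a later world.\<close>

lemma extend_fresh: "extend (\<lambda>i. \<sigma> (Suc i)) [\<sigma> 0] = \<sigma>"
proof
  fix i show "extend (\<lambda>i. \<sigma> (Suc i)) [\<sigma> 0] i = \<sigma> i" by (cases i) simp_all
qed

lemma morph_drop:
  assumes "morph \<sigma> (\<rho> # \<Gamma>) \<Phi>' \<Delta> \<Psi>" and "flift 1 ` \<Phi> \<subseteq> \<Phi>'"
  shows "morph (\<lambda>i. \<sigma> (Suc i)) \<Gamma> \<Phi> \<Delta> \<Psi>"
proof -
  have "morph (lift_env 1) \<Gamma> \<Phi> (\<rho> # \<Gamma>) \<Phi>'"
    using assms(2) by (simp add: morph_def)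
  from morph_comp [OF this assms(1)] show ?thesis by simp
qed

lemma wt_upn:
  assumes "wt_env \<sigma> \<Gamma> \<Delta>"
  shows "wt_env (upn (length \<rho>s) \<sigma>) (rev \<rho>s @ \<Gamma>) (rev \<rho>s @ \<Delta>)"
  using assms
proof (induction \<rho>s arbitrary: \<sigma> \<Gamma> \<Delta>)
  case (Cons \<rho> \<rho>s)
  from Cons.IH [OF wt_up [OF Cons.prems, of \<rho>]] show ?case by (simp add: upn_Suc)
qed simp

text \<open>Induction on the block. A morphism \<sigma> out of the world extended by the first bound
  variable amounts to a morphism out of the original world together with the term
  \<open>\<sigma> 0\<close>, which becomes the head of the tuple; the hypothesis about that variable
  is carried along \<sigma> and bounds the head.\<close>

lemma BAlls_I:
  assumes "\<And>\<Delta> \<Psi> \<sigma> ss. morph \<sigma> \<Gamma> \<Phi> \<Delta> \<Psi> \<Longrightarrow> majs T \<Delta> \<Psi> \<rho>s ss (map (tsubst \<sigma>) ts) \<Longrightarrow>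
      prv T \<Delta> \<Psi> (fsubst (extend \<sigma> ss) A)"
    and "list_all2 (has_ty \<Gamma>) ts \<rho>s" and "wf_fm (rev \<rho>s @ \<Gamma>) A" and T: "subst_closed T"
  shows "prv T \<Gamma> \<Phi> (BAlls \<rho>s ts A)"
  using assms(1-3)
proof (induction \<rho>s arbitrary: \<Gamma> \<Phi> ts)
  case Nil
  from Nil.prems(1) [of Var \<Gamma> \<Phi> "[]"] Nil.prems(2) show ?case by simp
next
  case (Cons \<rho> \<rho>s)
  then obtain t ts' where ts: "ts = t # ts'" "has_ty \<Gamma> t \<rho>" "list_all2 (has_ty \<Gamma>) ts' \<rho>s"
    by (auto simp: list_all2_Cons2)
  let ?M = "Atom (Maj \<rho> (Var 0) (tlift 1 t))"
  have tys: "list_all2 (has_ty (\<rho> # \<Gamma>)) (map (tlift 1) ts') \<rho>s"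
    using ts by (auto intro: list_all2_tsubst)
  have "prv T (\<rho> # \<Gamma>) (insert ?M (flift 1 ` \<Phi>)) (BAlls \<rho>s (map (tlift 1) ts') A)"
  proof (rule Cons.IH)
    fix \<Delta> \<Psi> \<sigma> ss
    assume m: "morph \<sigma> (\<rho> # \<Gamma>) (insert ?M (flift 1 ` \<Phi>)) \<Delta> \<Psi>"
      and maj: "majs T \<Delta> \<Psi> \<rho>s ss (map (tsubst \<sigma>) (map (tlift 1) ts'))"
    have "prv T (\<rho> # \<Gamma>) (insert ?M (flift 1 ` \<Phi>)) ?M"
      using ts by (intro prv_insert) simp
    from prv_morph [OF T this m]
    have M: "prv T \<Delta> \<Psi> (Atom (Maj \<rho> (\<sigma> 0) (tsubst (\<lambda>i. \<sigma> (Suc i)) t)))" by simp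
    have ty: "has_ty \<Delta> (\<sigma> 0) \<rho>" "has_ty \<Delta> (tsubst (\<lambda>i. \<sigma> (Suc i)) t) \<rho>"
      using m has_ty_tsubst [OF has_ty_tlift_1 [OF ts(2)] morph_wt [OF m]]
      by (auto simp: morph_def wt_env_def)
    have "morph (\<lambda>i. \<sigma> (Suc i)) \<Gamma> \<Phi> \<Delta> \<Psi>"
      using m by (rule morph_drop) blast
    then have "prv T \<Delta> \<Psi> (fsubst (extend (\<lambda>i. \<sigma> (Suc i)) (\<sigma> 0 # ss)) A)"
      by (rule Cons.prems(1)) (use maj M ty ts in simp)
    then show "prv T \<Delta> \<Psi> (fsubst (extend \<sigma> ss) A)" by (simp add: extend_Cons [of _ "\<sigma> 0" ss] extend_fresh)
  qed (use Cons.prems tys in simp_all)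
  then have "prv T \<Gamma> \<Phi> (BAll \<rho> t (BAlls \<rho>s (map (tlift 1) ts') A))"
    by (rule BAllI) (use Cons.prems(3) ts tys in \<open>simp_all add: wf_BAlls\<close>)
  then show ?case using ts by simp
qed

text \<open>The matrix varies in the induction because instantiating the outermost quantifier
  substitutes into everything below it.\<close>

lemma BAlls_E:
  assumes "prv T \<Gamma> \<Phi> (BAlls \<rho>s ts A)" and "majs T \<Gamma> \<Phi> \<rho>s ss ts" and "wf_fm (rev \<rho>s @ \<Gamma>) A"
  shows "prv T \<Gamma> \<Phi> (fsubst (extend Var ss) A)"
  using assms
proof (induction \<rho>s arbitrary: ss ts A)
  case (Cons \<rho> \<rho>s)
  then obtain s ss' t ts' where st: "ss = s # ss'" "ts = t # ts'" "has_ty \<Gamma> s \<rho>" "has_ty \<Gamma> t \<rho>"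
    "prv T \<Gamma> \<Phi> (Atom (Maj \<rho> s t))" "majs T \<Gamma> \<Phi> \<rho>s ss' ts'"
    by (auto simp: majs_Cons1)
  have tys: "list_all2 (has_ty \<Gamma>) ts' \<rho>s" using st by (auto dest: majs_tys)
  then have len: "length ts' = length \<rho>s" by (rule list_all2_lengthD)
  have len': "length ss' = length \<rho>s" using st(6) by (rule majs_length)
  have "prv T \<Gamma> \<Phi> (finst s (BAlls \<rho>s (map (tlift 1) ts') A))"
  proof (rule BAllE)
    show "prv T \<Gamma> \<Phi> (BAll \<rho> t (BAlls \<rho>s (map (tlift 1) ts') A))" using Cons.prems st by simp
    show "wf_fm (\<rho> # \<Gamma>) (BAlls \<rho>s (map (tlift 1) ts') A)"
      using Cons.prems(3) list_all2_tsubst [OF tys wt_lift_1] by (simp add: wf_BAlls)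
  qed (use st in simp_all)
  then have *: "prv T \<Gamma> \<Phi> (BAlls \<rho>s ts' (fsubst (upn (length \<rho>s) (inst_env s)) A))"
    using len by (simp add: fsubst_BAlls comp_def)
  have wt: "wt_env (upn (length \<rho>s) (inst_env s)) (rev (\<rho> # \<rho>s) @ \<Gamma>) (rev \<rho>s @ \<Gamma>)"
    using wt_upn [OF wt_inst [OF st(3)], of \<rho>s] by simp
  from Cons.IH [OF * st(6) wf_fsubst [OF Cons.prems(3) wt]]
  have "prv T \<Gamma> \<Phi> (fsubst (\<lambda>i. tsubst (extend Var ss') (upn (length \<rho>s) (inst_env s) i)) A)"
    by simp
  then show ?case
    using len' by (simp add: tsubst_extend_upn st(1) extend_Cons [of _ s ss'] inst_env_extend)
qed simp

lemma BExs_I: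
  assumes "prv T \<Gamma> \<Phi> (fsubst (extend Var ss) A)" and "majs T \<Gamma> \<Phi> \<rho>s ss ts"
    and "wf_fm (rev \<rho>s @ \<Gamma>) A"
  shows "prv T \<Gamma> \<Phi> (BExs \<rho>s ts A)"
  using assms
proof (induction \<rho>s arbitrary: ss ts A)
  case (Cons \<rho> \<rho>s)
  then obtain s ss' t ts' where st: "ss = s # ss'" "ts = t # ts'" "has_ty \<Gamma> s \<rho>" "has_ty \<Gamma> t \<rho>"
    "prv T \<Gamma> \<Phi> (Atom (Maj \<rho> s t))" "majs T \<Gamma> \<Phi> \<rho>s ss' ts'"
    by (auto simp: majs_Cons1)
  have tys: "list_all2 (has_ty \<Gamma>) ts' \<rho>s" using st by (auto dest: majs_tys)
  then have len: "length ts' = length \<rho>s" by (rule list_all2_lengthD)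
  have len': "length ss' = length \<rho>s" using st(6) by (rule majs_length)
  have wt: "wt_env (upn (length \<rho>s) (inst_env s)) (rev (\<rho> # \<rho>s) @ \<Gamma>) (rev \<rho>s @ \<Gamma>)"
    using wt_upn [OF wt_inst [OF st(3)], of \<rho>s] by simp
  have "prv T \<Gamma> \<Phi> (fsubst (extend Var ss') (fsubst (upn (length \<rho>s) (inst_env s)) A))"
    using Cons.prems(1) len' by (simp add: tsubst_extend_upn st(1) extend_Cons [of _ s ss'] inst_env_extend)
  from Cons.IH [OF this st(6) wf_fsubst [OF Cons.prems(3) wt]]
  have "prv T \<Gamma> \<Phi> (finst s (BExs \<rho>s (map (tlift 1) ts') A))"
    using len by (simp add: fsubst_BExs)
  then have "prv T \<Gamma> \<Phi> (BEx \<rho> t (BExs \<rho>s (map (tlift 1) ts') A))"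
    using st(5)
  proof (rule BExI)
    show "wf_fm (\<rho> # \<Gamma>) (BExs \<rho>s (map (tlift 1) ts') A)"
      using Cons.prems(3) list_all2_tsubst [OF tys wt_lift_1] by (simp add: wf_BExs)
  qed (use st in simp_all)
  then show ?case using st by simp
qed simp

text \<open>Dual to \<open>BAlls_I\<close>: the eigenvariables of the eliminations become arbitrary
  terms in later worlds. The conclusion varies in the induction since it is lifted past each of
  them.\<close>

lemma BExs_E:
  assumes "prv T \<Gamma> \<Phi> (BExs \<rho>s ts A)"
    and "\<And>\<Delta> \<Psi> \<sigma> ss. morph \<sigma> \<Gamma> \<Phi> \<Delta> \<Psi> \<Longrightarrow> majs T \<Delta> \<Psi> \<rho>s ss (map (tsubst \<sigma>) ts) \<Longrightarrow>
      prv T \<Delta> \<Psi> (fsubst (extend \<sigma> ss) A) \<Longrightarrow> prv T \<Delta> \<Psi> (fsubst \<sigma> C)"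
    and "list_all2 (has_ty \<Gamma>) ts \<rho>s" and "wf_fm (rev \<rho>s @ \<Gamma>) A" and T: "subst_closed T"
  shows "prv T \<Gamma> \<Phi> C"
  using assms(1-4)
proof (induction \<rho>s arbitrary: \<Gamma> \<Phi> ts C)
  case Nil
  from Nil.prems(2) [of Var \<Gamma> \<Phi> "[]"] Nil.prems(1,3) show ?case by simp
next
  case (Cons \<rho> \<rho>s)
  then obtain t ts' where ts: "ts = t # ts'" "has_ty \<Gamma> t \<rho>" "list_all2 (has_ty \<Gamma>) ts' \<rho>s"
    by (auto simp: list_all2_Cons2)
  let ?M = "Atom (Maj \<rho> (Var 0) (tlift 1 t))" and ?A = "BExs \<rho>s (map (tlift 1) ts') A"
  let ?\<Phi> = "insert ?A (insert ?M (flift 1 ` \<Phi>))"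
  have tys: "list_all2 (has_ty (\<rho> # \<Gamma>)) (map (tlift 1) ts') \<rho>s"
    using ts by (auto intro: list_all2_tsubst)
  have wf: "wf_fm (\<rho> # \<Gamma>) ?A" using Cons.prems(4) tys by (simp add: wf_BExs)
  have "prv T (\<rho> # \<Gamma>) ?\<Phi> ?A" using wf by (rule prv_insert)
  then have "prv T (\<rho> # \<Gamma>) ?\<Phi> (flift 1 C)"
  proof (rule Cons.IH)
    fix \<Delta> \<Psi> \<sigma> ss
    assume m: "morph \<sigma> (\<rho> # \<Gamma>) ?\<Phi> \<Delta> \<Psi>"
      and maj: "majs T \<Delta> \<Psi> \<rho>s ss (map (tsubst \<sigma>) (map (tlift 1) ts'))"
      and A: "prv T \<Delta> \<Psi> (fsubst (extend \<sigma> ss) A)"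
    have "prv T (\<rho> # \<Gamma>) ?\<Phi> ?M"
      using ts by (intro hyp) simp_all
    from prv_morph [OF T this m]
    have M: "prv T \<Delta> \<Psi> (Atom (Maj \<rho> (\<sigma> 0) (tsubst (\<lambda>i. \<sigma> (Suc i)) t)))" by simp
    have ty: "has_ty \<Delta> (\<sigma> 0) \<rho>" "has_ty \<Delta> (tsubst (\<lambda>i. \<sigma> (Suc i)) t) \<rho>"
      using m has_ty_tsubst [OF has_ty_tlift_1 [OF ts(2)] morph_wt [OF m]]
      by (auto simp: morph_def wt_env_def)
    have A': "prv T \<Delta> \<Psi> (fsubst (extend (\<lambda>i. \<sigma> (Suc i)) (\<sigma> 0 # ss)) A)"
      using A by (simp add: extend_Cons [of _ "\<sigma> 0" ss] extend_fresh)
    have "morph (\<lambda>i. \<sigma> (Suc i)) \<Gamma> \<Phi> \<Delta> \<Psi>"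
      using m by (rule morph_drop) blast
    then have "prv T \<Delta> \<Psi> (fsubst (\<lambda>i. \<sigma> (Suc i)) C)"
      by (rule Cons.prems(2) [OF _ _ A']) (use maj M ty ts in simp)
    then show "prv T \<Delta> \<Psi> (fsubst \<sigma> (flift 1 C))" by simp
  qed (use Cons.prems tys in simp_all)
  moreover have "prv T \<Gamma> \<Phi> (BEx \<rho> t ?A)" using Cons.prems(1) ts by simp
  ultimately show ?case using wf ts(2) by (intro BExE [of T \<Gamma> \<Phi> \<rho> t ?A C])
qed

lemma UAlls_I:
  assumes "prv T (rev \<rho>s @ \<Gamma>) (flift (length \<rho>s) ` \<Phi>) A"
  shows "prv T \<Gamma> \<Phi> (UAlls \<rho>s A)"
  using assms
proof (induction \<rho>s arbitrary: \<Gamma> \<Phi>)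
  case (Cons \<rho> \<rho>s)
  have "prv T (\<rho> # \<Gamma>) (flift 1 ` \<Phi>) (UAlls \<rho>s A)"
    by (rule Cons.IH) (use Cons.prems in \<open>simp add: image_image lift_env_def\<close>)
  then show ?case by (simp add: UAllI)
qed simp

lemma UAlls_E:
  assumes "prv T \<Gamma> \<Phi> (UAlls \<rho>s A)" and "list_all2 (has_ty \<Gamma>) ss \<rho>s"
  shows "prv T \<Gamma> \<Phi> (fsubst (extend Var ss) A)"
  using assms
proof (induction \<rho>s arbitrary: ss A)
  case (Cons \<rho> \<rho>s)
  then obtain s ss' where ss: "ss = s # ss'" "has_ty \<Gamma> s \<rho>" "list_all2 (has_ty \<Gamma>) ss' \<rho>s"
    by (auto simp: list_all2_Cons2)
  have len: "length ss' = length \<rho>s" using ss(3) by (rule list_all2_lengthD)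
  have "prv T \<Gamma> \<Phi> (finst s (UAlls \<rho>s A))"
    using UAllE [OF _ ss(2)] Cons.prems(1) by simp
  then have "prv T \<Gamma> \<Phi> (UAlls \<rho>s (fsubst (upn (length \<rho>s) (inst_env s)) A))"
    by (simp add: fsubst_UAlls)
  from Cons.IH [OF this ss(3)] show ?case
    using len by (simp add: tsubst_extend_upn ss(1) extend_Cons [of _ s ss'] inst_env_extend)
qed simp

lemma UExs_I:
  assumes "prv T \<Gamma> \<Phi> (fsubst (extend Var ss) A)" and "list_all2 (has_ty \<Gamma>) ss \<rho>s"
    and "wf_fm (rev \<rho>s @ \<Gamma>) A"
  shows "prv T \<Gamma> \<Phi> (UExs \<rho>s A)"
  using assms
proof (induction \<rho>s arbitrary: ss A)
  case (Cons \<rho> \<rho>s)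
  then obtain s ss' where ss: "ss = s # ss'" "has_ty \<Gamma> s \<rho>" "list_all2 (has_ty \<Gamma>) ss' \<rho>s"
    by (auto simp: list_all2_Cons2)
  have len: "length ss' = length \<rho>s" using ss(3) by (rule list_all2_lengthD)
  have wt: "wt_env (upn (length \<rho>s) (inst_env s)) (rev (\<rho> # \<rho>s) @ \<Gamma>) (rev \<rho>s @ \<Gamma>)"
    using wt_upn [OF wt_inst [OF ss(2)], of \<rho>s] by simp
  have "prv T \<Gamma> \<Phi> (fsubst (extend Var ss') (fsubst (upn (length \<rho>s) (inst_env s)) A))"
    using Cons.prems(1) len by (simp add: tsubst_extend_upn ss(1) extend_Cons [of _ s ss'] inst_env_extend)
  from Cons.IH [OF this ss(3) wf_fsubst [OF Cons.prems(3) wt]]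
  have "prv T \<Gamma> \<Phi> (finst s (UExs \<rho>s A))" by (simp add: fsubst_UExs)
  then have "prv T \<Gamma> \<Phi> (UEx \<rho> (UExs \<rho>s A))"
    using ss(2) by (rule UExI) (use Cons.prems(3) in \<open>simp add: wf_UExs\<close>)
  then show ?case by simp
qed simp

lemma UExs_E:
  assumes "prv T \<Gamma> \<Phi> (UExs \<rho>s A)"
    and "prv T (rev \<rho>s @ \<Gamma>) (insert A (flift (length \<rho>s) ` \<Phi>)) (flift (length \<rho>s) C)"
    and "wf_fm (rev \<rho>s @ \<Gamma>) A"
  shows "prv T \<Gamma> \<Phi> C"
  using assms
proof (induction \<rho>s arbitrary: \<Gamma> \<Phi> C)
  case (Cons \<rho> \<rho>s)
  let ?A = "UExs \<rho>s A" and ?n = "length \<rho>s"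
  have wf: "wf_fm (\<rho> # \<Gamma>) ?A" using Cons.prems(3) by (simp add: wf_UExs)
  then have "prv T (\<rho> # \<Gamma>) (insert ?A (flift 1 ` \<Phi>)) ?A" by (rule prv_insert)
  then have "prv T (\<rho> # \<Gamma>) (insert ?A (flift 1 ` \<Phi>)) (flift 1 C)"
  proof (rule Cons.IH)
    have "prv T (rev \<rho>s @ \<rho> # \<Gamma>) (insert A (flift ?n ` flift 1 ` \<Phi>)) (flift ?n (flift 1 C))"
      using Cons.prems(2) by (simp add: image_image lift_env_def)
    then show "prv T (rev \<rho>s @ \<rho> # \<Gamma>) (insert A (flift ?n ` insert ?A (flift 1 ` \<Phi>))) (flift ?n (flift 1 C))"
      by (rule prv_mono) blast
  qed (use Cons.prems(3) in simp)
  moreover have "prv T \<Gamma> \<Phi> (UEx \<rho> ?A)" using Cons.prems(1) by simp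
  ultimately show ?case by (intro UExE [of T \<Gamma> \<Phi> \<rho> ?A C])
qed (use prv_cut in auto)

lemma morph_lift: "length \<rho>s = n \<Longrightarrow> flift n ` \<Phi> \<subseteq> \<Psi> \<Longrightarrow> morph (lift_env n) \<Gamma> \<Phi> (\<rho>s @ \<Gamma>) \<Psi>"
  by (simp add: morph_def)

section \<open>Quantifier blocks restricted to monotone tuples\<close>

lemma fsubst_MBAlls:
  "length ts = length \<rho>s \<Longrightarrow>
    fsubst \<sigma> (MBAlls \<rho>s ts A) = MBAlls \<rho>s (map (tsubst \<sigma>) ts) (fsubst (upn (length \<rho>s) \<sigma>) A)"
  by (simp add: MBAlls_def fsubst_BAlls)

lemma fsubst_MBExs:
  "length ts = length \<rho>s \<Longrightarrow>
    fsubst \<sigma> (MBExs \<rho>s ts A) = MBExs \<rho>s (map (tsubst \<sigma>) ts) (fsubst (upn (length \<rho>s) \<sigma>) A)"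
  by (simp add: MBExs_def fsubst_BExs)

lemma fsubst_MAlls: "fsubst \<sigma> (MAlls \<rho>s A) = MAlls \<rho>s (fsubst (upn (length \<rho>s) \<sigma>) A)"
  by (simp add: MAlls_def fsubst_UAlls)

lemma fsubst_MExs: "fsubst \<sigma> (MExs \<rho>s A) = MExs \<rho>s (fsubst (upn (length \<rho>s) \<sigma>) A)"
  by (simp add: MExs_def fsubst_UExs)

lemma wf_MBAlls:
  "list_all2 (has_ty \<Gamma>) ts \<rho>s \<Longrightarrow> wf_fm \<Gamma> (MBAlls \<rho>s ts A) \<longleftrightarrow> wf_fm (rev \<rho>s @ \<Gamma>) A"
  by (simp add: MBAlls_def wf_BAlls wf_self_maj)

lemma wf_MBExs:
  "list_all2 (has_ty \<Gamma>) ts \<rho>s \<Longrightarrow> wf_fm \<Gamma> (MBExs \<rho>s ts A) \<longleftrightarrow> wf_fm (rev \<rho>s @ \<Gamma>) A"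
  by (simp add: MBExs_def wf_BExs wf_self_maj)

lemma wf_MAlls: "wf_fm \<Gamma> (MAlls \<rho>s A) \<longleftrightarrow> wf_fm (rev \<rho>s @ \<Gamma>) A"
  by (simp add: MAlls_def wf_UAlls wf_self_maj)

lemma wf_MExs: "wf_fm \<Gamma> (MExs \<rho>s A) \<longleftrightarrow> wf_fm (rev \<rho>s @ \<Gamma>) A"
  by (simp add: MExs_def wf_UExs wf_self_maj)

lemma MBAlls_I:
  assumes P: "\<And>\<Delta> \<Psi> \<sigma> ss. morph \<sigma> \<Gamma> \<Phi> \<Delta> \<Psi> \<Longrightarrow> majs T \<Delta> \<Psi> \<rho>s ss (map (tsubst \<sigma>) ts) \<Longrightarrow>
      majs T \<Delta> \<Psi> \<rho>s ss ss \<Longrightarrow> prv T \<Delta> \<Psi> (fsubst (extend \<sigma> ss) A)"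
    and tys: "list_all2 (has_ty \<Gamma>) ts \<rho>s" and wf: "wf_fm (rev \<rho>s @ \<Gamma>) A" and T: "subst_closed T"
  shows "prv T \<Gamma> \<Phi> (MBAlls \<rho>s ts A)"
  unfolding MBAlls_def
proof (rule BAlls_I [OF _ tys _ T])
  fix \<Delta> \<Psi> \<sigma> ss
  assume m: "morph \<sigma> \<Gamma> \<Phi> \<Delta> \<Psi>" and maj: "majs T \<Delta> \<Psi> \<rho>s ss (map (tsubst \<sigma>) ts)"
  let ?As = "map2 (\<lambda>\<rho> x. Atom (Maj \<rho> x x)) \<rho>s ss"
  have ss: "list_all2 (has_ty \<Delta>) ss \<rho>s" using maj by (rule majs_tys)
  have wfA: "\<forall>A \<in> set ?As. wf_fm \<Delta> A" using wf_map2_self [OF ss] by blast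
  \<comment> \<open>The given tuple is only bounded. Its monotonicity is added to the hypotheses,
    which is again a later world, and the guard discharges it afterwards.\<close>
  have "prv T \<Delta> (\<Psi> \<union> set ?As) (fsubst (extend \<sigma> ss) A)"
  proof (rule P)
    show "majs T \<Delta> (\<Psi> \<union> set ?As) \<rho>s ss ss"
      unfolding majs_self_iff [OF ss] using wfA by (blast intro: hyp)
  qed (use m maj in \<open>auto elim: morph_mono majs_mono\<close>)
  from prv_ImpGuardI [OF this wfA]
  show "prv T \<Delta> \<Psi> (fsubst (extend \<sigma> ss) (ImpGuard (self_maj \<rho>s) A))"
    using majs_length(1) [OF maj] by (simp add: map_self_maj_extend del: map_map)
qed (use wf in \<open>simp add: wf_self_maj\<close>)

lemma MBAlls_E:
  assumes "prv T \<Gamma> \<Phi> (MBAlls \<rho>s ts A)" and maj: "majs T \<Gamma> \<Phi> \<rho>s ss ts" "majs T \<Gamma> \<Phi> \<rho>s ss ss"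
    and wf: "wf_fm (rev \<rho>s @ \<Gamma>) A"
  shows "prv T \<Gamma> \<Phi> (fsubst (extend Var ss) A)"
proof (rule prv_ImpGuardE)
  have ss: "list_all2 (has_ty \<Gamma>) ss \<rho>s" using maj(2) by (rule majs_tys)
  show "prv T \<Gamma> \<Phi> (ImpGuard (map2 (\<lambda>\<rho> x. Atom (Maj \<rho> x x)) \<rho>s ss) (fsubst (extend Var ss) A))"
    using BAlls_E [OF assms(1) [unfolded MBAlls_def] maj(1)] wf majs_length(1) [OF maj(1)]
    by (simp add: map_self_maj_extend wf_self_maj del: map_map)
  show "\<forall>A \<in> set (map2 (\<lambda>\<rho> x. Atom (Maj \<rho> x x)) \<rho>s ss). prv T \<Gamma> \<Phi> A"
    using maj(2) majs_self_iff [OF ss] by blast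
qed

lemma MBExs_I:
  assumes "prv T \<Gamma> \<Phi> (fsubst (extend Var ss) A)" and maj: "majs T \<Gamma> \<Phi> \<rho>s ss ts" "majs T \<Gamma> \<Phi> \<rho>s ss ss"
    and wf: "wf_fm (rev \<rho>s @ \<Gamma>) A"
  shows "prv T \<Gamma> \<Phi> (MBExs \<rho>s ts A)"
  unfolding MBExs_def
proof (rule BExs_I [OF _ maj(1)])
  have ss: "list_all2 (has_ty \<Gamma>) ss \<rho>s" using maj(2) by (rule majs_tys)
  show "prv T \<Gamma> \<Phi> (fsubst (extend Var ss) (AndGuard (self_maj \<rho>s) A))"
    using assms(1) maj(2) majs_self_iff [OF ss] majs_length(1) [OF maj(1)]
    by (simp add: map_self_maj_extend prv_AndGuard del: map_map set_map)
qed (use wf in \<open>simp add: wf_self_maj\<close>)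

lemma MBExs_E:
  assumes "prv T \<Gamma> \<Phi> (MBExs \<rho>s ts A)"
    and P: "\<And>\<Delta> \<Psi> \<sigma> ss. morph \<sigma> \<Gamma> \<Phi> \<Delta> \<Psi> \<Longrightarrow> majs T \<Delta> \<Psi> \<rho>s ss (map (tsubst \<sigma>) ts) \<Longrightarrow>
      majs T \<Delta> \<Psi> \<rho>s ss ss \<Longrightarrow> prv T \<Delta> \<Psi> (fsubst (extend \<sigma> ss) A) \<Longrightarrow> prv T \<Delta> \<Psi> (fsubst \<sigma> C)"
    and tys: "list_all2 (has_ty \<Gamma>) ts \<rho>s" and wf: "wf_fm (rev \<rho>s @ \<Gamma>) A" and T: "subst_closed T"
  shows "prv T \<Gamma> \<Phi> C"
  using assms(1) unfolding MBExs_def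
proof (rule BExs_E [OF _ _ tys _ T])
  fix \<Delta> \<Psi> \<sigma> ss
  assume m: "morph \<sigma> \<Gamma> \<Phi> \<Delta> \<Psi>" and maj: "majs T \<Delta> \<Psi> \<rho>s ss (map (tsubst \<sigma>) ts)"
    and A: "prv T \<Delta> \<Psi> (fsubst (extend \<sigma> ss) (AndGuard (self_maj \<rho>s) A))"
  have ss: "list_all2 (has_ty \<Delta>) ss \<rho>s" using maj by (rule majs_tys)
  from A show "prv T \<Delta> \<Psi> (fsubst \<sigma> C)"
    using P [OF m maj] majs_self_iff [OF ss] majs_length(1) [OF maj]
    by (simp add: map_self_maj_extend prv_AndGuard del: map_map set_map)
qed (use wf in \<open>simp add: wf_self_maj\<close>)

lemma majs_vars:
  assumes "set (self_maj \<rho>s) \<subseteq> \<Phi>"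
  shows "majs T (rev \<rho>s @ \<Gamma>) \<Phi> \<rho>s (vars (length \<rho>s)) (vars (length \<rho>s))"
  unfolding majs_self_iff [OF list_all2_vars] self_maj_def [symmetric]
  using assms wf_self_maj by (blast intro: hyp)

lemma MAlls_I:
  assumes "prv T (rev \<rho>s @ \<Gamma>) (flift (length \<rho>s) ` \<Phi> \<union> set (self_maj \<rho>s)) A"
  shows "prv T \<Gamma> \<Phi> (MAlls \<rho>s A)"
  unfolding MAlls_def using assms wf_self_maj by (blast intro: UAlls_I prv_ImpGuardI)

lemma MAlls_E:
  assumes "prv T \<Gamma> \<Phi> (MAlls \<rho>s A)" and maj: "majs T \<Gamma> \<Phi> \<rho>s ss ss"
  shows "prv T \<Gamma> \<Phi> (fsubst (extend Var ss) A)"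
proof (rule prv_ImpGuardE)
  have ss: "list_all2 (has_ty \<Gamma>) ss \<rho>s" using maj by (rule majs_tys)
  show "prv T \<Gamma> \<Phi> (ImpGuard (map2 (\<lambda>\<rho> x. Atom (Maj \<rho> x x)) \<rho>s ss) (fsubst (extend Var ss) A))"
    using UAlls_E [OF assms(1) [unfolded MAlls_def] ss] majs_length(1) [OF maj]
    by (simp add: map_self_maj_extend del: map_map)
  show "\<forall>A \<in> set (map2 (\<lambda>\<rho> x. Atom (Maj \<rho> x x)) \<rho>s ss). prv T \<Gamma> \<Phi> A"
    using maj majs_self_iff [OF ss] by blast
qed

lemma MExs_I:
  assumes "prv T \<Gamma> \<Phi> (fsubst (extend Var ss) A)" and maj: "majs T \<Gamma> \<Phi> \<rho>s ss ss"
    and wf: "wf_fm (rev \<rho>s @ \<Gamma>) A"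
  shows "prv T \<Gamma> \<Phi> (MExs \<rho>s A)"
  unfolding MExs_def
proof (rule UExs_I)
  show ss: "list_all2 (has_ty \<Gamma>) ss \<rho>s" using maj by (rule majs_tys)
  show "prv T \<Gamma> \<Phi> (fsubst (extend Var ss) (AndGuard (self_maj \<rho>s) A))"
    using assms(1) maj majs_self_iff [OF ss] majs_length(1) [OF maj]
    by (simp add: map_self_maj_extend prv_AndGuard del: map_map set_map)
qed (use wf in \<open>simp add: wf_self_maj\<close>)

lemma MExs_E:
  assumes "prv T \<Gamma> \<Phi> (MExs \<rho>s A)"
    and "prv T (rev \<rho>s @ \<Gamma>) (insert A (flift (length \<rho>s) ` \<Phi> \<union> set (self_maj \<rho>s))) (flift (length \<rho>s) C)"
    and wf: "wf_fm (rev \<rho>s @ \<Gamma>) A"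
  shows "prv T \<Gamma> \<Phi> C"
  using assms(1) unfolding MExs_def
proof (rule UExs_E)
  let ?G = "AndGuard (self_maj \<rho>s) A"
  show wfG: "wf_fm (rev \<rho>s @ \<Gamma>) ?G" using wf by (simp add: wf_self_maj)
  then have G: "prv T (rev \<rho>s @ \<Gamma>) (insert ?G (flift (length \<rho>s) ` \<Phi>)) ?G" by (rule prv_insert)
  show "prv T (rev \<rho>s @ \<Gamma>) (insert ?G (flift (length \<rho>s) ` \<Phi>)) (flift (length \<rho>s) C)"
  proof (rule prv_cut_list [where As = "A # self_maj \<rho>s"])
    show "\<forall>B \<in> set (A # self_maj \<rho>s).
        wf_fm (rev \<rho>s @ \<Gamma>) B \<and> prv T (rev \<rho>s @ \<Gamma>) (insert ?G (flift (length \<rho>s) ` \<Phi>)) B"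
      using G wfG by (simp add: prv_AndGuard)
    show "prv T (rev \<rho>s @ \<Gamma>) (insert ?G (flift (length \<rho>s) ` \<Phi>) \<union> set (A # self_maj \<rho>s))
        (flift (length \<rho>s) C)"
      using assms(2) by (rule prv_mono) auto
  qed
qed

section \<open>The matrices of the two interpretations\<close>

lemma U_psubst [simp]: "U_all (psubst \<sigma> A) = U_all A" "U_ex (psubst \<sigma> A) = U_ex A"
  by (induction A arbitrary: \<sigma>) simp_all

lemma krivine_sub_psubst: "krivine_sub (psubst \<sigma> A) = fsubst \<sigma> (krivine_sub A)"
  by (induction A arbitrary: \<sigma>) simp_all

text \<open>A_K plays the role of the negation of A, so the two prefixes are exchanged clause by
  clause. One further negation then yields the types claimed for the interpretation of A^K.\<close>

lemma B_krivine_sub [simp]: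
  "B_ex (krivine_sub A) = U_all A" "B_all (krivine_sub A) = U_ex A"
  by (induction A) simp_all

lemma list_all2_take_drop:
  "list_all2 P xs (as @ bs) \<longleftrightarrow>
    list_all2 P (take (length as) xs) as \<and> list_all2 P (drop (length as) xs) bs"
proof (induction as arbitrary: xs)
  case (Cons a as)
  then show ?case by (cases xs) auto
qed simp

lemma list_all2_tlift:
  "list_all2 (has_ty \<Gamma>) ts \<tau>s \<Longrightarrow> length \<rho>s = n \<Longrightarrow> list_all2 (has_ty (\<rho>s @ \<Gamma>)) (map (tlift n) ts) \<tau>s"
  by (erule list_all2_tsubst) simp

lemma list_all2_tlift_1:
  "list_all2 (has_ty \<Gamma>) ts \<tau>s \<Longrightarrow> list_all2 (has_ty (\<rho> # \<Gamma>)) (map (tlift (Suc 0)) ts) \<tau>s"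
  by (erule list_all2_tsubst) simp

text \<open>The matrices recurse on lifted formulas, so the induction hypothesis is needed for all
  substitution instances of a subformula.\<close>

lemma pfm_subst_induct [case_names PAtom PNeg POr PAnd PBAll PUAll]:
  assumes "\<And>a. P (PAtom a)"
    and "\<And>A. (\<And>\<theta>. P (psubst \<theta> A)) \<Longrightarrow> P (PNeg A)"
    and "\<And>A B. (\<And>\<theta>. P (psubst \<theta> A)) \<Longrightarrow> (\<And>\<theta>. P (psubst \<theta> B)) \<Longrightarrow> P (POr A B)"
    and "\<And>A B. (\<And>\<theta>. P (psubst \<theta> A)) \<Longrightarrow> (\<And>\<theta>. P (psubst \<theta> B)) \<Longrightarrow> P (PAnd A B)"
    and "\<And>\<rho> t A. (\<And>\<theta>. P (psubst \<theta> A)) \<Longrightarrow> P (PBAll \<rho> t A)"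
    and "\<And>\<rho> A. (\<And>\<theta>. P (psubst \<theta> A)) \<Longrightarrow> P (PUAll \<rho> A)"
  shows "P A"
proof -
  have "P (psubst \<theta> A)" for \<theta>
    by (induction A arbitrary: \<theta>) (auto intro: assms)
  from this [of Var] show ?thesis by simp
qed

text \<open>\<open>KB A x y\<close> is \<open>(A\<^sub>K)\<^sub>B(x, y)\<close>, and \<open>KM A x y\<close> is its closure under smaller monotone
  \<open>y'\<close>, that is \<open>\<forall>y' \<unlhd> y (A\<^sub>K)\<^sub>B(x, y')\<close> with the tilde quantifier.\<close>

definition KB :: "pfm \<Rightarrow> tm list \<Rightarrow> tm list \<Rightarrow> fm" where
  "KB A = B_mat (krivine_sub A)"

definition KM :: "pfm \<Rightarrow> tm list \<Rightarrow> tm list \<Rightarrow> fm" where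
  "KM A xs ys = MBAlls (U_ex A) ys
     (KB (plift (length (U_ex A)) A) (map (tlift (length (U_ex A))) xs) (vars (length (U_ex A))))"

lemma MBAlls_Nil [simp]: "MBAlls [] ts A = A"
  by (simp add: MBAlls_def ImpGuard_def self_maj_def)

lemma MBExs_Nil [simp]: "MBExs [] ts A = A"
  by (simp add: MBExs_def AndGuard_def self_maj_def)

lemma KB_PAtom [simp]: "KB (PAtom a) xs ys = Neg (Atom a)"
  by (simp add: KB_def)

text \<open>\<open>Bot\<close> contributes empty tuples, so the implication clause retains only Y
  and x, and its premise is exactly the closure \<open>KM\<close>. The length condition makes x take
  up the whole argument list.\<close>

lemma KB_PNeg: "length xs = length (U_all A) \<Longrightarrow> KB (PNeg A) Ys xs = Neg (KM A xs (tapps Ys xs))"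
  by (simp add: KB_def KM_def Let_def krivine_sub_psubst)

lemma KB_POr [simp]:
  "KB (POr A B) xs ys =
    And (KB A (take (length (U_all A)) xs) (take (length (U_ex A)) ys))
        (KB B (drop (length (U_all A)) xs) (drop (length (U_ex A)) ys))"
  by (simp add: KB_def)

text \<open>The clauses of the interpretation for disjunction and for both existential quantifiers
  contain the closure over smaller tuples already; this is why \<open>KM\<close> of the subformulas
  appears here and in the next two equations.\<close>

lemma KB_PAnd [simp]:
  "KB (PAnd A B) xs ys =
    Or (KM A (take (length (U_all A)) xs) (take (length (U_ex A)) ys))
       (KM B (drop (length (U_all A)) xs) (drop (length (U_ex A)) ys))"
  by (simp add: KB_def KM_def Let_def krivine_sub_psubst)

lemma KB_PBAll [simp]:
  "KB (PBAll \<rho> t A) xs ys = BEx \<rho> t (KM A (map (tlift 1) xs) (map (tlift 1) ys))"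
  by (simp add: KB_def KM_def Let_def krivine_sub_psubst lift_env_def)

lemma KB_PUAll [simp]:
  "KB (PUAll \<rho> A) xs ys = BEx \<rho> (hd xs) (KM A (map (tlift 1) (tl xs)) (map (tlift 1) ys))"
  by (simp add: KB_def KM_def Let_def krivine_sub_psubst lift_env_def)

text \<open>\<open>KB\<close> of a formula is built from \<open>KM\<close> of subformulas, and
  \<open>KM\<close> from \<open>KB\<close> of lifted formulas. Assuming the property of
  \<open>KB\<close> makes the lemma usable inside the very induction that establishes it;
  \<open>wf_KM_if\<close> has the same purpose.\<close>

lemma fsubst_KM_if:
  assumes "\<And>\<tau> \<sigma> xs ys. length xs = length (U_all A) \<Longrightarrow> length ys = length (U_ex A) \<Longrightarrow>
      fsubst \<sigma> (KB (psubst \<tau> A) xs ys) = KB (psubst \<sigma> (psubst \<tau> A)) (map (tsubst \<sigma>) xs) (map (tsubst \<sigma>) ys)"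
    and "length xs = length (U_all A)" and "length ys = length (U_ex A)"
  shows "fsubst \<sigma> (KM A xs ys) = KM (psubst \<sigma> A) (map (tsubst \<sigma>) xs) (map (tsubst \<sigma>) ys)"
  using assms by (simp add: KM_def fsubst_MBAlls)

lemma fsubst_KB:
  "length xs = length (U_all A) \<Longrightarrow> length ys = length (U_ex A) \<Longrightarrow>
    fsubst \<sigma> (KB A xs ys) = KB (psubst \<sigma> A) (map (tsubst \<sigma>) xs) (map (tsubst \<sigma>) ys)"
proof (induction A arbitrary: \<sigma> xs ys rule: pfm_subst_induct)
  case (PNeg A)
  have "fsubst \<sigma> (KM A ys (tapps xs ys)) =
      KM (psubst \<sigma> A) (map (tsubst \<sigma>) ys) (map (tsubst \<sigma>) (tapps xs ys))"
    by (rule fsubst_KM_if) (use PNeg in simp_all)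
  then show ?case using PNeg.prems by (simp add: KB_PNeg)
next
  case (POr A B)
  then show ?case using POr.IH(1) [where \<theta> = Var] POr.IH(2) [where \<theta> = Var] by (simp add: take_map drop_map)
next
  case (PAnd A B)
  then show ?case by (simp add: fsubst_KM_if take_map drop_map)
next
  case (PBAll \<rho> t A)
  then show ?case by (simp add: fsubst_KM_if)
next
  case (PUAll \<rho> A)
  then show ?case by (cases xs) (simp_all add: fsubst_KM_if)
qed simp

lemma fsubst_KM:
  "length xs = length (U_all A) \<Longrightarrow> length ys = length (U_ex A) \<Longrightarrow>
    fsubst \<sigma> (KM A xs ys) = KM (psubst \<sigma> A) (map (tsubst \<sigma>) xs) (map (tsubst \<sigma>) ys)"
  by (rule fsubst_KM_if) (simp_all add: fsubst_KB)

lemma wf_KM_if: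
  assumes "\<And>\<sigma> \<Gamma> xs ys. wf_pfm \<Gamma> (psubst \<sigma> A) \<Longrightarrow> list_all2 (has_ty \<Gamma>) xs (U_all A) \<Longrightarrow>
      list_all2 (has_ty \<Gamma>) ys (U_ex A) \<Longrightarrow> wf_fm \<Gamma> (KB (psubst \<sigma> A) xs ys)"
    and "wf_pfm \<Gamma> A" and "list_all2 (has_ty \<Gamma>) xs (U_all A)" and "list_all2 (has_ty \<Gamma>) ys (U_ex A)"
  shows "wf_fm \<Gamma> (KM A xs ys)"
proof -
  have "wf_fm (rev (U_ex A) @ \<Gamma>) (KB (plift (length (U_ex A)) A)
      (map (tlift (length (U_ex A))) xs) (vars (length (U_ex A))))"
    by (rule assms(1))
      (use assms in \<open>auto intro: wf_psubst list_all2_tsubst list_all2_vars wt_lift\<close>)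
  then show ?thesis using assms(4) by (simp add: KM_def wf_MBAlls)
qed

lemma wf_KB:
  "wf_pfm \<Gamma> A \<Longrightarrow> list_all2 (has_ty \<Gamma>) xs (U_all A) \<Longrightarrow> list_all2 (has_ty \<Gamma>) ys (U_ex A) \<Longrightarrow>
    wf_fm \<Gamma> (KB A xs ys)"
proof (induction A arbitrary: \<Gamma> xs ys rule: pfm_subst_induct)
  case (PNeg A)
  have "wf_fm \<Gamma> (KM A ys (tapps xs ys))"
    by (rule wf_KM_if) (use PNeg in \<open>auto intro: list_all2_tapps\<close>)
  then show ?case using PNeg.prems list_all2_lengthD by (fastforce simp: KB_PNeg)
next
  case (POr A B)
  then show ?case using POr.IH(1) [where \<theta> = Var] POr.IH(2) [where \<theta> = Var] by (simp add: list_all2_take_drop)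
next
  case (PAnd A B)
  then show ?case by (simp add: wf_KM_if list_all2_take_drop)
next
  case (PBAll \<rho> t A)
  then show ?case by (simp add: wf_KM_if list_all2_tlift_1)
next
  case (PUAll \<rho> A)
  then show ?case by (cases xs) (auto intro!: wf_KM_if intro: list_all2_tlift_1)
qed simp

lemma wf_KM:
  "wf_pfm \<Gamma> A \<Longrightarrow> list_all2 (has_ty \<Gamma>) xs (U_all A) \<Longrightarrow> list_all2 (has_ty \<Gamma>) ys (U_ex A) \<Longrightarrow>
    wf_fm \<Gamma> (KM A xs ys)"
  by (rule wf_KM_if) (simp_all add: wf_KB)

section \<open>The matrix of U: substitution, typing and boundedness\<close>

lemma fsubst_U_mat:
  "length xs = length (U_all A) \<Longrightarrow> length ys = length (U_ex A) \<Longrightarrow>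
    fsubst \<sigma> (U_mat A xs ys) = U_mat (psubst \<sigma> A) (map (tsubst \<sigma>) xs) (map (tsubst \<sigma>) ys)"
proof (induction A arbitrary: \<sigma> xs ys rule: pfm_subst_induct)
  case (PNeg A)
  then show ?case by (simp add: Let_def fsubst_MBExs)
next
  case (POr A B)
  then show ?case using POr.IH(1) [where \<theta> = Var] POr.IH(2) [where \<theta> = Var] by (simp add: take_map drop_map)
next
  case (PAnd A B)
  then show ?case using PAnd.IH(1) [where \<theta> = Var] PAnd.IH(2) [where \<theta> = Var] by (simp add: take_map drop_map)
next
  case (PBAll \<rho> t A)
  then show ?case using PBAll.IH [where \<theta> = Var] by simp
next
  case (PUAll \<rho> A)
  then show ?case using PUAll.IH [where \<theta> = Var] by (cases xs) simp_all
qed simp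

lemma wf_U_mat:
  "wf_pfm \<Gamma> A \<Longrightarrow> list_all2 (has_ty \<Gamma>) xs (U_all A) \<Longrightarrow> list_all2 (has_ty \<Gamma>) ys (U_ex A) \<Longrightarrow>
    wf_fm \<Gamma> (U_mat A xs ys)"
proof (induction A arbitrary: \<Gamma> xs ys rule: pfm_subst_induct)
  case (PNeg A)
  let ?n = "length (U_all A)"
  have tys: "list_all2 (has_ty (rev (U_all A) @ \<Gamma>)) (tapps (map (tlift ?n) xs) (vars ?n)) (U_ex A)"
    by (rule list_all2_tapps [OF list_all2_tlift list_all2_vars]) (use PNeg.prems in simp_all)
  have "wf_fm (rev (U_all A) @ \<Gamma>) (U_mat (plift ?n A) (vars ?n) (tapps (map (tlift ?n) xs) (vars ?n)))"
    by (rule PNeg.IH)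
      (use PNeg.prems tys in \<open>auto intro: wf_psubst list_all2_vars wt_lift\<close>)
  then show ?case using PNeg.prems by (simp add: Let_def wf_MBExs)
next
  case (POr A B)
  then show ?case using POr.IH(1) [where \<theta> = Var] POr.IH(2) [where \<theta> = Var] by (simp add: list_all2_take_drop)
next
  case (PAnd A B)
  then show ?case using PAnd.IH(1) [where \<theta> = Var] PAnd.IH(2) [where \<theta> = Var] by (simp add: list_all2_take_drop)
next
  case (PBAll \<rho> t A)
  then show ?case using PBAll.IH [where \<theta> = Var] by (simp add: list_all2_tlift_1)
next
  case (PUAll \<rho> A)
  then show ?case using PUAll.IH [where \<theta> = Var] by (cases xs) (simp_all add: list_all2_tlift_1)
qed simp

lemma bounded_BExs [simp]: "bounded (BExs \<rho>s ts A) \<longleftrightarrow> bounded A"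
  by (induction \<rho>s arbitrary: ts) simp_all

lemma bounded_Conj: "\<forall>A \<in> set As. bounded A \<Longrightarrow> bounded (Conj As)"
  by (induction As rule: Conj.induct) auto

lemma bounded_MBExs [simp]: "bounded A \<Longrightarrow> bounded (MBExs \<rho>s ts A)"
  by (auto simp: MBExs_def AndGuard_def self_maj_def intro!: bounded_Conj)

text \<open>This is what permits BLEM to be applied to the U-matrix and bMAC to be applied to
  A^U.\<close>

lemma bounded_U_mat: "bounded (U_mat A xs ys)"
proof (induction A arbitrary: xs ys rule: pfm_subst_induct)
  case (POr A B)
  then show ?case using POr.IH(1) [where \<theta> = Var] POr.IH(2) [where \<theta> = Var] by simp
next
  case (PAnd A B)
  then show ?case using PAnd.IH(1) [where \<theta> = Var] PAnd.IH(2) [where \<theta> = Var] by simp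
next
  case (PBAll \<rho> t A)
  then show ?case using PBAll.IH [where \<theta> = Var] by simp
next
  case (PUAll \<rho> A)
  then show ?case using PUAll.IH [where \<theta> = Var] by simp
qed (simp_all add: Let_def)

section \<open>Rules for the closure and its antimonotonicity\<close>

lemma KM_I:
  assumes P: "\<And>\<Delta> \<Psi> \<sigma> ss. morph \<sigma> \<Gamma> \<Phi> \<Delta> \<Psi> \<Longrightarrow> majs T \<Delta> \<Psi> (U_ex A) ss (map (tsubst \<sigma>) ys) \<Longrightarrow>
      majs T \<Delta> \<Psi> (U_ex A) ss ss \<Longrightarrow> prv T \<Delta> \<Psi> (KB (psubst \<sigma> A) (map (tsubst \<sigma>) xs) ss)"
    and A: "wf_pfm \<Gamma> A" and xs: "list_all2 (has_ty \<Gamma>) xs (U_all A)"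
    and ys: "list_all2 (has_ty \<Gamma>) ys (U_ex A)" and T: "subst_closed T"
  shows "prv T \<Gamma> \<Phi> (KM A xs ys)"
  unfolding KM_def
proof (rule MBAlls_I [OF _ ys _ T])
  let ?n = "length (U_ex A)"
  fix \<Delta> \<Psi> \<sigma> ss
  assume m: "morph \<sigma> \<Gamma> \<Phi> \<Delta> \<Psi>" "majs T \<Delta> \<Psi> (U_ex A) ss (map (tsubst \<sigma>) ys)"
    "majs T \<Delta> \<Psi> (U_ex A) ss ss"
  show "prv T \<Delta> \<Psi> (fsubst (extend \<sigma> ss) (KB (plift ?n A) (map (tlift ?n) xs) (vars ?n)))"
    using P [OF m] majs_length [OF m(3)] list_all2_lengthD [OF xs] by (simp add: fsubst_KB)
qed (use wf_KM [OF A xs ys] ys in \<open>simp add: KM_def wf_MBAlls\<close>)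

lemma KM_E:
  assumes "prv T \<Gamma> \<Phi> (KM A xs ys)" and m: "majs T \<Gamma> \<Phi> (U_ex A) ss ys" "majs T \<Gamma> \<Phi> (U_ex A) ss ss"
    and A: "wf_pfm \<Gamma> A" and xs: "list_all2 (has_ty \<Gamma>) xs (U_all A)"
  shows "prv T \<Gamma> \<Phi> (KB A xs ss)"
proof -
  have ys: "list_all2 (has_ty \<Gamma>) ys (U_ex A)" using m(1) by (rule majs_tys)
  from MBAlls_E [OF assms(1) [unfolded KM_def] m]
  show ?thesis
    using wf_KM [OF A xs ys] ys majs_length [OF m(2)] list_all2_lengthD [OF xs]
    by (simp add: KM_def wf_MBAlls fsubst_KB)
qed

lemma prv_morph_KM:
  assumes "prv T \<Gamma> \<Phi> (KM A xs ys)" and "morph \<sigma> \<Gamma> \<Phi> \<Delta> \<Psi>" and T: "subst_closed T"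
    and "list_all2 (has_ty \<Gamma>) xs (U_all A)" and "list_all2 (has_ty \<Gamma>) ys (U_ex A)"
  shows "prv T \<Delta> \<Psi> (KM (psubst \<sigma> A) (map (tsubst \<sigma>) xs) (map (tsubst \<sigma>) ys))"
  using prv_morph [OF T assms(1,2)] list_all2_lengthD [OF assms(4)] list_all2_lengthD [OF assms(5)]
  by (simp add: fsubst_KM)

lemma KM_antimono:
  assumes "prv T \<Gamma> \<Phi> (KM A xs ys)" and m: "majs T \<Gamma> \<Phi> (U_ex A) ys' ys"
    and A: "wf_pfm \<Gamma> A" and xs: "list_all2 (has_ty \<Gamma>) xs (U_all A)" and T: "subst_closed T"
  shows "prv T \<Gamma> \<Phi> (KM A xs ys')"
proof (rule KM_I [OF _ A xs _ T])
  show "list_all2 (has_ty \<Gamma>) ys' (U_ex A)" using m by (rule majs_tys)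
  have ys: "list_all2 (has_ty \<Gamma>) ys (U_ex A)" using m by (rule majs_tys)
  fix \<Delta> \<Psi> \<sigma> ss
  assume s: "morph \<sigma> \<Gamma> \<Phi> \<Delta> \<Psi>" "majs T \<Delta> \<Psi> (U_ex A) ss (map (tsubst \<sigma>) ys')"
    "majs T \<Delta> \<Psi> (U_ex A) ss ss"
  show "prv T \<Delta> \<Psi> (KB (psubst \<sigma> A) (map (tsubst \<sigma>) xs) ss)"
    by (rule KM_E [OF prv_morph_KM [OF assms(1) s(1) T xs ys]])
      (use s majs_trans [OF s(2) majs_morph [OF T m s(1)]] A xs in
        \<open>auto intro: wf_psubst list_all2_tsubst morph_wt\<close>)
qed

section \<open>Classical logic for bounded formulas\<close>

lemma prv_Bot_cut: "prv T \<Gamma> \<Phi> (Neg A) \<Longrightarrow> prv T \<Gamma> \<Phi> A \<Longrightarrow> prv T \<Gamma> \<Phi> Bot"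
  by (rule ImpE)

lemma BLEM_cases:
  assumes "prv BLEM \<Gamma> (insert A \<Phi>) C" and "prv BLEM \<Gamma> (insert (Neg A) \<Phi>) C"
    and "wf_fm \<Gamma> A" and "bounded A"
  shows "prv BLEM \<Gamma> \<Phi> C"
  by (rule OrE [OF extra_ax assms(1,2)]) (use assms(3,4) in \<open>auto simp: BLEM_def\<close>)

lemma BLEM_contr:
  assumes "prv BLEM \<Gamma> (insert (Neg A) \<Phi>) Bot" and "wf_fm \<Gamma> A" and "bounded A"
  shows "prv BLEM \<Gamma> \<Phi> A"
  by (rule BLEM_cases [OF prv_insert BotE [OF assms(1)]]) (use assms in simp_all)

lemma prv_Neg_Neg: "wf_fm \<Gamma> A \<Longrightarrow> bounded A \<Longrightarrow> prv BLEM \<Gamma> \<Phi> (Neg (Neg A)) \<longleftrightarrow> prv BLEM \<Gamma> \<Phi> A"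
proof
  assume wf: "wf_fm \<Gamma> A" "bounded A"
  then show "prv BLEM \<Gamma> \<Phi> (Neg (Neg A)) \<Longrightarrow> prv BLEM \<Gamma> \<Phi> A"
    by (rule_tac BLEM_contr) (simp_all add: prv_Imp)
  assume "prv BLEM \<Gamma> \<Phi> A"
  then show "prv BLEM \<Gamma> \<Phi> (Neg (Neg A))"
    using ImpI [OF ImpE [OF prv_insert prv_weaken]] wf by simp
qed

text \<open>The formula under the negation is assumed in the course of the proof, so the passage
  from A to B has to be available over larger sets of hypotheses.\<close>

lemma prv_Neg_mono:
  assumes "prv T \<Gamma> \<Phi> (Neg B)" and "wf_fm \<Gamma> A" and "\<And>\<Psi>. \<Phi> \<subseteq> \<Psi> \<Longrightarrow> prv T \<Gamma> \<Psi> A \<Longrightarrow> prv T \<Gamma> \<Psi> B"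
  shows "prv T \<Gamma> \<Phi> (Neg A)"
  using ImpI [OF ImpE [OF prv_weaken [OF assms(1)] assms(3) [OF subset_insertI prv_insert [OF assms(2)]]] assms(2)] .

lemma prv_Neg_cong:
  assumes "wf_fm \<Gamma> A" and "wf_fm \<Gamma> B" and "\<And>\<Psi>. \<Phi> \<subseteq> \<Psi> \<Longrightarrow> prv T \<Gamma> \<Psi> A \<longleftrightarrow> prv T \<Gamma> \<Psi> B"
  shows "prv T \<Gamma> \<Phi> (Neg A) \<longleftrightarrow> prv T \<Gamma> \<Phi> (Neg B)"
  using prv_Neg_mono [OF _ assms(1), of T \<Phi> B] prv_Neg_mono [OF _ assms(2), of T \<Phi> A] assms(3) by blast

lemma prv_Or_mono:
  assumes "prv T \<Gamma> \<Phi> (Or A B)"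
    and "\<And>\<Psi>. \<Phi> \<subseteq> \<Psi> \<Longrightarrow> prv T \<Gamma> \<Psi> A \<Longrightarrow> prv T \<Gamma> \<Psi> A'"
    and "\<And>\<Psi>. \<Phi> \<subseteq> \<Psi> \<Longrightarrow> prv T \<Gamma> \<Psi> B \<Longrightarrow> prv T \<Gamma> \<Psi> B'"
    and "wf_fm \<Gamma> A" "wf_fm \<Gamma> B" "wf_fm \<Gamma> A'" "wf_fm \<Gamma> B'"
  shows "prv T \<Gamma> \<Phi> (Or A' B')"
proof (rule OrE [OF assms(1)])
  show "prv T \<Gamma> (insert A \<Phi>) (Or A' B')"
    using OrI1 [OF assms(2) [OF subset_insertI prv_insert [OF assms(4)]] assms(7)] .
  show "prv T \<Gamma> (insert B \<Phi>) (Or A' B')"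
    using OrI2 [OF assms(3) [OF subset_insertI prv_insert [OF assms(5)]] assms(6)] .
qed

text \<open>Intuitionistically valid, hence stated for every theory; the de Morgan laws for
  conjunction and for the bounded universal quantifier below rest on BLEM.\<close>

lemma prv_Neg_Or: "wf_fm \<Gamma> A \<Longrightarrow> wf_fm \<Gamma> B \<Longrightarrow>
    prv T \<Gamma> \<Phi> (Neg (Or A B)) \<longleftrightarrow> prv T \<Gamma> \<Phi> (Neg A) \<and> prv T \<Gamma> \<Phi> (Neg B)"
proof
  assume wf: "wf_fm \<Gamma> A" "wf_fm \<Gamma> B"
  show "prv T \<Gamma> \<Phi> (Neg A) \<and> prv T \<Gamma> \<Phi> (Neg B)" if n: "prv T \<Gamma> \<Phi> (Neg (Or A B))"
    using prv_Neg_mono [OF n wf(1)] OrI1 [OF _ wf(2)] prv_Neg_mono [OF n wf(2)] OrI2 [OF _ wf(1)]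
    by blast
  assume n: "prv T \<Gamma> \<Phi> (Neg A) \<and> prv T \<Gamma> \<Phi> (Neg B)"
  have "prv T \<Gamma> (insert (Or A B) \<Phi>) Bot"
  proof (rule OrE [OF prv_insert])
    have a: "prv T \<Gamma> (insert A \<Phi>) Bot" and b: "prv T \<Gamma> (insert B \<Phi>) Bot"
      using n wf by (simp_all add: prv_Imp)
    show "prv T \<Gamma> (insert A (insert (Or A B) \<Phi>)) Bot" using a by (rule prv_mono) blast
    show "prv T \<Gamma> (insert B (insert (Or A B) \<Phi>)) Bot" using b by (rule prv_mono) blast
  qed (use wf in simp)
  then show "prv T \<Gamma> \<Phi> (Neg (Or A B))" using wf by (simp add: ImpI)
qed

lemma prv_Neg_And:
  assumes "wf_fm \<Gamma> A" "wf_fm \<Gamma> B" "bounded A" "bounded B"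
  shows "prv BLEM \<Gamma> \<Phi> (Neg (And A B)) \<longleftrightarrow> prv BLEM \<Gamma> \<Phi> (Or (Neg A) (Neg B))"
proof
  assume n: "prv BLEM \<Gamma> \<Phi> (Neg (And A B))"
  \<comment> \<open>A is decided by BLEM: if it holds, B is refuted, and otherwise the left disjunct
    holds outright.\<close>
  have "prv BLEM \<Gamma> (insert A \<Phi>) (Neg B)"
  proof (rule ImpI)
    have "prv BLEM \<Gamma> (insert B (insert A \<Phi>)) (Neg (And A B))"
      using n by (rule prv_mono) blast
    then show "prv BLEM \<Gamma> (insert B (insert A \<Phi>)) Bot"
      by (rule ImpE) (use assms in \<open>simp add: hyp\<close>)
  qed (use assms in simp)
  then show "prv BLEM \<Gamma> \<Phi> (Or (Neg A) (Neg B))"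
    using assms by (rule_tac BLEM_cases [OF OrI2 OrI1 [OF prv_insert]]) simp_all
next
  assume o: "prv BLEM \<Gamma> \<Phi> (Or (Neg A) (Neg B))"
  have "prv BLEM \<Gamma> (insert (And A B) \<Phi>) Bot"
  proof (rule OrE [OF prv_weaken [OF o]])
    let ?\<Phi> = "insert (And A B) \<Phi>"
    have "prv BLEM \<Gamma> ?\<Phi> (And A B)" using assms by (intro prv_insert) simp
    from prv_weaken [OF this]
    have ab: "prv BLEM \<Gamma> (insert C ?\<Phi>) A" "prv BLEM \<Gamma> (insert C ?\<Phi>) B" for C
      by simp_all
    show "prv BLEM \<Gamma> (insert (Neg A) ?\<Phi>) Bot" "prv BLEM \<Gamma> (insert (Neg B) ?\<Phi>) Bot"
      using prv_Bot_cut [OF prv_insert ab(1)] prv_Bot_cut [OF prv_insert ab(2)] assms by simp_all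
  qed
  then show "prv BLEM \<Gamma> \<Phi> (Neg (And A B))" using assms by (simp add: ImpI)
qed

section \<open>Single bounded quantifiers and their de Morgan law\<close>

lemma BAll_I:
  assumes "\<And>\<Delta> \<Psi> \<sigma> s. morph \<sigma> \<Gamma> \<Phi> \<Delta> \<Psi> \<Longrightarrow> has_ty \<Delta> s \<rho> \<Longrightarrow>
      prv T \<Delta> \<Psi> (Atom (Maj \<rho> s (tsubst \<sigma> t))) \<Longrightarrow> prv T \<Delta> \<Psi> (fsubst (extend \<sigma> [s]) A)"
    and "has_ty \<Gamma> t \<rho>" and "wf_fm (\<rho> # \<Gamma>) A" and T: "subst_closed T"
  shows "prv T \<Gamma> \<Phi> (BAll \<rho> t A)"
proof -
  have "prv T \<Gamma> \<Phi> (BAlls [\<rho>] [t] A)"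
    by (rule BAlls_I) (use assms in \<open>auto simp: majs_Cons1\<close>)
  then show ?thesis by simp
qed

lemma BEx_E:
  assumes "prv T \<Gamma> \<Phi> (BEx \<rho> t A)"
    and "\<And>\<Delta> \<Psi> \<sigma> s. morph \<sigma> \<Gamma> \<Phi> \<Delta> \<Psi> \<Longrightarrow> has_ty \<Delta> s \<rho> \<Longrightarrow>
      prv T \<Delta> \<Psi> (Atom (Maj \<rho> s (tsubst \<sigma> t))) \<Longrightarrow> prv T \<Delta> \<Psi> (fsubst (extend \<sigma> [s]) A) \<Longrightarrow>
      prv T \<Delta> \<Psi> (fsubst \<sigma> C)"
    and "has_ty \<Gamma> t \<rho>" and "wf_fm (\<rho> # \<Gamma>) A" and T: "subst_closed T"
  shows "prv T \<Gamma> \<Phi> C"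
  by (rule BExs_E [of T \<Gamma> \<Phi> "[\<rho>]" "[t]" A])
    (use assms in \<open>auto simp: majs_Cons1\<close>)

lemma prv_BEx_mono:
  assumes "prv T \<Gamma> \<Phi> (BEx \<rho> t A)"
    and P: "\<And>\<Delta> \<Psi> \<sigma> s. morph \<sigma> \<Gamma> \<Phi> \<Delta> \<Psi> \<Longrightarrow> has_ty \<Delta> s \<rho> \<Longrightarrow>
      prv T \<Delta> \<Psi> (fsubst (extend \<sigma> [s]) A) \<Longrightarrow> prv T \<Delta> \<Psi> (fsubst (extend \<sigma> [s]) B)"
    and t: "has_ty \<Gamma> t \<rho>" and wf: "wf_fm (\<rho> # \<Gamma>) A" "wf_fm (\<rho> # \<Gamma>) B" and T: "subst_closed T"
  shows "prv T \<Gamma> \<Phi> (BEx \<rho> t B)"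
proof (rule BEx_E [OF assms(1) _ t wf(1) T])
  fix \<Delta> \<Psi> \<sigma> s
  assume m: "morph \<sigma> \<Gamma> \<Phi> \<Delta> \<Psi>" and s: "has_ty \<Delta> s \<rho>"
    and maj: "prv T \<Delta> \<Psi> (Atom (Maj \<rho> s (tsubst \<sigma> t)))"
    and A: "prv T \<Delta> \<Psi> (fsubst (extend \<sigma> [s]) A)"
  have "prv T \<Delta> \<Psi> (finst s (fsubst (up \<sigma>) B))"
    unfolding finst_up using P [OF m s A] .
  from BExI [OF this maj] show "prv T \<Delta> \<Psi> (fsubst \<sigma> (BEx \<rho> t B))"
    using wf_fsubst [OF wf(2) wt_up [OF morph_wt [OF m]]] has_ty_tsubst [OF t morph_wt [OF m]] s
    by simp
qed

text \<open>The forward direction argues by contradiction twice, which is legitimate since both the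
  bounded existential formula and each instance of A are bounded: if no s below t refutes A, every
  instance of A is stable and therefore holds, against the assumption.\<close>

lemma prv_Neg_BAll:
  assumes t: "has_ty \<Gamma> t \<rho>" and wf: "wf_fm (\<rho> # \<Gamma>) A" and bd: "bounded A"
  shows "prv BLEM \<Gamma> \<Phi> (Neg (BAll \<rho> t A)) \<longleftrightarrow> prv BLEM \<Gamma> \<Phi> (BEx \<rho> t (Neg A))"
proof
  assume n: "prv BLEM \<Gamma> \<Phi> (Neg (BAll \<rho> t A))"
  show "prv BLEM \<Gamma> \<Phi> (BEx \<rho> t (Neg A))"
  proof (rule BLEM_contr)
    let ?E = "BEx \<rho> t (Neg A)"
    have "prv BLEM \<Gamma> (insert (Neg ?E) \<Phi>) (BAll \<rho> t A)"
    proof (rule BAll_I [OF _ t wf subst_closed_BLEM])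
      fix \<Delta> \<Psi> \<sigma> s
      assume m: "morph \<sigma> \<Gamma> (insert (Neg ?E) \<Phi>) \<Delta> \<Psi>" and s: "has_ty \<Delta> s \<rho>"
        and maj: "prv BLEM \<Delta> \<Psi> (Atom (Maj \<rho> s (tsubst \<sigma> t)))"
      let ?A = "fsubst (extend \<sigma> [s]) A"
      have wfA: "wf_fm \<Delta> ?A"
        using wf_fsubst [OF wf wt_extend_single [OF morph_wt [OF m] s]] .
      show "prv BLEM \<Delta> \<Psi> ?A"
      proof (rule BLEM_contr)
        have "prv BLEM \<Delta> (insert (Neg ?A) \<Psi>) (Neg ?A)"
          using wfA by (intro prv_insert) simp
        then have "prv BLEM \<Delta> (insert (Neg ?A) \<Psi>) (finst s (fsubst (up \<sigma>) (Neg A)))"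
          unfolding finst_up by simp
        from BExI [OF this prv_weaken [OF maj]]
        have E: "prv BLEM \<Delta> (insert (Neg ?A) \<Psi>) (fsubst \<sigma> ?E)"
          using wf_fsubst [OF wf wt_up [OF morph_wt [OF m]]] has_ty_tsubst [OF t morph_wt [OF m]] s
          by simp
        have "prv BLEM \<Gamma> (insert (Neg ?E) \<Phi>) (Neg ?E)"
          using t wf by (intro prv_insert) simp
        from prv_morph [OF subst_closed_BLEM this m]
        have "prv BLEM \<Delta> \<Psi> (Neg (fsubst \<sigma> ?E))" by simp
        from prv_Bot_cut [OF prv_weaken [OF this] E]
        show "prv BLEM \<Delta> (insert (Neg ?A) \<Psi>) Bot" .
      qed (use wfA bd in simp_all)
    qed
    then show "prv BLEM \<Gamma> (insert (Neg ?E) \<Phi>) Bot"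
      by (rule prv_Bot_cut [OF prv_weaken [OF n]])
  qed (use t wf bd in simp_all)
next
  let ?U = "BAll \<rho> t A"
  assume e: "prv BLEM \<Gamma> \<Phi> (BEx \<rho> t (Neg A))"
  have wfU: "wf_fm \<Gamma> ?U" using t wf by simp
  have "prv BLEM \<Gamma> (insert ?U \<Phi>) Bot"
  proof (rule BEx_E [OF prv_weaken [OF e] _ t _ subst_closed_BLEM])
    fix \<Delta> \<Psi> \<sigma> s
    assume m: "morph \<sigma> \<Gamma> (insert ?U \<Phi>) \<Delta> \<Psi>" and s: "has_ty \<Delta> s \<rho>"
      and maj: "prv BLEM \<Delta> \<Psi> (Atom (Maj \<rho> s (tsubst \<sigma> t)))"
      and nA: "prv BLEM \<Delta> \<Psi> (fsubst (extend \<sigma> [s]) (Neg A))"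
    from prv_morph [OF subst_closed_BLEM prv_insert [OF wfU] m]
    have "prv BLEM \<Delta> \<Psi> (BAll \<rho> (tsubst \<sigma> t) (fsubst (up \<sigma>) A))" by simp
    from BAllE [OF this maj] have "prv BLEM \<Delta> \<Psi> (finst s (fsubst (up \<sigma>) A))"
      using wf_fsubst [OF wf wt_up [OF morph_wt [OF m]]] has_ty_tsubst [OF t morph_wt [OF m]] s
      by blast
    then show "prv BLEM \<Delta> \<Psi> (fsubst \<sigma> Bot)"
      using nA prv_Bot_cut unfolding finst_up fsubst.simps by blast
  qed (use wf in simp)
  then show "prv BLEM \<Gamma> \<Phi> (Neg ?U)" using wfU by (rule ImpI)
qed

section \<open>The main equivalence\<close>

text \<open>For a disjunction A_K is a conjunction, and a universal closure distributes over it. The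
  closure runs over one joint tuple, so projecting to one side calls for some admissible value on
  the other side.\<close>

lemma KM_POr:
  assumes A: "wf_pfm \<Gamma> (POr A B)" and xs: "list_all2 (has_ty \<Gamma>) xs (U_all A @ U_all B)"
    and ys: "majs T \<Gamma> \<Phi> (U_ex A @ U_ex B) ys ys" and T: "subst_closed T"
  shows "prv T \<Gamma> \<Phi> (KM (POr A B) xs ys) \<longleftrightarrow>
    prv T \<Gamma> \<Phi> (KM A (take (length (U_all A)) xs) (take (length (U_ex A)) ys)) \<and>
    prv T \<Gamma> \<Phi> (KM B (drop (length (U_all A)) xs) (drop (length (U_ex A)) ys))"
    (is "?L \<longleftrightarrow> prv T \<Gamma> \<Phi> (KM A ?x ?y) \<and> prv T \<Gamma> \<Phi> (KM B ?x' ?y')")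
proof -
  have xs': "list_all2 (has_ty \<Gamma>) ?x (U_all A)" "list_all2 (has_ty \<Gamma>) ?x' (U_all B)"
    using xs by (simp_all add: list_all2_take_drop)
  have y: "majs T \<Gamma> \<Phi> (U_ex A) ?y ?y" and y': "majs T \<Gamma> \<Phi> (U_ex B) ?y' ?y'"
    using ys by (simp_all add: majs_append)
  have ysty: "list_all2 (has_ty \<Gamma>) ys (U_ex (POr A B))" using ys by (auto dest: majs_tys)
  show ?thesis
  proof (intro iffI conjI)
    assume L: ?L
    have L': "prv T \<Delta> \<Psi> (KB (psubst \<sigma> (POr A B)) (map (tsubst \<sigma>) xs) ss)"
      if m: "morph \<sigma> \<Gamma> \<Phi> \<Delta> \<Psi>"
        and ss: "majs T \<Delta> \<Psi> (U_ex A @ U_ex B) ss (map (tsubst \<sigma>) ys)"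
          "majs T \<Delta> \<Psi> (U_ex A @ U_ex B) ss ss" for \<Delta> \<Psi> \<sigma> ss
    proof (rule KM_E [OF prv_morph_KM [OF L m T]])
      show "wf_pfm \<Delta> (psubst \<sigma> (POr A B))" using A morph_wt [OF m] by (rule wf_psubst)
    qed (use xs ysty ss list_all2_tsubst [OF xs morph_wt [OF m]] in simp_all)
    show "prv T \<Gamma> \<Phi> (KM A ?x ?y)"
    proof (rule KM_I [OF _ _ xs'(1) majs_tys(1) [OF y] T])
      fix \<Delta> \<Psi> \<sigma> ss
      assume m: "morph \<sigma> \<Gamma> \<Phi> \<Delta> \<Psi>" and ss: "majs T \<Delta> \<Psi> (U_ex A) ss (map (tsubst \<sigma>) ?y)"
        "majs T \<Delta> \<Psi> (U_ex A) ss ss"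
      \<comment> \<open>The tuple for A is completed by the bound for B itself, which is admissible
        because it is monotone.\<close>
      have "prv T \<Delta> \<Psi> (KB (psubst \<sigma> (POr A B)) (map (tsubst \<sigma>) xs) (ss @ map (tsubst \<sigma>) ?y'))"
        by (rule L' [OF m])
          (use ss majs_morph [OF T y' m] majs_length(1) [OF ss(1)] in
            \<open>simp_all add: majs_append take_map drop_map\<close>)
      then show "prv T \<Delta> \<Psi> (KB (psubst \<sigma> A) (map (tsubst \<sigma>) ?x) ss)"
        using majs_length(1) [OF ss(1)] by (simp add: take_map)
    qed (use A in simp)
    show "prv T \<Gamma> \<Phi> (KM B ?x' ?y')"
    proof (rule KM_I [OF _ _ xs'(2) majs_tys(1) [OF y'] T])
      fix \<Delta> \<Psi> \<sigma> ss
      assume m: "morph \<sigma> \<Gamma> \<Phi> \<Delta> \<Psi>" and ss: "majs T \<Delta> \<Psi> (U_ex B) ss (map (tsubst \<sigma>) ?y')"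
        "majs T \<Delta> \<Psi> (U_ex B) ss ss"
      have len: "length ?y = length (U_ex A)" using y by (rule majs_length)
      have "prv T \<Delta> \<Psi> (KB (psubst \<sigma> (POr A B)) (map (tsubst \<sigma>) xs) (map (tsubst \<sigma>) ?y @ ss))"
        by (rule L' [OF m])
          (use ss majs_morph [OF T y m] len in \<open>simp_all add: majs_append take_map drop_map\<close>)
      then show "prv T \<Delta> \<Psi> (KB (psubst \<sigma> B) (map (tsubst \<sigma>) ?x') ss)"
        using len by (simp add: drop_map)
    qed (use A in simp)
  next
    assume R: "prv T \<Gamma> \<Phi> (KM A ?x ?y) \<and> prv T \<Gamma> \<Phi> (KM B ?x' ?y')"
    show ?L
    proof (rule KM_I [OF _ A _ ysty T])
      fix \<Delta> \<Psi> \<sigma> ss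
      assume m: "morph \<sigma> \<Gamma> \<Phi> \<Delta> \<Psi>"
        and ss: "majs T \<Delta> \<Psi> (U_ex (POr A B)) ss (map (tsubst \<sigma>) ys)"
          "majs T \<Delta> \<Psi> (U_ex (POr A B)) ss ss"
      have "prv T \<Delta> \<Psi> (KB (psubst \<sigma> A) (map (tsubst \<sigma>) ?x) (take (length (U_ex A)) ss))"
        by (rule KM_E [OF prv_morph_KM [OF R [THEN conjunct1] m T xs'(1) majs_tys(1) [OF y]]])
          (use ss A wf_psubst [OF _ morph_wt [OF m]] list_all2_tsubst [OF xs'(1) morph_wt [OF m]] in
            \<open>simp_all add: majs_append take_map\<close>)
      moreover have "prv T \<Delta> \<Psi> (KB (psubst \<sigma> B) (map (tsubst \<sigma>) ?x') (drop (length (U_ex A)) ss))"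
        by (rule KM_E [OF prv_morph_KM [OF R [THEN conjunct2] m T xs'(2) majs_tys(1) [OF y']]])
          (use ss A wf_psubst [OF _ morph_wt [OF m]] list_all2_tsubst [OF xs'(2) morph_wt [OF m]] in
            \<open>simp_all add: majs_append drop_map\<close>)
      ultimately show "prv T \<Delta> \<Psi> (KB (psubst \<sigma> (POr A B)) (map (tsubst \<sigma>) xs) ss)"
        by (simp add: take_map drop_map)
    qed (use xs in simp)
  qed
qed

text \<open>The interpretation of the disjunction is a disjunction of closures bounded by its own
  argument. At the monotone bound ys this is the right-hand side; at a smaller tuple each disjunct
  follows by antimonotonicity.\<close>

lemma KM_PAnd:
  assumes A: "wf_pfm \<Gamma> (PAnd A B)" and xs: "list_all2 (has_ty \<Gamma>) xs (U_all A @ U_all B)"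
    and ys: "majs T \<Gamma> \<Phi> (U_ex A @ U_ex B) ys ys" and T: "subst_closed T"
  shows "prv T \<Gamma> \<Phi> (KM (PAnd A B) xs ys) \<longleftrightarrow>
    prv T \<Gamma> \<Phi> (Or (KM A (take (length (U_all A)) xs) (take (length (U_ex A)) ys))
      (KM B (drop (length (U_all A)) xs) (drop (length (U_ex A)) ys)))"
    (is "?L \<longleftrightarrow> prv T \<Gamma> \<Phi> (Or (KM A ?x ?y) (KM B ?x' ?y'))")
proof
  assume ?L
  from KM_E [OF this _ _ A] ys xs show "prv T \<Gamma> \<Phi> (Or (KM A ?x ?y) (KM B ?x' ?y'))" by simp
next
  assume R: "prv T \<Gamma> \<Phi> (Or (KM A ?x ?y) (KM B ?x' ?y'))"
  have xs': "list_all2 (has_ty \<Gamma>) ?x (U_all A)" "list_all2 (has_ty \<Gamma>) ?x' (U_all B)"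
    using xs by (simp_all add: list_all2_take_drop)
  have ysty: "list_all2 (has_ty \<Gamma>) ys (U_ex A @ U_ex B)" using ys by (rule majs_tys)
  then have ys': "list_all2 (has_ty \<Gamma>) ?y (U_ex A)" "list_all2 (has_ty \<Gamma>) ?y' (U_ex B)"
    by (simp_all add: list_all2_take_drop)
  show ?L
  proof (rule KM_I [OF _ A _ _ T])
    fix \<Delta> \<Psi> \<sigma> ss
    assume m: "morph \<sigma> \<Gamma> \<Phi> \<Delta> \<Psi>"
      and ss: "majs T \<Delta> \<Psi> (U_ex (PAnd A B)) ss (map (tsubst \<sigma>) ys)"
        "majs T \<Delta> \<Psi> (U_ex (PAnd A B)) ss ss"
    have wt: "wt_env \<sigma> \<Gamma> \<Delta>" using m by (rule morph_wt)
    let ?s = "take (length (U_ex A)) ss" and ?s' = "drop (length (U_ex A)) ss"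
    have s: "majs T \<Delta> \<Psi> (U_ex A) ?s (map (tsubst \<sigma>) ?y)"
      and s': "majs T \<Delta> \<Psi> (U_ex B) ?s' (map (tsubst \<sigma>) ?y')"
      using ss by (simp_all add: majs_append take_map drop_map)
    have wf: "wf_pfm \<Delta> (psubst \<sigma> A)" "wf_pfm \<Delta> (psubst \<sigma> B)"
      using A wt by (auto intro: wf_psubst)
    have x: "list_all2 (has_ty \<Delta>) (map (tsubst \<sigma>) ?x) (U_all A)"
      "list_all2 (has_ty \<Delta>) (map (tsubst \<sigma>) ?x') (U_all B)"
      using xs' wt by (auto intro: list_all2_tsubst)
    have y: "list_all2 (has_ty \<Delta>) (map (tsubst \<sigma>) ?y) (U_ex A)"
      "list_all2 (has_ty \<Delta>) (map (tsubst \<sigma>) ?y') (U_ex B)"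
      using ys' wt by (auto intro: list_all2_tsubst)
    have "prv T \<Delta> \<Psi> (Or (KM (psubst \<sigma> A) (map (tsubst \<sigma>) ?x) (map (tsubst \<sigma>) ?y))
        (KM (psubst \<sigma> B) (map (tsubst \<sigma>) ?x') (map (tsubst \<sigma>) ?y')))"
      using prv_morph [OF T R m] xs' [THEN list_all2_lengthD] ys' [THEN list_all2_lengthD]
      by (simp add: fsubst_KM)
    then have "prv T \<Delta> \<Psi> (Or (KM (psubst \<sigma> A) (map (tsubst \<sigma>) ?x) ?s)
        (KM (psubst \<sigma> B) (map (tsubst \<sigma>) ?x') ?s'))"
    proof (rule prv_Or_mono)
      fix \<Psi>' assume sub: "\<Psi> \<subseteq> \<Psi>'"
      show "prv T \<Delta> \<Psi>' (KM (psubst \<sigma> A) (map (tsubst \<sigma>) ?x) ?s)"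
        if "prv T \<Delta> \<Psi>' (KM (psubst \<sigma> A) (map (tsubst \<sigma>) ?x) (map (tsubst \<sigma>) ?y))"
        by (rule KM_antimono [OF that _ wf(1) _ T]) (use majs_mono [OF s sub] x in simp_all)
      show "prv T \<Delta> \<Psi>' (KM (psubst \<sigma> B) (map (tsubst \<sigma>) ?x') ?s')"
        if "prv T \<Delta> \<Psi>' (KM (psubst \<sigma> B) (map (tsubst \<sigma>) ?x') (map (tsubst \<sigma>) ?y'))"
        by (rule KM_antimono [OF that _ wf(2) _ T]) (use majs_mono [OF s' sub] x in simp_all)
    qed (use wf x y majs_tys(1) [OF s] majs_tys(1) [OF s'] in \<open>simp_all add: wf_KM\<close>)
    then show "prv T \<Delta> \<Psi> (KB (psubst \<sigma> (PAnd A B)) (map (tsubst \<sigma>) xs) ss)"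
      by (simp add: take_map drop_map)
  qed (use xs ysty in simp_all)
qed

text \<open>Common form of the two quantifier clauses, with the assumption on \<open>KB\<close>
  abstracting from their difference: for a bounded quantifier t is its bound and xs' is xs, while
  for an unbounded one t is the head of xs and xs' its tail.\<close>

lemma KM_BEx:
  assumes A': "wf_pfm \<Gamma> A'" and xs: "list_all2 (has_ty \<Gamma>) xs (U_all A')"
    and ys: "majs T \<Gamma> \<Phi> (U_ex A) ys ys" and ex: "U_ex A' = U_ex A"
    and t: "has_ty \<Gamma> t \<rho>" and A: "wf_pfm (\<rho> # \<Gamma>) A" and xs': "list_all2 (has_ty \<Gamma>) xs' (U_all A)"
    and KB: "\<And>\<sigma> ss. KB (psubst \<sigma> A') (map (tsubst \<sigma>) xs) ss = BEx \<rho> (tsubst \<sigma> t)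
      (KM (psubst (up \<sigma>) A) (map (tlift 1) (map (tsubst \<sigma>) xs')) (map (tlift 1) ss))"
    and T: "subst_closed T"
  shows "prv T \<Gamma> \<Phi> (KM A' xs ys) \<longleftrightarrow>
    prv T \<Gamma> \<Phi> (BEx \<rho> t (KM A (map (tlift 1) xs') (map (tlift 1) ys)))"
proof
  assume "prv T \<Gamma> \<Phi> (KM A' xs ys)"
  from KM_E [OF this _ _ A' xs] ys ex have "prv T \<Gamma> \<Phi> (KB A' xs ys)" by simp
  with KB [of Var ys] show "prv T \<Gamma> \<Phi> (BEx \<rho> t (KM A (map (tlift 1) xs') (map (tlift 1) ys)))"
    by simp
next
  let ?K = "KM A (map (tlift 1) xs') (map (tlift 1) ys)"
  assume R: "prv T \<Gamma> \<Phi> (BEx \<rho> t ?K)"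
  have ysty: "list_all2 (has_ty \<Gamma>) ys (U_ex A)" using ys by (rule majs_tys)
  show "prv T \<Gamma> \<Phi> (KM A' xs ys)"
  proof (rule KM_I [OF _ A' xs _ T])
    fix \<Delta> \<Psi> \<sigma> ss
    assume m: "morph \<sigma> \<Gamma> \<Phi> \<Delta> \<Psi>" and ss: "majs T \<Delta> \<Psi> (U_ex A') ss (map (tsubst \<sigma>) ys)"
    have wt: "wt_env \<sigma> \<Gamma> \<Delta>" using m by (rule morph_wt)
    let ?K' = "KM (psubst (up \<sigma>) A) (map (tlift 1) (map (tsubst \<sigma>) xs'))"
    have lens: "length xs' = length (U_all A)" "length ys = length (U_ex A)" "length ss = length (U_ex A)"
      using list_all2_lengthD [OF xs'] list_all2_lengthD [OF ysty] majs_length(1) [OF ss] ex by simp_all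
    have wfA: "wf_pfm (\<rho> # \<Delta>) (psubst (up \<sigma>) A)"
      using A wt by (auto intro: wf_psubst wt_up)
    have xsD: "list_all2 (has_ty \<Delta>) (map (tsubst \<sigma>) xs') (U_all A)"
      using xs' wt by (rule list_all2_tsubst)
    have ysD: "list_all2 (has_ty \<Delta>) (map (tsubst \<sigma>) ys) (U_ex A)"
      using ysty wt by (rule list_all2_tsubst)
    have ssD: "list_all2 (has_ty \<Delta>) ss (U_ex A)" using majs_tys(1) [OF ss] ex by simp
    have "prv T \<Delta> \<Psi> (BEx \<rho> (tsubst \<sigma> t) (?K' (map (tlift 1) (map (tsubst \<sigma>) ys))))"
      using prv_morph [OF T R m] lens by (simp add: fsubst_KM)
    then have "prv T \<Delta> \<Psi> (BEx \<rho> (tsubst \<sigma> t) (?K' (map (tlift 1) ss)))"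
    proof (rule prv_BEx_mono [OF _ _ has_ty_tsubst [OF t wt] _ _ T])
      fix \<Delta>' \<Psi>' \<tau> s
      assume m': "morph \<tau> \<Delta> \<Psi> \<Delta>' \<Psi>'" and s: "has_ty \<Delta>' s \<rho>"
      have wt': "wt_env \<tau> \<Delta> \<Delta>'" using m' by (rule morph_wt)
      let ?B = "psubst (extend \<tau> [s]) (psubst (up \<sigma>) A)"
      have wfB: "wf_pfm \<Delta>' ?B" using wfA wt_extend_single [OF wt' s] by (rule wf_psubst)
      have eq: "fsubst (extend \<tau> [s]) (?K' (map (tlift 1) zs)) =
          KM ?B (map (tsubst \<tau>) (map (tsubst \<sigma>) xs')) (map (tsubst \<tau>) zs)"
        if "length zs = length (U_ex A)" for zs
        using that lens by (simp add: fsubst_KM)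
      assume "prv T \<Delta>' \<Psi>' (fsubst (extend \<tau> [s]) (?K' (map (tlift 1) (map (tsubst \<sigma>) ys))))"
      then have "prv T \<Delta>' \<Psi>' (KM ?B (map (tsubst \<tau>) (map (tsubst \<sigma>) xs')) (map (tsubst \<tau>) (map (tsubst \<sigma>) ys)))"
        by (subst (asm) eq) (use lens in simp_all)
      then have "prv T \<Delta>' \<Psi>' (KM ?B (map (tsubst \<tau>) (map (tsubst \<sigma>) xs')) (map (tsubst \<tau>) ss))"
        by (rule KM_antimono [OF _ _ wfB _ T])
          (use majs_morph [OF T ss m'] ex list_all2_tsubst [OF xsD wt'] in simp_all)
      then show "prv T \<Delta>' \<Psi>' (fsubst (extend \<tau> [s]) (?K' (map (tlift 1) ss)))"
        by (subst eq) (use lens in simp_all)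
    next
      show "wf_fm (\<rho> # \<Delta>) (?K' (map (tlift 1) (map (tsubst \<sigma>) ys)))"
        by (rule wf_KM [OF wfA])
          (use list_all2_tlift_1 [OF xsD] list_all2_tlift_1 [OF ysD] in simp_all)
      show "wf_fm (\<rho> # \<Delta>) (?K' (map (tlift 1) ss))"
        by (rule wf_KM [OF wfA])
          (use list_all2_tlift_1 [OF xsD] list_all2_tlift_1 [OF ssD] in simp_all)
    qed
    then show "prv T \<Delta> \<Psi> (KB (psubst \<sigma> A') (map (tsubst \<sigma>) xs) ss)"
      unfolding KB .
  qed (use ysty ex in simp)
qed

text \<open>The equivalence is applied below the quantifier, to the instance of A at a witness in a
  later world; hence the induction hypothesis for every substitution instance. Afterwards
  \<open>prv_Neg_BAll\<close> pulls the negation out.\<close>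

lemma KM_BEx_iff:
  assumes IH: "\<And>\<theta> \<Gamma> \<Phi> xs ys. wf_pfm \<Gamma> (psubst \<theta> A) \<Longrightarrow> majs BLEM \<Gamma> \<Phi> (U_all A) xs xs \<Longrightarrow>
      majs BLEM \<Gamma> \<Phi> (U_ex A) ys ys \<Longrightarrow>
      prv BLEM \<Gamma> \<Phi> (KM (psubst \<theta> A) xs ys) \<longleftrightarrow> prv BLEM \<Gamma> \<Phi> (Neg (U_mat (psubst \<theta> A) xs ys))"
    and t: "has_ty \<Gamma> t \<rho>" and A: "wf_pfm (\<rho> # \<Gamma>) A"
    and xs: "majs BLEM \<Gamma> \<Phi> (U_all A) xs xs" and ys: "majs BLEM \<Gamma> \<Phi> (U_ex A) ys ys"
  shows "prv BLEM \<Gamma> \<Phi> (BEx \<rho> t (KM A (map (tlift 1) xs) (map (tlift 1) ys))) \<longleftrightarrow>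
    prv BLEM \<Gamma> \<Phi> (Neg (BAll \<rho> t (U_mat A (map (tlift 1) xs) (map (tlift 1) ys))))"
proof -
  let ?K = "KM A (map (tlift 1) xs) (map (tlift 1) ys)"
  let ?U = "U_mat A (map (tlift 1) xs) (map (tlift 1) ys)"
  have tys: "list_all2 (has_ty (\<rho> # \<Gamma>)) (map (tlift 1) xs) (U_all A)"
    "list_all2 (has_ty (\<rho> # \<Gamma>)) (map (tlift 1) ys) (U_ex A)"
    using list_all2_tlift_1 [OF majs_tys(1) [OF xs]] list_all2_tlift_1 [OF majs_tys(1) [OF ys]] by simp_all
  have wfK: "wf_fm (\<rho> # \<Gamma>) ?K" and wfU: "wf_fm (\<rho> # \<Gamma>) ?U"
    using A tys by (auto intro: wf_KM wf_U_mat)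
  have eq: "prv BLEM \<Delta> \<Psi> (fsubst (extend \<sigma> [s]) ?K) \<longleftrightarrow> prv BLEM \<Delta> \<Psi> (fsubst (extend \<sigma> [s]) (Neg ?U))"
    if m: "morph \<sigma> \<Gamma> \<Phi> \<Delta> \<Psi>" and s: "has_ty \<Delta> s \<rho>" for \<Delta> \<Psi> \<sigma> s
    using IH [OF wf_psubst [OF A wt_extend_single [OF morph_wt [OF m] s]]
        majs_morph [OF subst_closed_BLEM xs m] majs_morph [OF subst_closed_BLEM ys m]]
      majs_length(1) [OF xs] majs_length(1) [OF ys]
    by (simp add: fsubst_KM fsubst_U_mat)
  have "prv BLEM \<Gamma> \<Phi> (BEx \<rho> t ?K) \<longleftrightarrow> prv BLEM \<Gamma> \<Phi> (BEx \<rho> t (Neg ?U))"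
    using prv_BEx_mono [OF _ _ t _ _ subst_closed_BLEM, of \<Phi> ?K "Neg ?U"]
      prv_BEx_mono [OF _ _ t _ _ subst_closed_BLEM, of \<Phi> "Neg ?U" ?K] eq wfK wfU
    by (metis wf_fm.simps(2,5))
  also have "\<dots> \<longleftrightarrow> prv BLEM \<Gamma> \<Phi> (Neg (BAll \<rho> t ?U))"
    using prv_Neg_BAll [OF t wfU bounded_U_mat] by blast
  finally show ?thesis .
qed

lemma fsubst_U_PNeg_body:
  assumes "length ss = length (U_all A)" and "length Ys = length (U_ex A)"
  shows "fsubst (extend \<sigma> ss) (Neg (U_mat (plift (length (U_all A)) A) (vars (length (U_all A)))
      (tapps (map (tlift (length (U_all A))) Ys) (vars (length (U_all A)))))) =
    Neg (U_mat (psubst \<sigma> A) ss (tapps (map (tsubst \<sigma>) Ys) ss))"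
  using assms by (simp add: fsubst_U_mat)

text \<open>Context and hypotheses vary: the negation case applies the induction hypothesis in later
  worlds and under a new assumption, and the conjunction case under the assumption of a
  disjunct.\<close>

lemma KM_iff:
  "wf_pfm \<Gamma> A \<Longrightarrow> majs BLEM \<Gamma> \<Phi> (U_all A) xs xs \<Longrightarrow> majs BLEM \<Gamma> \<Phi> (U_ex A) ys ys \<Longrightarrow>
    prv BLEM \<Gamma> \<Phi> (KM A xs ys) \<longleftrightarrow> prv BLEM \<Gamma> \<Phi> (Neg (U_mat A xs ys))"
proof (induction A arbitrary: \<Gamma> \<Phi> xs ys rule: pfm_subst_induct)
  case (PAtom a)
  then show ?case by (simp add: KM_def)
next
  case (PNeg A)
  let ?n = "length (U_all A)"
  let ?B = "Neg (U_mat (plift ?n A) (vars ?n) (tapps (map (tlift ?n) xs) (vars ?n)))"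
  note T = subst_closed_BLEM
  have xs: "majs BLEM \<Gamma> \<Phi> (map (funs (U_all A)) (U_ex A)) xs xs"
    and ys: "majs BLEM \<Gamma> \<Phi> (U_all A) ys ys" and A: "wf_pfm \<Gamma> A"
    using PNeg.prems by simp_all
  have xsty: "list_all2 (has_ty \<Gamma>) xs (map (funs (U_all A)) (U_ex A))" using xs by (rule majs_tys)
  have ysty: "list_all2 (has_ty \<Gamma>) ys (U_all A)" using ys by (rule majs_tys)
  have lens: "length xs = length (U_ex A)" "length ys = ?n"
    using list_all2_lengthD [OF xsty] list_all2_lengthD [OF ysty] by simp_all
  have wfU: "wf_fm \<Gamma> (U_mat (PNeg A) xs ys)"
    using PNeg.prems(1) xsty ysty by (intro wf_U_mat) simp_all
  have U: "U_mat (PNeg A) xs ys = MBExs (U_all A) ys ?B" by (simp add: Let_def)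
  have wfB: "wf_fm (rev (U_all A) @ \<Gamma>) ?B"
    using wfU wf_MBExs [OF ysty] unfolding U by blast
  show ?case
  proof
    assume L: "prv BLEM \<Gamma> \<Phi> (KM (PNeg A) xs ys)"
    \<comment> \<open>The assumed matrix provides a smaller monotone tuple at which A_U fails. The
      induction hypothesis turns this failure into \<open>KM\<close> of A at that tuple, which the
      closure of the negated formula denies.\<close>
    have "prv BLEM \<Gamma> (insert (U_mat (PNeg A) xs ys) \<Phi>) Bot" (is "prv _ _ ?\<Phi> _")
    proof (rule MBExs_E [OF _ _ ysty wfB T])
      show "prv BLEM \<Gamma> ?\<Phi> (MBExs (U_all A) ys ?B)" using prv_insert [OF wfU] unfolding U .
      fix \<Delta> \<Psi> \<sigma> ss
      assume m: "morph \<sigma> \<Gamma> ?\<Phi> \<Delta> \<Psi>" and ss: "majs BLEM \<Delta> \<Psi> (U_all A) ss (map (tsubst \<sigma>) ys)"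
        "majs BLEM \<Delta> \<Psi> (U_all A) ss ss" and B: "prv BLEM \<Delta> \<Psi> (fsubst (extend \<sigma> ss) ?B)"
      have wt: "wt_env \<sigma> \<Gamma> \<Delta>" using m by (rule morph_wt)
      have m0: "morph \<sigma> \<Gamma> \<Phi> \<Delta> \<Psi>" using m by (auto simp: morph_def)
      have wf: "wf_pfm \<Delta> (psubst \<sigma> A)" using A wt by (rule wf_psubst)
      have "prv BLEM \<Delta> \<Psi> (KM (psubst \<sigma> (PNeg A)) (map (tsubst \<sigma>) xs) (map (tsubst \<sigma>) ys))"
        using L m0 T by (rule prv_morph_KM) (use xsty ysty in simp_all)
      then have "prv BLEM \<Delta> \<Psi> (KB (psubst \<sigma> (PNeg A)) (map (tsubst \<sigma>) xs) ss)"
        by (rule KM_E) (use ss wf list_all2_tsubst [OF xsty wt] in simp_all)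
      then have n: "prv BLEM \<Delta> \<Psi> (Neg (KM (psubst \<sigma> A) ss (tapps (map (tsubst \<sigma>) xs) ss)))"
        using majs_length(1) [OF ss(1)] by (simp add: KB_PNeg)
      \<comment> \<open>The induction hypothesis speaks of monotone tuples, so the value of Y at the
        chosen tuple must be monotone too.\<close>
      have maj: "majs BLEM \<Delta> \<Psi> (U_ex A) (tapps (map (tsubst \<sigma>) xs) ss) (tapps (map (tsubst \<sigma>) xs) ss)"
        by (rule majs_tapps [OF majs_morph [OF T xs m0] ss(2)])
      have "prv BLEM \<Delta> \<Psi> (Neg (U_mat (psubst \<sigma> A) ss (tapps (map (tsubst \<sigma>) xs) ss)))"
        using B fsubst_U_PNeg_body [OF majs_length(1) [OF ss(1)] lens(1), of \<sigma>] by simp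
      then have "prv BLEM \<Delta> \<Psi> (KM (psubst \<sigma> A) ss (tapps (map (tsubst \<sigma>) xs) ss))"
        using PNeg.IH [OF wf] ss(2) maj by simp
      with n show "prv BLEM \<Delta> \<Psi> (fsubst \<sigma> Bot)" by (simp, rule prv_Bot_cut)
    qed
    then show "prv BLEM \<Gamma> \<Phi> (Neg (U_mat (PNeg A) xs ys))" using wfU by (rule ImpI)
  next
    assume R: "prv BLEM \<Gamma> \<Phi> (Neg (U_mat (PNeg A) xs ys))"
    show "prv BLEM \<Gamma> \<Phi> (KM (PNeg A) xs ys)"
    proof (rule KM_I [OF _ PNeg.prems(1) _ _ T])
      fix \<Delta> \<Psi> \<sigma> ss
      assume m: "morph \<sigma> \<Gamma> \<Phi> \<Delta> \<Psi>" and "majs BLEM \<Delta> \<Psi> (U_ex (PNeg A)) ss (map (tsubst \<sigma>) ys)"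
        "majs BLEM \<Delta> \<Psi> (U_ex (PNeg A)) ss ss"
      then have ss: "majs BLEM \<Delta> \<Psi> (U_all A) ss (map (tsubst \<sigma>) ys)"
        "majs BLEM \<Delta> \<Psi> (U_all A) ss ss" by simp_all
      have wt: "wt_env \<sigma> \<Gamma> \<Delta>" using m by (rule morph_wt)
      have wf: "wf_pfm \<Delta> (psubst \<sigma> A)" using A wt by (rule wf_psubst)
      let ?Ys = "tapps (map (tsubst \<sigma>) xs) ss"
      let ?K = "KM (psubst \<sigma> A) ss ?Ys"
      have xs\<sigma>: "majs BLEM \<Delta> \<Psi> (map (funs (U_all A)) (U_ex A)) (map (tsubst \<sigma>) xs) (map (tsubst \<sigma>) xs)"
        by (rule majs_morph [OF T xs m])
      have maj: "majs BLEM \<Delta> \<Psi> (U_ex A) ?Ys ?Ys"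
        by (rule majs_tapps [OF xs\<sigma> ss(2)])
      have wfK: "wf_fm \<Delta> ?K"
        using wf majs_tys(1) [OF ss(1)] majs_tys(1) [OF maj] by (intro wf_KM) simp_all
      have len: "length ss = ?n" using ss(1) by (rule majs_length)
      \<comment> \<open>Conversely \<open>KM\<close> of A is assumed at a smaller tuple; by the
        induction hypothesis A_U fails there, so the tuple itself witnesses the existential matrix
        whose negation is given.\<close>
      have "prv BLEM \<Delta> (insert ?K \<Psi>) (KM (psubst \<sigma> A) ss ?Ys)"
        using wfK by (rule prv_insert)
      then have "prv BLEM \<Delta> (insert ?K \<Psi>) (Neg (U_mat (psubst \<sigma> A) ss ?Ys))"
        using PNeg.IH [OF wf, of "insert ?K \<Psi>" ss ?Ys] majs_mono [OF ss(2) subset_insertI]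
          majs_mono [OF maj subset_insertI] by simp
      then have "prv BLEM \<Delta> (insert ?K \<Psi>) (fsubst (extend Var ss) (fsubst (upn ?n \<sigma>) ?B))"
        using len lens by (simp add: fsubst_U_mat tsubst_extend_upn)
      then have "prv BLEM \<Delta> (insert ?K \<Psi>) (MBExs (U_all A) (map (tsubst \<sigma>) ys) (fsubst (upn ?n \<sigma>) ?B))"
        by (rule MBExs_I)
          (use majs_mono [OF ss(1) subset_insertI] majs_mono [OF ss(2) subset_insertI]
            wf_fsubst [OF wfB wt_upn [OF wt]] in simp_all)
      then have "prv BLEM \<Delta> (insert ?K \<Psi>) (fsubst \<sigma> (U_mat (PNeg A) xs ys))"
        unfolding U using lens by (simp only: fsubst_MBExs)
      moreover have "prv BLEM \<Delta> (insert ?K \<Psi>) (Neg (fsubst \<sigma> (U_mat (PNeg A) xs ys)))"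
        using prv_weaken [OF prv_morph [OF T R m]] by (simp only: fsubst.simps)
      ultimately have "prv BLEM \<Delta> (insert ?K \<Psi>) Bot" by (rule_tac prv_Bot_cut)
      then show "prv BLEM \<Delta> \<Psi> (KB (psubst \<sigma> (PNeg A)) (map (tsubst \<sigma>) xs) ss)"
        using wfK len by (simp add: KB_PNeg ImpI)
    qed (use xsty ysty in simp_all)
  qed
next
  case (POr A B)
  let ?x = "take (length (U_all A)) xs" and ?y = "take (length (U_ex A)) ys"
    and ?x' = "drop (length (U_all A)) xs" and ?y' = "drop (length (U_ex A)) ys"
  have p: "majs BLEM \<Gamma> \<Phi> (U_all A) ?x ?x" "majs BLEM \<Gamma> \<Phi> (U_all B) ?x' ?x'"
    "majs BLEM \<Gamma> \<Phi> (U_ex A) ?y ?y" "majs BLEM \<Gamma> \<Phi> (U_ex B) ?y' ?y'"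
    "wf_pfm \<Gamma> A" "wf_pfm \<Gamma> B"
    using POr.prems by (simp_all add: majs_append)
  note tys = p(1-4) [THEN majs_tys(1)]
  have "prv BLEM \<Gamma> \<Phi> (KM (POr A B) xs ys) \<longleftrightarrow> prv BLEM \<Gamma> \<Phi> (KM A ?x ?y) \<and> prv BLEM \<Gamma> \<Phi> (KM B ?x' ?y')"
    by (rule KM_POr [OF POr.prems(1) _ _ subst_closed_BLEM])
      (use POr.prems majs_tys(1) [OF POr.prems(2)] in simp_all)
  also have "\<dots> \<longleftrightarrow> prv BLEM \<Gamma> \<Phi> (Neg (U_mat A ?x ?y)) \<and> prv BLEM \<Gamma> \<Phi> (Neg (U_mat B ?x' ?y'))"
    using POr.IH(1) [where \<theta> = Var] POr.IH(2) [where \<theta> = Var] p by simp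
  also have "\<dots> \<longleftrightarrow> prv BLEM \<Gamma> \<Phi> (Neg (U_mat (POr A B) xs ys))"
    using prv_Neg_Or [OF wf_U_mat [OF p(5) tys(1,3)] wf_U_mat [OF p(6) tys(2,4)]] by simp
  finally show ?case .
next
  case (PAnd A B)
  let ?x = "take (length (U_all A)) xs" and ?y = "take (length (U_ex A)) ys"
    and ?x' = "drop (length (U_all A)) xs" and ?y' = "drop (length (U_ex A)) ys"
  have p: "majs BLEM \<Gamma> \<Phi> (U_all A) ?x ?x" "majs BLEM \<Gamma> \<Phi> (U_all B) ?x' ?x'"
    "majs BLEM \<Gamma> \<Phi> (U_ex A) ?y ?y" "majs BLEM \<Gamma> \<Phi> (U_ex B) ?y' ?y'"
    "wf_pfm \<Gamma> A" "wf_pfm \<Gamma> B"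
    using PAnd.prems by (simp_all add: majs_append)
  note tys = p(1-4) [THEN majs_tys(1)]
  have wf: "wf_fm \<Gamma> (KM A ?x ?y)" "wf_fm \<Gamma> (KM B ?x' ?y')"
    "wf_fm \<Gamma> (U_mat A ?x ?y)" "wf_fm \<Gamma> (U_mat B ?x' ?y')"
    using wf_KM [OF p(5) tys(1,3)] wf_KM [OF p(6) tys(2,4)]
      wf_U_mat [OF p(5) tys(1,3)] wf_U_mat [OF p(6) tys(2,4)] by simp_all
  have IH: "prv BLEM \<Gamma> \<Psi> (KM A ?x ?y) \<longleftrightarrow> prv BLEM \<Gamma> \<Psi> (Neg (U_mat A ?x ?y))"
    "prv BLEM \<Gamma> \<Psi> (KM B ?x' ?y') \<longleftrightarrow> prv BLEM \<Gamma> \<Psi> (Neg (U_mat B ?x' ?y'))" if "\<Phi> \<subseteq> \<Psi>" for \<Psi>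
    using PAnd.IH(1) [where \<theta> = Var] PAnd.IH(2) [where \<theta> = Var] p majs_mono [OF _ that] by simp_all
  have "prv BLEM \<Gamma> \<Phi> (KM (PAnd A B) xs ys) \<longleftrightarrow> prv BLEM \<Gamma> \<Phi> (Or (KM A ?x ?y) (KM B ?x' ?y'))"
    by (rule KM_PAnd [OF PAnd.prems(1) _ _ subst_closed_BLEM])
      (use PAnd.prems majs_tys(1) [OF PAnd.prems(2)] in simp_all)
  also have "\<dots> \<longleftrightarrow> prv BLEM \<Gamma> \<Phi> (Or (Neg (U_mat A ?x ?y)) (Neg (U_mat B ?x' ?y')))"
  proof
    assume "prv BLEM \<Gamma> \<Phi> (Or (KM A ?x ?y) (KM B ?x' ?y'))"
    then show "prv BLEM \<Gamma> \<Phi> (Or (Neg (U_mat A ?x ?y)) (Neg (U_mat B ?x' ?y')))"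
      by (rule prv_Or_mono) (use IH wf in simp_all)
  next
    assume "prv BLEM \<Gamma> \<Phi> (Or (Neg (U_mat A ?x ?y)) (Neg (U_mat B ?x' ?y')))"
    then show "prv BLEM \<Gamma> \<Phi> (Or (KM A ?x ?y) (KM B ?x' ?y'))"
      by (rule prv_Or_mono) (use IH wf in simp_all)
  qed
  also have "\<dots> \<longleftrightarrow> prv BLEM \<Gamma> \<Phi> (Neg (U_mat (PAnd A B) xs ys))"
    using prv_Neg_And [OF wf(3,4) bounded_U_mat bounded_U_mat] by simp
  finally show ?case .
next
  case (PBAll \<rho> t A)
  have p: "has_ty \<Gamma> t \<rho>" "wf_pfm (\<rho> # \<Gamma>) A" "majs BLEM \<Gamma> \<Phi> (U_all A) xs xs" "majs BLEM \<Gamma> \<Phi> (U_ex A) ys ys"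
    using PBAll.prems by simp_all
  have "prv BLEM \<Gamma> \<Phi> (KM (PBAll \<rho> t A) xs ys) \<longleftrightarrow>
      prv BLEM \<Gamma> \<Phi> (BEx \<rho> t (KM A (map (tlift 1) xs) (map (tlift 1) ys)))"
    by (rule KM_BEx) (use PBAll.prems p majs_tys(1) [OF p(3)] subst_closed_BLEM in simp_all)
  also have "\<dots> \<longleftrightarrow> prv BLEM \<Gamma> \<Phi> (Neg (BAll \<rho> t (U_mat A (map (tlift 1) xs) (map (tlift 1) ys))))"
    by (rule KM_BEx_iff [OF _ p]) (use PBAll.IH in simp)
  finally show ?case by simp
next
  case (PUAll \<rho> A)
  then obtain t xs' where xs: "xs = t # xs'" by (auto simp: majs_Cons1)
  have p: "has_ty \<Gamma> t \<rho>" "wf_pfm (\<rho> # \<Gamma>) A" "majs BLEM \<Gamma> \<Phi> (U_all A) xs' xs'" "majs BLEM \<Gamma> \<Phi> (U_ex A) ys ys"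
    using PUAll.prems xs by simp_all
  have "prv BLEM \<Gamma> \<Phi> (KM (PUAll \<rho> A) xs ys) \<longleftrightarrow>
      prv BLEM \<Gamma> \<Phi> (BEx \<rho> t (KM A (map (tlift 1) xs') (map (tlift 1) ys)))"
    by (rule KM_BEx) (use xs PUAll.prems p majs_tys(1) [OF p(3)] subst_closed_BLEM in simp_all)
  also have "\<dots> \<longleftrightarrow> prv BLEM \<Gamma> \<Phi> (Neg (BAll \<rho> t (U_mat A (map (tlift 1) xs') (map (tlift 1) ys))))"
    by (rule KM_BEx_iff [OF _ p]) (use PUAll.IH in simp)
  finally show ?case using xs by simp
qed

text \<open>\<open>KB (PNeg A)\<close> is a negated closure and by \<open>KM_iff\<close> a double
  negation of the bounded formula A_U, which is stable under BLEM.\<close>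

lemma U_mat_iff_KB:
  assumes A: "wf_pfm \<Gamma> A" and Ys: "majs BLEM \<Gamma> \<Phi> (map (funs (U_all A)) (U_ex A)) Ys Ys"
    and xs: "majs BLEM \<Gamma> \<Phi> (U_all A) xs xs"
  shows "prv BLEM \<Gamma> \<Phi> (U_mat A xs (tapps Ys xs)) \<longleftrightarrow> prv BLEM \<Gamma> \<Phi> (KB (PNeg A) Ys xs)"
proof -
  have maj: "majs BLEM \<Gamma> \<Phi> (U_ex A) (tapps Ys xs) (tapps Ys xs)"
    using Ys xs by (rule majs_tapps)
  note tys = majs_tys(1) [OF xs] majs_tys(1) [OF maj]
  have wf: "wf_fm \<Gamma> (U_mat A xs (tapps Ys xs))" "wf_fm \<Gamma> (KM A xs (tapps Ys xs))"
    using wf_U_mat [OF A tys] wf_KM [OF A tys] by simp_all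
  have "prv BLEM \<Gamma> \<Phi> (KB (PNeg A) Ys xs) \<longleftrightarrow> prv BLEM \<Gamma> \<Phi> (Neg (KM A xs (tapps Ys xs)))"
    using majs_length(1) [OF xs] by (simp add: KB_PNeg)
  also have "\<dots> \<longleftrightarrow> prv BLEM \<Gamma> \<Phi> (Neg (Neg (U_mat A xs (tapps Ys xs))))"
    by (rule prv_Neg_cong) (use wf KM_iff [OF A majs_mono [OF xs] majs_mono [OF maj]] in simp_all)
  also have "\<dots> \<longleftrightarrow> prv BLEM \<Gamma> \<Phi> (U_mat A xs (tapps Ys xs))"
    using wf(1) bounded_U_mat by (rule prv_Neg_Neg)
  finally show ?thesis ..
qed

section \<open>From the matrices to the quantified formulas\<close>

lemma prv_Iff_I:
  assumes "\<And>\<Psi>. \<Phi> \<subseteq> \<Psi> \<Longrightarrow> prv T \<Gamma> \<Psi> A \<longleftrightarrow> prv T \<Gamma> \<Psi> B" and "wf_fm \<Gamma> A" and "wf_fm \<Gamma> B"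
  shows "prv T \<Gamma> \<Phi> (Iff A B)"
  \<comment> \<open>The set of hypotheses is enlarged once by A and once by B, giving one
    implication each.\<close>
  using assms(1) [OF subset_insertI, of A] assms(1) [OF subset_insertI, of B]
    prv_insert [OF assms(2), of T \<Phi>] prv_insert [OF assms(3), of T \<Phi>] assms(2,3)
  by (simp add: prv_Imp)

lemma extend_shift_vars [simp]: "extend (\<lambda>i. Var (i + n)) (vars n) = Var"
  using extend_lift_vars [of n] by (simp only: lift_env_def)

lemma MAlls_mono:
  assumes "prv T \<Gamma> \<Phi> (MAlls \<rho>s A)"
    and "prv T (rev \<rho>s @ \<Gamma>) (insert A (flift (length \<rho>s) ` \<Phi> \<union> set (self_maj \<rho>s))) B"
    and wf: "wf_fm (rev \<rho>s @ \<Gamma>) A" and T: "subst_closed T"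
  shows "prv T \<Gamma> \<Phi> (MAlls \<rho>s B)"
proof (rule MAlls_I, rule prv_cut [OF _ assms(2) wf])
  let ?n = "length \<rho>s" and ?\<Phi> = "flift (length \<rho>s) ` \<Phi> \<union> set (self_maj \<rho>s)"
  have "morph (lift_env ?n) \<Gamma> \<Phi> (rev \<rho>s @ \<Gamma>) ?\<Phi>" by (rule morph_lift) auto
  from prv_morph [OF T assms(1) this]
  have "prv T (rev \<rho>s @ \<Gamma>) ?\<Phi> (MAlls \<rho>s (fsubst (upn ?n (lift_env ?n)) A))"
    by (simp add: fsubst_MAlls)
  \<comment> \<open>The lifted formula is instantiated with the freshly bound variables themselves,
    which gives back the matrix; their guards make them monotone.\<close>
  from MAlls_E [OF this majs_vars] show "prv T (rev \<rho>s @ \<Gamma>) ?\<Phi> A"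
    by (simp add: tsubst_extend_upn)
qed

lemma MExs_mono:
  assumes "prv T \<Gamma> \<Phi> (MExs \<rho>s A)"
    and "prv T (rev \<rho>s @ \<Gamma>) (insert A (flift (length \<rho>s) ` \<Phi> \<union> set (self_maj \<rho>s))) B"
    and wf: "wf_fm (rev \<rho>s @ \<Gamma>) A" "wf_fm (rev \<rho>s @ \<Gamma>) B"
  shows "prv T \<Gamma> \<Phi> (MExs \<rho>s B)"
proof (rule MExs_E [OF assms(1) _ wf(1)])
  let ?n = "length \<rho>s" and ?\<Phi> = "insert A (flift (length \<rho>s) ` \<Phi> \<union> set (self_maj \<rho>s))"
  have wt: "wt_env (lift_env ?n) \<Gamma> (rev \<rho>s @ \<Gamma>)" by simp
  have "prv T (rev \<rho>s @ \<Gamma>) ?\<Phi> (fsubst (extend Var (vars ?n)) (fsubst (upn ?n (lift_env ?n)) B))"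
    using assms(2) by (simp add: tsubst_extend_upn)
  then have "prv T (rev \<rho>s @ \<Gamma>) ?\<Phi> (MExs \<rho>s (fsubst (upn ?n (lift_env ?n)) B))"
    by (rule MExs_I) (use wf_fsubst [OF wf(2) wt_upn [OF wt]] in \<open>auto intro: majs_vars\<close>)
  then show "prv T (rev \<rho>s @ \<Gamma>) ?\<Phi> (flift ?n (MExs \<rho>s B))" by (simp add: fsubst_MExs)
qed

text \<open>This removes the bounded witness of bMAC. If \<open>KM\<close> held at the bound ys, it
  would hold at the smaller witness by antimonotonicity, and there \<open>KM_iff\<close> refutes the
  A_U that the witness provides.\<close>

lemma MBExs_U_mat_imp:
  assumes A: "wf_pfm \<Gamma> A" and xs: "majs BLEM \<Gamma> \<Phi> (U_all A) xs xs"
    and ys: "list_all2 (has_ty \<Gamma>) ys (U_ex A)"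
    and U: "prv BLEM \<Gamma> \<Phi> (MBExs (U_ex A) ys
      (U_mat (plift (length (U_ex A)) A) (map (tlift (length (U_ex A))) xs) (vars (length (U_ex A)))))"
      (is "prv _ _ _ (MBExs _ _ ?U)")
  shows "prv BLEM \<Gamma> \<Phi> (Neg (KM A xs ys))"
proof (rule ImpI)
  let ?m = "length (U_ex A)"
  note T = subst_closed_BLEM
  have xsty: "list_all2 (has_ty \<Gamma>) xs (U_all A)" using xs by (rule majs_tys)
  show wfK: "wf_fm \<Gamma> (KM A xs ys)" using A xsty ys by (rule wf_KM)
  have wfU: "wf_fm (rev (U_ex A) @ \<Gamma>) ?U"
    by (rule wf_U_mat)
      (use A list_all2_tlift [OF xsty, of "rev (U_ex A)"] in \<open>auto intro: wf_psubst list_all2_vars wt_lift\<close>)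
  show "prv BLEM \<Gamma> (insert (KM A xs ys) \<Phi>) Bot"
  proof (rule MBExs_E [OF prv_weaken [OF U] _ ys wfU T])
    fix \<Delta> \<Psi> \<sigma> ss
    assume m: "morph \<sigma> \<Gamma> (insert (KM A xs ys) \<Phi>) \<Delta> \<Psi>"
      and ss: "majs BLEM \<Delta> \<Psi> (U_ex A) ss (map (tsubst \<sigma>) ys)" "majs BLEM \<Delta> \<Psi> (U_ex A) ss ss"
      and u: "prv BLEM \<Delta> \<Psi> (fsubst (extend \<sigma> ss) ?U)"
    have wt: "wt_env \<sigma> \<Gamma> \<Delta>" using m by (rule morph_wt)
    have wf: "wf_pfm \<Delta> (psubst \<sigma> A)" using A wt by (rule wf_psubst)
    have xs': "majs BLEM \<Delta> \<Psi> (U_all A) (map (tsubst \<sigma>) xs) (map (tsubst \<sigma>) xs)"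
      by (rule majs_morph [OF T majs_mono [OF xs subset_insertI] m])
    have "prv BLEM \<Delta> \<Psi> (KM (psubst \<sigma> A) (map (tsubst \<sigma>) xs) (map (tsubst \<sigma>) ys))"
      using prv_insert [OF wfK] m T xsty ys by (rule prv_morph_KM)
    then have "prv BLEM \<Delta> \<Psi> (KM (psubst \<sigma> A) (map (tsubst \<sigma>) xs) ss)"
      by (rule KM_antimono [OF _ _ wf _ T]) (use ss(1) majs_tys(1) [OF xs'] in simp_all)
    then have "prv BLEM \<Delta> \<Psi> (Neg (U_mat (psubst \<sigma> A) (map (tsubst \<sigma>) xs) ss))"
      using KM_iff [OF wf, of \<Psi> "map (tsubst \<sigma>) xs" ss] xs' ss(2) by simp
    moreover have "prv BLEM \<Delta> \<Psi> (U_mat (psubst \<sigma> A) (map (tsubst \<sigma>) xs) ss)"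
      using u list_all2_lengthD [OF xsty] majs_length(1) [OF ss(1)] by (simp add: fsubst_U_mat)
    ultimately show "prv BLEM \<Delta> \<Psi> (fsubst \<sigma> Bot)" by (simp, rule_tac prv_Bot_cut)
  qed
qed

text \<open>Y and x form one block in the first claim and two nested blocks in the second; this
  identity translates between them. The outer tuple is seen through the n inner binders.\<close>

lemma vars_add: "vars (m + n) = map (tlift n) (vars m) @ vars n"
  by (induction m) (simp_all add: vars_Suc)

lemma majs_vars_append:
  assumes "set (self_maj (\<tau>s @ \<rho>s)) \<subseteq> \<Phi>"
  shows "majs T (rev \<rho>s @ rev \<tau>s @ \<Gamma>) \<Phi> \<tau>s
      (map (tlift (length \<rho>s)) (vars (length \<tau>s))) (map (tlift (length \<rho>s)) (vars (length \<tau>s)))"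
    and "majs T (rev \<rho>s @ rev \<tau>s @ \<Gamma>) \<Phi> \<rho>s (vars (length \<rho>s)) (vars (length \<rho>s))"
  using majs_vars [OF assms, of T \<Gamma>] by (simp_all add: majs_append vars_add)

lemma self_maj_append:
  "set (self_maj (\<tau>s @ \<rho>s)) = flift (length \<rho>s) ` set (self_maj \<tau>s) \<union> set (self_maj \<rho>s)"
proof -
  have "self_maj (\<tau>s @ \<rho>s) = map (flift (length \<rho>s)) (self_maj \<tau>s) @ self_maj \<rho>s"
    unfolding map_self_maj by (simp add: self_maj_def vars_add)
  then show ?thesis by simp
qed

text \<open>A^K is the negation of A_K, which is literally (\<not>A)_K; so its interpretation is
  covered by the negation clause of \<open>KB\<close>.\<close>

lemma krivine_mat: "B_mat (flift k (krivine A)) = KB (PNeg (plift k A))"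
  by (rule ext)+ (simp add: KB_def krivine_def krivine_sub_psubst)

lemma prv_U_mat_iff_B_mat:
  assumes A: "wf_pfm \<Gamma> A"
  defines "m \<equiv> length (U_ex A)" and "n \<equiv> length (U_all A)" and "\<tau>s \<equiv> map (funs (U_all A)) (U_ex A)"
  shows "prv BLEM \<Gamma> {} (MAlls (\<tau>s @ U_all A)
    (Iff (U_mat (plift (m + n) A) (vars n) (tapps (map (tlift n) (vars m)) (vars n)))
         (B_mat (flift (m + n) (krivine A)) (map (tlift n) (vars m)) (vars n))))"
proof (rule MAlls_I)
  let ?\<Gamma> = "rev (\<tau>s @ U_all A) @ \<Gamma>" and ?A = "plift (m + n) A"
  let ?Y = "map (tlift n) (vars m)" and ?x = "vars n"
  let ?\<Phi> = "flift (length (\<tau>s @ U_all A)) ` {} \<union> set (self_maj (\<tau>s @ U_all A))"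
  have wf: "wf_pfm ?\<Gamma> ?A" using A
    by (rule wf_psubst)
      (use wt_lift [of "rev (U_all A) @ rev \<tau>s" "m + n" \<Gamma>] in \<open>simp add: m_def n_def \<tau>s_def\<close>)
  have len: "length \<tau>s = m" "length (U_all A) = n" by (simp_all add: m_def n_def \<tau>s_def)
  have maj: "majs BLEM ?\<Gamma> \<Psi> \<tau>s ?Y ?Y" "majs BLEM ?\<Gamma> \<Psi> (U_all A) ?x ?x" if "?\<Phi> \<subseteq> \<Psi>" for \<Psi>
    using majs_vars_append [of \<tau>s "U_all A" \<Psi> BLEM \<Gamma>] that len by simp_all
  note tys = maj [OF subset_refl, THEN majs_tys(1)]
  have "prv BLEM ?\<Gamma> ?\<Phi> (Iff (U_mat ?A ?x (tapps ?Y ?x)) (KB (PNeg ?A) ?Y ?x))"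
  proof (rule prv_Iff_I)
    show "prv BLEM ?\<Gamma> \<Psi> (U_mat ?A ?x (tapps ?Y ?x)) \<longleftrightarrow> prv BLEM ?\<Gamma> \<Psi> (KB (PNeg ?A) ?Y ?x)"
      if "?\<Phi> \<subseteq> \<Psi>" for \<Psi>
      by (rule U_mat_iff_KB [OF wf]) (use maj [OF that] in \<open>simp_all add: \<tau>s_def\<close>)
    have "list_all2 (has_ty ?\<Gamma>) (tapps ?Y ?x) (U_ex A)"
      by (rule list_all2_tapps [OF _ tys(2)]) (use tys(1) in \<open>simp add: \<tau>s_def\<close>)
    then show "wf_fm ?\<Gamma> (U_mat ?A ?x (tapps ?Y ?x))"
      using wf tys(2) by (intro wf_U_mat) simp_all
    show "wf_fm ?\<Gamma> (KB (PNeg ?A) ?Y ?x)"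
      using wf tys by (intro wf_KB) (simp_all add: \<tau>s_def)
  qed
  then show "prv BLEM ?\<Gamma> ?\<Phi> (Iff (U_mat ?A ?x (tapps ?Y ?x)) (B_mat (flift (m + n) (krivine A)) ?Y ?x))"
    by (simp only: krivine_mat)
qed

text \<open>A cycle of three implications through \<open>?E\<close> and \<open>?B\<close>, the first
  of them being an instance of bMAC. The other two are derived with BLEM alone, where substitution
  into derivations is available, and then transferred.\<close>

lemma prv_U_int_iff:
  assumes A: "wf_pfm \<Gamma> A"
  defines "m \<equiv> length (U_ex A)" and "n \<equiv> length (U_all A)" and "\<tau>s \<equiv> map (funs (U_all A)) (U_ex A)"
  shows "prv (\<lambda>\<Delta>. BLEM \<Delta> \<union> bMAC \<Delta>) \<Gamma> {} (Iff (U_int A)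
    (MExs \<tau>s (MAlls (U_all A) (B_mat (flift (m + n) (krivine A)) (map (tlift n) (vars m)) (vars n)))))"
proof -
  let ?\<rho>s = "U_all A" and ?\<sigma>s = "U_ex A"
  let ?\<Delta> = "rev \<tau>s @ \<Gamma>" let ?\<Gamma> = "rev ?\<rho>s @ ?\<Delta>" and ?A = "plift (m + n) A"
  let ?Y = "map (tlift n) (vars m)" and ?x = "vars n"
  let ?K = "KB (PNeg ?A) ?Y ?x"
  \<comment> \<open>\<open>?C\<close> is the matrix of A^U under x and y; \<open>?D\<close> is the
    same matrix with y bounded by Y x, in the context where Y is bound outside x.\<close>
  let ?C = "U_mat (plift (n + m) A) (map (tlift m) (vars n)) (vars m)"
  let ?D = "MBExs ?\<sigma>s (tapps ?Y ?x) (U_mat (plift m ?A) (map (tlift m) (vars n)) (vars m))"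
  note T = subst_closed_BLEM
  have len: "length \<tau>s = m" "length ?\<rho>s = n" "length ?\<sigma>s = m" by (simp_all add: m_def n_def \<tau>s_def)
  have wf: "wf_pfm ?\<Gamma> ?A"
    using A by (rule wf_psubst) (use wt_lift [of "rev ?\<rho>s @ rev \<tau>s" "m + n" \<Gamma>] len in simp)
  have maj: "majs BLEM ?\<Gamma> \<Psi> \<tau>s ?Y ?Y" "majs BLEM ?\<Gamma> \<Psi> ?\<rho>s ?x ?x"
    if "set (self_maj (\<tau>s @ ?\<rho>s)) \<subseteq> \<Psi>" for \<Psi>
    using majs_vars_append [of \<tau>s ?\<rho>s \<Psi> BLEM \<Gamma>] that len by simp_all
  note tys = maj [OF subset_refl, THEN majs_tys(1)]
  have Yx: "list_all2 (has_ty ?\<Gamma>) (tapps ?Y ?x) ?\<sigma>s"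
    by (rule list_all2_tapps [OF _ tys(2)]) (use tys(1) in \<open>simp add: \<tau>s_def\<close>)
  have wfK: "wf_fm ?\<Gamma> ?K"
    using wf tys by (intro wf_KB) (simp_all add: \<tau>s_def)
  have wfC: "wf_fm (rev ?\<sigma>s @ rev ?\<rho>s @ \<Gamma>) ?C"
  proof (rule wf_U_mat)
    show "wf_pfm (rev ?\<sigma>s @ rev ?\<rho>s @ \<Gamma>) (plift (n + m) A)"
      using A by (rule wf_psubst) (use wt_lift [of "rev ?\<sigma>s @ rev ?\<rho>s" "n + m" \<Gamma>] len in simp)
    show "list_all2 (has_ty (rev ?\<sigma>s @ rev ?\<rho>s @ \<Gamma>)) (map (tlift m) (vars n)) (U_all (plift (n + m) A))"
      using list_all2_tlift [OF list_all2_vars [of ?\<rho>s \<Gamma>], of "rev ?\<sigma>s" m] len by simp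
    show "list_all2 (has_ty (rev ?\<sigma>s @ rev ?\<rho>s @ \<Gamma>)) (vars m) (U_ex (plift (n + m) A))"
      using list_all2_vars [of ?\<sigma>s] len by simp
  qed
  have wfD: "wf_fm ?\<Gamma> ?D"
    unfolding wf_MBExs [OF Yx]
  proof (rule wf_U_mat)
    show "wf_pfm (rev ?\<sigma>s @ ?\<Gamma>) (plift m ?A)" using wf by (rule wf_psubst) (simp add: len)
    show "list_all2 (has_ty (rev ?\<sigma>s @ ?\<Gamma>)) (map (tlift m) (vars n)) (U_all (plift m ?A))"
      using list_all2_tlift [OF tys(2), of "rev ?\<sigma>s" m] len by simp
    show "list_all2 (has_ty (rev ?\<sigma>s @ ?\<Gamma>)) (vars m) (U_ex (plift m ?A))"
      using list_all2_vars [of ?\<sigma>s] len by simp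
  qed
  let ?E = "MExs \<tau>s (MAlls ?\<rho>s ?D)" and ?B = "MExs \<tau>s (MAlls ?\<rho>s ?K)"
  have U: "U_int A = MAlls ?\<rho>s (MExs ?\<sigma>s ?C)"
    by (simp add: U_int_def Let_def m_def n_def)
  have wfs: "wf_fm \<Gamma> ?E" "wf_fm \<Gamma> ?B" "wf_fm \<Gamma> (U_int A)"
    using wfD wfK wfC by (simp_all add: U wf_MExs wf_MAlls)
  have EB: "prv BLEM \<Gamma> {} (Imp ?E ?B)"
  proof (rule ImpI [OF MExs_mono [OF prv_insert] wfs(1)])
    let ?\<Phi> = "insert (MAlls ?\<rho>s ?D) (flift (length \<tau>s) ` {?E} \<union> set (self_maj \<tau>s))"
    show "prv BLEM ?\<Delta> ?\<Phi> (MAlls ?\<rho>s ?K)"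
    proof (rule MAlls_mono [OF prv_insert _ wfD T])
      let ?\<Psi> = "insert ?D (flift (length ?\<rho>s) ` ?\<Phi> \<union> set (self_maj ?\<rho>s))"
      have sub: "set (self_maj (\<tau>s @ ?\<rho>s)) \<subseteq> ?\<Psi>" by (auto simp: self_maj_append)
      have "prv BLEM ?\<Gamma> ?\<Psi> (Neg (KM ?A ?x (tapps ?Y ?x)))"
        by (rule MBExs_U_mat_imp [OF wf])
          (use maj [OF sub] Yx prv_insert [OF wfD] len in simp_all)
      then show "prv BLEM ?\<Gamma> ?\<Psi> ?K" using len by (simp add: KB_PNeg)
    qed (use wfD in \<open>simp add: wf_MAlls\<close>)
  qed (use wfs wfD wfK in \<open>simp_all add: wf_MAlls\<close>)
  have BU: "prv BLEM \<Gamma> {} (Imp ?B (U_int A))"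
  proof (rule ImpI [OF MExs_E [OF prv_insert] wfs(2)])
    let ?\<Phi> = "insert (MAlls ?\<rho>s ?K) (flift (length \<tau>s) ` {?B} \<union> set (self_maj \<tau>s))"
    \<comment> \<open>The matrix of A^U as it appears below Y: the lifting past Y has to pass the
      blocks x and y.\<close>
    let ?C' = "fsubst (upn m (upn n (lift_env m))) ?C"
    have "prv BLEM ?\<Delta> ?\<Phi> (MAlls ?\<rho>s (MExs ?\<sigma>s ?C'))"
    proof (rule MAlls_mono [OF prv_insert _ wfK T])
      let ?\<Psi> = "insert ?K (flift (length ?\<rho>s) ` ?\<Phi> \<union> set (self_maj ?\<rho>s))"
      have sub: "set (self_maj (\<tau>s @ ?\<rho>s)) \<subseteq> ?\<Psi>" by (auto simp: self_maj_append)
      show "prv BLEM ?\<Gamma> ?\<Psi> (MExs ?\<sigma>s ?C')"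
      proof (rule MExs_I)
        have "prv BLEM ?\<Gamma> ?\<Psi> (U_mat ?A ?x (tapps ?Y ?x))"
          using U_mat_iff_KB [OF wf, of ?\<Psi> ?Y ?x] maj [OF sub] prv_insert [OF wfK]
          by (simp add: \<tau>s_def)
        \<comment> \<open>The witness for y is Y x, which is monotone since Y and x are.\<close>
        moreover have "fsubst (extend Var (tapps ?Y ?x)) ?C' = U_mat ?A ?x (tapps ?Y ?x)"
          using len by (simp add: fsubst_U_mat tsubst_extend_upn add.assoc [symmetric] lift_env_def)
        ultimately show "prv BLEM ?\<Gamma> ?\<Psi> (fsubst (extend Var (tapps ?Y ?x)) ?C')" by simp
        show "majs BLEM ?\<Gamma> ?\<Psi> ?\<sigma>s (tapps ?Y ?x) (tapps ?Y ?x)"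
          using maj [OF sub] unfolding \<tau>s_def by (rule majs_tapps)
        have "wt_env (lift_env m) \<Gamma> ?\<Delta>" using len by simp
        from wf_fsubst [OF wfC wt_upn [OF wt_upn [OF this, of ?\<rho>s], of ?\<sigma>s]]
        show "wf_fm (rev ?\<sigma>s @ ?\<Gamma>) ?C'" by (simp only: len)
      qed
    qed (use wfK in \<open>simp add: wf_MAlls\<close>)
    then show "prv BLEM ?\<Delta> ?\<Phi> (flift (length \<tau>s) (U_int A))"
      unfolding U by (simp only: fsubst_MAlls fsubst_MExs len)
  qed (use wfs wfK in \<open>simp_all add: wf_MAlls\<close>)
  let ?T = "\<lambda>\<Delta>. BLEM \<Delta> \<union> bMAC \<Delta>"
  \<comment> \<open>The renaming from the definition of bMAC: x and y keep their indices, and the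
    parameters move up to make room for Y, which has as many components as y.\<close>
  let ?\<theta> = "\<lambda>i. if i < length ?\<rho>s + length ?\<sigma>s then Var i else Var (i + length ?\<sigma>s)"
  have \<theta>: "map (tsubst ?\<theta>) (map (tlift m) (vars n)) = map (tlift m) (vars n)"
    "map (tsubst ?\<theta>) (vars m) = vars m"
    using len by (simp_all add: vars_def)
  have D: "fsubst ?\<theta> ?C = U_mat (plift m ?A) (map (tlift m) (vars n)) (vars m)"
  proof -
    have "psubst ?\<theta> (plift (n + m) A) = plift m ?A"
      using len by (simp add: lift_env_def add_ac)
    with \<theta> show ?thesis
      by (subst fsubst_U_mat) (simp_all only: len length_map length_vars U_psubst)
  qed
  have "Imp (U_int A) ?E \<in> bMAC \<Gamma>"
    unfolding bMAC_def U
  proof (intro CollectI exI conjI)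
    show "wf_fm (rev ?\<sigma>s @ rev ?\<rho>s @ \<Gamma>) ?C" by (rule wfC)
    show "bounded ?C" by (rule bounded_U_mat)
    show "Imp (MAlls ?\<rho>s (MExs ?\<sigma>s ?C)) ?E = Imp (MAlls ?\<rho>s (MExs ?\<sigma>s ?C))
         (MExs (map (funs ?\<rho>s) ?\<sigma>s) (MAlls ?\<rho>s
            (MBExs ?\<sigma>s (tapps (map (tlift (length ?\<rho>s)) (vars (length ?\<sigma>s))) (vars (length ?\<rho>s)))
              (fsubst ?\<theta> ?C))))"
      unfolding D by (simp only: len \<tau>s_def)
  qed
  then have UE: "prv ?T \<Gamma> {} (Imp (U_int A) ?E)" by (intro extra_ax) simp
  have EB': "prv ?T \<Gamma> {} (Imp ?E ?B)" and BU': "prv ?T \<Gamma> {} (Imp ?B (U_int A))"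
    using EB BU by (auto elim: prv_theory_mono)
  have "prv ?T \<Gamma> {} (Imp (U_int A) ?B)"
    using ImpI [OF ImpE [OF prv_weaken [OF EB'] ImpE [OF prv_weaken [OF UE] prv_insert [OF wfs(3)]]] wfs(3)] .
  then have "prv ?T \<Gamma> {} (Iff (U_int A) ?B)" using BU' by (rule AndI)
  then show ?thesis by (simp only: krivine_mat)
qed

theorem mainTheorem1:
  fixes \<Gamma> :: "ty list" and A :: pfm
  assumes "wf_pfm \<Gamma> A"
  shows "let xtys = U_all A; Ytys = map (funs (U_all A)) (U_ex A);
             m = length Ytys; n = length xtys;
             Y = map (tlift n) (vars m); x = vars n
         in B_ex (krivine A) = Ytys \<and> B_all (krivine A) = xtys \<and>
            B_int (krivine A) = MExs Ytys (MAlls xtys (B_mat (flift (m + n) (krivine A)) Y x)) \<and>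
            prv BLEM \<Gamma> {}
              (MAlls (Ytys @ xtys)
                (Iff (U_mat (plift (m + n) A) x (tapps Y x))
                     (B_mat (flift (m + n) (krivine A)) Y x))) \<and>
            prv (\<lambda>\<Delta>. BLEM \<Delta> \<union> bMAC \<Delta>) \<Gamma> {} (Iff (U_int A) (B_int (krivine A)))"
proof -
  have ex: "B_ex (krivine A) = map (funs (U_all A)) (U_ex A)" and all: "B_all (krivine A) = U_all A"
    by (simp_all add: krivine_def)
  then show ?thesis
    using prv_U_mat_iff_B_mat [OF assms] prv_U_int_iff [OF assms]
    by (simp only: Let_def B_int_def length_map)
qed

end
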